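(* Let $\Theta$ satisfy the hypothesis recalled in the context. Let $0\le r\le T$ and $y\in\mathbb R^n$. The set $$\mathcal Q^\Theta_{r,y}=\{Q^\gamma_{r,y}\;:\;\gamma\in\Theta^r_T\}$$ is a stable set of probability measures on $(\Omega^r,\mathcal B^r_T)$ (with the regular conditional distributions $T^{Q}_s=T^\gamma_s$ for $Q=Q^\gamma_{r,y}$). More precisely, let $Q=Q^\gamma_{r,y}$ and $R=Q^\delta_{r,y}$ be in $\mathcal Q^\Theta_{r,y}$, let $s\in[r,T]$ and $A\in\mathcal B^r_s$. i) Let $\lambda(u,\omega)=\gamma(u,\omega)$ for all $r\le u<s$ and $\lambda(u,\omega)=\delta(u,\omega)$ for all $s\le u<T$. The probability measure $S=Q^\lambda_{r,y}$ satisfies $T^S_u=T^R_u$ for all $s\le u\le T$, and $T^S_u(\phi)=T^Q_u(\phi)$ for all $r\le u<s$ and all bounded $\mathcal B^r_s$-measurable $\phi$. ii) Let $\eta(u,\omega)=\gamma(u,\omega)$ for all $r\le u<s$ and $\eta(u,\omega)=1_A(\omega)\gamma(u,\omega)+1_{A^c}(\omega)\delta(u,\omega)$ for all $s\le u<T$. The probability measure $S=Q^\eta_{r,y}$ satisfies $T^S_u=1_AT^Q_u+1_{A^c}T^R_u$ for all $s\le u\le T$.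
   Context: Fix $n\ge1$ and a finite horizon $T>0$. For $0\le r\le t\le T$, $\Omega^r_t$ denotes either (for all $r,t$) the space $C([r,t],\mathbb R^n)$ of continuous paths with the topology of uniform convergence, or (for all $r,t$) the space $D([r,t],\mathbb R^n)$ of càdlàg paths with the Skorokhod topology; $\Omega^r=\Omega^r_T$; $X_u(\omega)=\omega(u)$; $\mathcal B^r_t$ is the $\sigma$-algebra generated by $X_u$, $r\le u\le t$. Functions of the path on a smaller interval are regarded as functions on larger path spaces through restriction of paths. A martingale problem is a family $Z=(Z^k)_{k\in I}$ of real processes $Z^k=(Z^k_{r,t})_{0\le r\le t\le T}$ on path space. It is additive if $Z^k_{r,s}$ is $\mathcal B^r_s$-measurable, right continuous in $s$, and $Z^k_{r,t}=Z^k_{r,s}+Z^k_{s,t}$ for $r\le s\le t$; it is bounded if every $Z^k_{r,t}$ is bounded. A probability measure $Q$ on $(\Omega^r_t,\mathcal B^r_t)$ is a solution to $Z$ starting from $y$ at time $r$ if $Q(X_r=y)=1$ and for every $k$, $(Z^k_{r,u})_{r\le u\le t}$ is a $Q$-martingale for $(\mathcal B^r_u)_u$. Hypothesis on $\Theta$: $\Theta$ is a set of Borel maps on $\mathbb R_+\times\mathbb R^n$ with values in a topological space $E$; to each $\theta\in\Theta$ is associated an additive bounded martingale problem $Z^\theta=(Z^{\theta,k})_{k\in I}$ (same index set $I$ for all $\theta$) such that (1) for all $\theta\in\Theta$, $0\le r<t\le T$, $y\in\mathbb R^n$ there is a unique solution $Q^\theta_{r,y}$ on $(\Omega^r_t,\mathcal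 B^r_t)$ to $Z^\theta$ starting from $y$ at time $r$; (2) for all $\theta\in\Theta$ and $r<T$, $y\mapsto Q^\theta_{r,y}$ is weakly continuous. $\Theta^r_T$ is the set of predictable $E$-valued processes $\gamma$ on $(\Omega^r,\mathcal B^r_T)$ (with its filtration $(\mathcal B^r_u)_{r\le u\le T}$) for which there are a finite subdivision $r=s_0<s_1<\dots<s_N=T$, finite sets $I_i$ with $I_0=\{1\}$, finite partitions $(A_{i,j})_{j\in I_i}$ of $\Omega^r$ into $\mathcal B^r_{s_i}$-measurable sets, and $\theta_{i,j}\in\Theta$ such that $\gamma(u,\omega)=\sum_{j\in I_i}\theta_{i,j}(u,X_u(\omega))1_{A_{i,j}}(\omega)$ for $s_i\le u<s_{i+1}$. $1_A\gamma+1_{A^c}\delta$ denotes the process equal to $\gamma$ on $A$ and $\delta$ on $A^c$. $Z^\gamma$ is the additive family determined by $Z^{\gamma,k}_{s_i,u}=\sum_{j\in I_i}Z^{\theta_{i,j},k}_{s_i,u}1_{A_{i,j}}$ for $s_i\le u\le s_{i+1}$. There is a unique solution $Q^\gamma_{r,y}$ on $(\Omega^r,\mathcal B^r_T)$ to $Z^\gamma$ starting from $y$ at time $r$. Canonical conditional expectations: for $\theta\in\Theta$, $s<T$, $\psi$ bounded $\mathcal B^r_T$-measurable, $T^\theta_s(\psi)(\omega)=\int_{\Omega^s_T}\psi(i(\omega_{|[r,s]},\omega'))\,dQ^\theta_{s,X_s(\omega)}(\omega')$, where $i(\omega,\omega')(u)=\omega(u)$ for $r\le u\le s$ and $\omega'(u)+\omega(s)-\omega'(s)$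 for $s\le u\le T$. For $\gamma\in\Theta^r_T$: $T^\gamma_T=\mathrm{id}$ and, for $s_i\le s<s_{i+1}$, $T^\gamma_s(\psi)=\sum_{j\in I_i}1_{A_{i,j}}T^{\theta_{i,j}}_s\big(T^\gamma_{s_{i+1}}(\psi)\big)$ (downward recursion). Stable set: let $(\mathcal B_b)^r_s$ be the set of bounded $\mathcal B^r_s$-measurable functions on $\Omega^r$. A set $\mathcal Q$ of probability measures on $(\Omega^r,\mathcal B^r_T)$ is stable if: (1) for all $Q\in\mathcal Q$, $r\le s\le T$, there is a non-negative linear map $T^Q_s:(\mathcal B_b)^r_T\to(\mathcal B_b)^r_s$, continuous from below, such that for all $\psi\in(\mathcal B_b)^r_T$, $T^Q_s(\psi)$ is a version of the $Q$-conditional expectation of $\psi$ given $\mathcal B^r_s$; (2) $T^Q_s(\psi)=T^Q_s(T^Q_t(\psi))$ for all $\psi\in(\mathcal B_b)^r_T$ and $r\le s\le t\le T$; (3) for all $Q,R\in\mathcal Q$ and $s\in[r,T]$ there is $S\in\mathcal Q$ with $T^S_u=T^R_u$ for all $s\le u\le T$ and $T^S_u(\phi)=T^Q_u(\phi)$ for all $r\le u<s$, $\phi\in(\mathcal B_b)^r_s$; (4) for all $s\in[r,T]$, $Q,R\in\mathcal Q$, $A\in\mathcal B^r_s$ there is $S\in\mathcal Q$ with $T^S_u=1_AT^Q_u+1_{A^c}T^R_u$ for all $s\le u\le T$.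
   Formalization: Each Q^γ is paired with its own T^γ, as the measure alone does not determine T^γ; γ carries its subdivision, cells and θ_{i,j}; at s=r, η may have several initial cells (same measures); on càdlàg paths progressive measurability replaces predictability. *)

theory Defs
  imports "HOL-Probability.Probability"
begin

section \<open>Path spaces\<close>

text \<open>A path on $[r,t]$ is a function on \<open>real\<close> which is \<open>undefined\<close> outside \<open>{r..t}\<close>
  (\<^const>\<open>extensional\<close>), so that equality of paths is equality on $[r,t]$ and restricting
  a path to a smaller interval is \<^const>\<open>restrict\<close>.\<close>

type_synonym 'n path = "real \<Rightarrow> real ^ 'n"

datatype path_kind = Continuous | Cadlag

definition cadlag_on :: "real \<Rightarrow> real \<Rightarrow> ('n::finite) path \<Rightarrow> bool" where
  "cadlag_on r t \<omega> \<longleftrightarrow>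
     (\<forall>u\<in>{r..<t}. (\<omega> \<longlongrightarrow> \<omega> u) (at_right u)) \<and>
     (\<forall>u\<in>{r<..t}. \<exists>l. (\<omega> \<longlongrightarrow> l) (at_left u))"

definition Paths :: "path_kind \<Rightarrow> real \<Rightarrow> real \<Rightarrow> ('n::finite) path set" where
  "Paths pk r t = {\<omega> \<in> extensional {r..t}.
     (case pk of Continuous \<Rightarrow> continuous_on {r..t} \<omega> | Cadlag \<Rightarrow> cadlag_on r t \<omega>)}"

text \<open>For \<^const>\<open>Continuous\<close> the balls of the uniform metric. For \<^const>\<open>Cadlag\<close> the balls of
  Skorokhod's ($J_1$) metric: a time change of $[r,t]$ uniformly close to the identity
  brings \<open>\<omega>'\<close> uniformly close to \<open>\<omega>\<close>.\<close>

definition path_near ::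
    "path_kind \<Rightarrow> real \<Rightarrow> real \<Rightarrow> real \<Rightarrow> ('n::finite) path \<Rightarrow> 'n path \<Rightarrow> bool" where
  "path_near pk r t e \<omega> \<omega>' \<longleftrightarrow>
     (case pk of
        Continuous \<Rightarrow> (\<forall>u\<in>{r..t}. dist (\<omega> u) (\<omega>' u) < e)
      | Cadlag \<Rightarrow> (\<exists>c. strict_mono_on {r..t} c \<and> c ` {r..t} = {r..t} \<and>
                     (\<forall>u\<in>{r..t}. \<bar>c u - u\<bar> < e \<and> dist (\<omega> u) (\<omega>' (c u)) < e)))"

definition path_topology :: "path_kind \<Rightarrow> real \<Rightarrow> real \<Rightarrow> ('n::finite) path topology" where
  "path_topology pk r t = topology (\<lambda>U. U \<subseteq> Paths pk r t \<and>
     (\<forall>\<omega>\<in>U. \<exists>e>0. \<forall>\<omega>'\<in>Paths pk r t. path_near pk r t e \<omega> \<omega>' \<longrightarrow> \<omega>' \<in> U))"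

lemma path_near_mono:
  "path_near pk r t e \<omega> \<omega>' \<Longrightarrow> e \<le> e' \<Longrightarrow> path_near pk r t e' \<omega> \<omega>'"
  unfolding path_near_def by (cases pk) (auto 0 4 dest: less_le_trans)

lemma openin_path_topology:
  fixes U :: "('n::finite) path set"
  shows "openin (path_topology pk r t) U \<longleftrightarrow> U \<subseteq> Paths pk r t \<and>
     (\<forall>\<omega>\<in>U. \<exists>e>0. \<forall>\<omega>'\<in>Paths pk r t. path_near pk r t e \<omega> \<omega>' \<longrightarrow> \<omega>' \<in> U)"
proof -
  let ?P = "\<lambda>U :: 'n path set. U \<subseteq> Paths pk r t \<and>
     (\<forall>\<omega>\<in>U. \<exists>e>0. \<forall>\<omega>'\<in>Paths pk r t. path_near pk r t e \<omega> \<omega>' \<longrightarrow> \<omega>' \<in> U)"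
  have "istopology ?P"
    unfolding istopology_def
  proof (intro conjI allI impI)
    fix S U :: "'n path set" assume S: "?P S" and U: "?P U"
    show "S \<inter> U \<subseteq> Paths pk r t" using S by blast
    show "\<forall>\<omega>\<in>S \<inter> U. \<exists>e>0. \<forall>\<omega>'\<in>Paths pk r t. path_near pk r t e \<omega> \<omega>' \<longrightarrow> \<omega>' \<in> S \<inter> U"
    proof
      fix \<omega> assume w: "\<omega> \<in> S \<inter> U"
      obtain a where a: "a > 0" "\<forall>\<omega>'\<in>Paths pk r t. path_near pk r t a \<omega> \<omega>' \<longrightarrow> \<omega>' \<in> S"
        using S w by blast
      obtain b where b: "b > 0" "\<forall>\<omega>'\<in>Paths pk r t. path_near pk r t b \<omega> \<omega>' \<longrightarrow> \<omega>' \<in> U"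
        using U w by blast
      show "\<exists>e>0. \<forall>\<omega>'\<in>Paths pk r t. path_near pk r t e \<omega> \<omega>' \<longrightarrow> \<omega>' \<in> S \<inter> U"
        by (rule exI[of _ "min a b"])
           (use a b in \<open>auto dest: path_near_mono[where e' = a] path_near_mono[where e' = b]\<close>)
    qed
  next
    fix \<K> :: "'n path set set" assume K: "\<forall>U\<in>\<K>. ?P U"
    show "\<Union>\<K> \<subseteq> Paths pk r t" using K by blast
    show "\<forall>\<omega>\<in>\<Union>\<K>. \<exists>e>0. \<forall>\<omega>'\<in>Paths pk r t. path_near pk r t e \<omega> \<omega>' \<longrightarrow> \<omega>' \<in> \<Union>\<K>"
      using K by (meson Union_iff)
  qed
  then show ?thesis
    unfolding path_topology_def by (simp add: topology_inverse')
qed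

text \<open>\<open>path_alg pk r t u\<close> is the $\sigma$-algebra ${\cal B}^r_u$ on $\Omega^r_t$, for $u \le t$;
  the space $(\Omega^r_t, {\cal B}^r_t)$ is \<open>path_alg pk r t t\<close>.\<close>

definition path_alg :: "path_kind \<Rightarrow> real \<Rightarrow> real \<Rightarrow> real \<Rightarrow> ('n::finite) path measure" where
  "path_alg pk r t u =
     sigma (Paths pk r t) {{\<omega> \<in> Paths pk r t. \<omega> v \<in> B} | v B. v \<in> {r..u} \<and> B \<in> sets borel}"

section \<open>Martingale problems\<close>

text \<open>A family \<open>Z\<close> has type \<open>'k \<Rightarrow> real \<Rightarrow> real \<Rightarrow> 'n path \<Rightarrow> real\<close>; \<open>Z k r t\<close> is a function on
  $\Omega^r_t$. The operator \<open>on_paths\<close> turns it into a function of paths on larger intervals.\<close>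

definition on_paths ::
    "('k \<Rightarrow> real \<Rightarrow> real \<Rightarrow> ('n::finite) path \<Rightarrow> real) \<Rightarrow> 'k \<Rightarrow> real \<Rightarrow> real \<Rightarrow> 'n path \<Rightarrow> real" where
  "on_paths Z k a b \<omega> = Z k a b (restrict \<omega> {a..b})"

definition additive_problem ::
    "path_kind \<Rightarrow> real \<Rightarrow> 'k set \<Rightarrow> ('k \<Rightarrow> real \<Rightarrow> real \<Rightarrow> ('n::finite) path \<Rightarrow> real) \<Rightarrow> bool" where
  "additive_problem pk T I Z \<longleftrightarrow> (\<forall>k\<in>I. \<forall>r\<in>{0..T}.
     (\<forall>s\<in>{r..T}. Z k r s \<in> borel_measurable (path_alg pk r s s)) \<and>
     (\<forall>s\<in>{r..<T}. \<forall>\<omega>\<in>Paths pk r T.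
        ((\<lambda>u. on_paths Z k r u \<omega>) \<longlongrightarrow> on_paths Z k r s \<omega>) (at_right s)) \<and>
     (\<forall>t\<in>{r..T}. \<forall>s\<in>{r..t}. \<forall>\<omega>\<in>Paths pk r t.
        on_paths Z k r t \<omega> = on_paths Z k r s \<omega> + on_paths Z k s t \<omega>))"

definition bounded_problem ::
    "path_kind \<Rightarrow> real \<Rightarrow> 'k set \<Rightarrow> ('k \<Rightarrow> real \<Rightarrow> real \<Rightarrow> ('n::finite) path \<Rightarrow> real) \<Rightarrow> bool" where
  "bounded_problem pk T I Z \<longleftrightarrow>
     (\<forall>k\<in>I. \<forall>r\<in>{0..T}. \<forall>t\<in>{r..T}. bounded (Z k r t ` Paths pk r t))"

definition martingale_on ::
    "'a measure \<Rightarrow> (real \<Rightarrow> 'a measure) \<Rightarrow> real set \<Rightarrow> (real \<Rightarrow> 'a \<Rightarrow> real) \<Rightarrow> bool" where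
  "martingale_on Q F J M \<longleftrightarrow>
     (\<forall>u\<in>J. M u \<in> borel_measurable (F u) \<and> integrable Q (M u)) \<and>
     (\<forall>u\<in>J. \<forall>v\<in>J. u \<le> v \<longrightarrow> (AE \<omega> in Q. real_cond_exp Q (F u) (M v) \<omega> = M u \<omega>))"

definition prob_on :: "'a measure \<Rightarrow> 'a measure \<Rightarrow> bool" where
  "prob_on B Q \<longleftrightarrow> prob_space Q \<and> sets Q = sets B"

text \<open>Here \<open>W k r u\<close> is a function on $\Omega^r_t$ (the problem of a single \<open>\<theta>\<close> enters as
  \<open>on_paths (Z \<theta>)\<close>).\<close>

definition is_solution ::
    "path_kind \<Rightarrow> real \<Rightarrow> real \<Rightarrow> 'k set \<Rightarrow> ('k \<Rightarrow> real \<Rightarrow> real \<Rightarrow> ('n::finite) path \<Rightarrow> real)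
       \<Rightarrow> real ^ 'n \<Rightarrow> 'n path measure \<Rightarrow> bool" where
  "is_solution pk r t I W y Q \<longleftrightarrow>
     prob_on (path_alg pk r t t) Q \<and>
     measure Q {\<omega> \<in> space Q. \<omega> r = y} = 1 \<and>
     (\<forall>k\<in>I. martingale_on Q (path_alg pk r t) {r..t} (W k r))"

section \<open>The hypothesis on \<open>\<Theta>\<close>\<close>

type_synonym ('n, 'e) coefficient = "real \<times> (real ^ 'n) \<Rightarrow> 'e"

type_synonym ('n, 'e, 'k) problems =
  "('n, 'e) coefficient \<Rightarrow> 'k \<Rightarrow> real \<Rightarrow> real \<Rightarrow> 'n path \<Rightarrow> real"

definition Q_theta ::
    "path_kind \<Rightarrow> real \<Rightarrow> 'k set \<Rightarrow> ('n::finite, 'e, 'k) problems \<Rightarrow> ('n, 'e) coefficient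
       \<Rightarrow> real \<Rightarrow> real ^ 'n \<Rightarrow> 'n path measure" where
  "Q_theta pk T I Z \<theta> s x = (THE Q. is_solution pk s T I (on_paths (Z \<theta>)) x Q)"

definition weakly_continuous ::
    "path_kind \<Rightarrow> real \<Rightarrow> real \<Rightarrow> (real ^ 'n \<Rightarrow> ('n::finite) path measure) \<Rightarrow> bool" where
  "weakly_continuous pk r t q \<longleftrightarrow>
     (\<forall>f. continuous_map (path_topology pk r t) euclideanreal f \<and> bounded (f ` Paths pk r t)
        \<longrightarrow> continuous_on UNIV (\<lambda>y. \<integral>\<omega>. f \<omega> \<partial>q y))"

definition Theta_hypothesis ::
    "path_kind \<Rightarrow> real \<Rightarrow> ('n::finite, 'e::topological_space) coefficient set \<Rightarrow> 'k set
       \<Rightarrow> ('n, 'e, 'k) problems \<Rightarrow> bool" where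
  "Theta_hypothesis pk T \<Theta> I Z \<longleftrightarrow> (\<forall>\<theta>\<in>\<Theta>.
     \<theta> \<in> borel_measurable (restrict_space borel ({0..} \<times> UNIV)) \<and>
     additive_problem pk T I (Z \<theta>) \<and>
     bounded_problem pk T I (Z \<theta>) \<and>
     (\<forall>r t y. 0 \<le> r \<and> r < t \<and> t \<le> T \<longrightarrow> (\<exists>!Q. is_solution pk r t I (on_paths (Z \<theta>)) y Q)) \<and>
     (\<forall>r. 0 \<le> r \<and> r < T \<longrightarrow> weakly_continuous pk r T (Q_theta pk T I Z \<theta> r)))"

section \<open>Step processes\<close>

text \<open>Since distinct elements of \<open>\<Theta>\<close> may coincide on part of $[0,T] \times \mathbb{R}^n$ while their
  martingale problems are unrelated, the problem $Z^\gamma$ and the operators $T^\gamma_s$ depend on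
  which \<open>\<theta>\<close> is used where, and not only on the \<open>'e\<close>-valued process $\gamma$. An element $\gamma$
  is therefore given with its data $N$, $s_i$, $I_i$, $A_{i,j}$, $\theta_{i,j}$. The function
  \<open>used_coef\<close> returns the $\theta_{i,j}$ in force at time \<open>u\<close> on the path \<open>\<omega>\<close>, and \<open>process\<close> is
  the resulting \<open>'e\<close>-valued process $\gamma(u,\omega)$.\<close>

record ('n, 'e) step_process =
  nsteps :: nat
  node :: "nat \<Rightarrow> real"
  idx :: "nat \<Rightarrow> nat set"
  cell :: "nat \<Rightarrow> nat \<Rightarrow> ('n::finite) path set"
  coef :: "nat \<Rightarrow> nat \<Rightarrow> ('n, 'e) coefficient"

definition step_at :: "('n::finite, 'e) step_process \<Rightarrow> real \<Rightarrow> nat" where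
  "step_at \<gamma> u = (THE i. i < nsteps \<gamma> \<and> node \<gamma> i \<le> u \<and> u < node \<gamma> (Suc i))"

definition used_coef ::
    "('n::finite, 'e) step_process \<Rightarrow> real \<Rightarrow> 'n path \<Rightarrow> ('n, 'e) coefficient" where
  "used_coef \<gamma> u \<omega> =
     (let i = step_at \<gamma> u in coef \<gamma> i (THE j. j \<in> idx \<gamma> i \<and> \<omega> \<in> cell \<gamma> i j))"

definition process :: "('n::finite, 'e) step_process \<Rightarrow> real \<Rightarrow> 'n path \<Rightarrow> 'e" where
  "process \<gamma> u \<omega> = used_coef \<gamma> u \<omega> (u, \<omega> u)"

definition predictable_alg ::
    "path_kind \<Rightarrow> real \<Rightarrow> real \<Rightarrow> (real \<times> ('n::finite) path) measure" where
  "predictable_alg pk T r = sigma ({r..<T} \<times> Paths pk r T)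
     ({({r} \<inter> {..<T}) \<times> A | A. A \<in> sets (path_alg pk r T r)} \<union>
      {{a<..b} \<times> A | a b A. r \<le> a \<and> a \<le> b \<and> b < T \<and> A \<in> sets (path_alg pk r T a)})"

text \<open>Predictability in the usual sense on the space of continuous paths. On the space of cadlag
  paths the coordinate process, and processes of the form $1_{[s,t)}(u) 1_A$ with
  $A \in {\cal B}^r_s$, are not predictable in general; there progressive measurability takes
  its place.\<close>

definition predictable_process ::
    "path_kind \<Rightarrow> real \<Rightarrow> real \<Rightarrow> (real \<Rightarrow> ('n::finite) path \<Rightarrow> 'e::topological_space) \<Rightarrow> bool" where
  "predictable_process pk T r p \<longleftrightarrow>
     (case pk of
        Continuous \<Rightarrow> (\<lambda>(u, \<omega>). p u \<omega>) \<in> borel_measurable (predictable_alg pk T r)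
      | Cadlag \<Rightarrow> (\<forall>t\<in>{r..<T}. (\<lambda>(u, \<omega>). p u \<omega>)
                     \<in> borel_measurable (restrict_space borel {r..t} \<Otimes>\<^sub>M path_alg pk r T t)))"

text \<open>The set \<open>Theta_T\<close> is $\Theta^r_T$. In \<open>Theta_ext\<close> the requirement $I_0 = \{1\}$ is
  dropped: $\Theta^r_T$ is closed under passing to $1_A \gamma + 1_{A^c} \delta$ from time $s$ on
  if $s > r$, but for $s = r$ this process has two cells on its first interval. The larger class
  yields no new measures: the cells at time $r$ are events of $X_r$, and $X_r = y$ almost surely.\<close>

definition Theta_ext ::
    "path_kind \<Rightarrow> real \<Rightarrow> ('n::finite, 'e::topological_space) coefficient set \<Rightarrow> real
       \<Rightarrow> ('n, 'e) step_process set" where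
  "Theta_ext pk T \<Theta> r = {\<gamma>.
     node \<gamma> 0 = r \<and> node \<gamma> (nsteps \<gamma>) = T \<and>
     (\<forall>i<nsteps \<gamma>.
        node \<gamma> i < node \<gamma> (Suc i) \<and>
        finite (idx \<gamma> i) \<and>
        (\<Union>j\<in>idx \<gamma> i. cell \<gamma> i j) = Paths pk r T \<and>
        disjoint_family_on (cell \<gamma> i) (idx \<gamma> i) \<and>
        (\<forall>j\<in>idx \<gamma> i. cell \<gamma> i j \<in> sets (path_alg pk r T (node \<gamma> i)) \<and> coef \<gamma> i j \<in> \<Theta>)) \<and>
     predictable_process pk T r (process \<gamma>)}"

definition Theta_T ::
    "path_kind \<Rightarrow> real \<Rightarrow> ('n::finite, 'e::topological_space) coefficient set \<Rightarrow> real
       \<Rightarrow> ('n, 'e) step_process set" where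
  "Theta_T pk T \<Theta> r = {\<gamma> \<in> Theta_ext pk T \<Theta> r. idx \<gamma> 0 = {1}}"

text \<open>The additive family $Z^{\gamma,k}_{s,u}$: the sum over \<open>i\<close> of the increments of
  $\sum_j 1_{A_{i,j}} Z^{\theta_{i,j},k}$ over $[s,u] \cap [s_i, s_{i+1}]$.\<close>

definition Z_step ::
    "('n::finite, 'e, 'k) problems \<Rightarrow> ('n, 'e) step_process \<Rightarrow> 'k \<Rightarrow> real \<Rightarrow> real \<Rightarrow> 'n path \<Rightarrow> real" where
  "Z_step Z \<gamma> k s u \<omega> = (\<Sum>i<nsteps \<gamma>.
     let a = max s (node \<gamma> i); b = min u (node \<gamma> (Suc i)) in
     if a \<le> b then \<Sum>j\<in>idx \<gamma> i. indicator (cell \<gamma> i j) \<omega> * on_paths (Z (coef \<gamma> i j)) k a b \<omega>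
     else 0)"

definition Q_step ::
    "path_kind \<Rightarrow> real \<Rightarrow> 'k set \<Rightarrow> ('n::finite, 'e, 'k) problems \<Rightarrow> real \<Rightarrow> real ^ 'n
       \<Rightarrow> ('n, 'e) step_process \<Rightarrow> 'n path measure" where
  "Q_step pk T I Z r y \<gamma> = (THE Q. is_solution pk r T I (Z_step Z \<gamma>) y Q)"

section \<open>Canonical conditional expectations\<close>

definition paste :: "real \<Rightarrow> real \<Rightarrow> real \<Rightarrow> ('n::finite) path \<Rightarrow> 'n path \<Rightarrow> 'n path" where
  "paste r s T \<omega> \<omega>' =
     restrict (\<lambda>u. if u \<le> s then \<omega> u else \<omega>' u + \<omega> s - \<omega>' s) {r..T}"

definition T_theta ::
    "path_kind \<Rightarrow> real \<Rightarrow> 'k set \<Rightarrow> ('n::finite, 'e, 'k) problems \<Rightarrow> real \<Rightarrow> ('n, 'e) coefficient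
       \<Rightarrow> real \<Rightarrow> ('n path \<Rightarrow> real) \<Rightarrow> 'n path \<Rightarrow> real" where
  "T_theta pk T I Z r \<theta> s \<psi> \<omega> = (\<integral>\<omega>'. \<psi> (paste r s T \<omega> \<omega>') \<partial>Q_theta pk T I Z \<theta> s (\<omega> s))"

definition T_mix ::
    "path_kind \<Rightarrow> real \<Rightarrow> 'k set \<Rightarrow> ('n::finite, 'e, 'k) problems \<Rightarrow> real \<Rightarrow> ('n, 'e) step_process
       \<Rightarrow> nat \<Rightarrow> real \<Rightarrow> ('n path \<Rightarrow> real) \<Rightarrow> 'n path \<Rightarrow> real" where
  "T_mix pk T I Z r \<gamma> i s \<psi> \<omega> =
     (\<Sum>j\<in>idx \<gamma> i. indicator (cell \<gamma> i j) \<omega> * T_theta pk T I Z r (coef \<gamma> i j) s \<psi> \<omega>)"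

text \<open>\<open>T_back pk T I Z r \<gamma> \<psi> m\<close> is $T^\gamma_{s_{N-m}}(\psi)$.\<close>

primrec T_back ::
    "path_kind \<Rightarrow> real \<Rightarrow> 'k set \<Rightarrow> ('n::finite, 'e, 'k) problems \<Rightarrow> real \<Rightarrow> ('n, 'e) step_process
       \<Rightarrow> ('n path \<Rightarrow> real) \<Rightarrow> nat \<Rightarrow> 'n path \<Rightarrow> real" where
  "T_back pk T I Z r \<gamma> \<psi> 0 = \<psi>"
| "T_back pk T I Z r \<gamma> \<psi> (Suc m) =
     (let i = nsteps \<gamma> - Suc m in T_mix pk T I Z r \<gamma> i (node \<gamma> i) (T_back pk T I Z r \<gamma> \<psi> m))"

definition T_step ::
    "path_kind \<Rightarrow> real \<Rightarrow> 'k set \<Rightarrow> ('n::finite, 'e, 'k) problems \<Rightarrow> real \<Rightarrow> ('n, 'e) step_process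
       \<Rightarrow> real \<Rightarrow> ('n path \<Rightarrow> real) \<Rightarrow> 'n path \<Rightarrow> real" where
  "T_step pk T I Z r \<gamma> s \<psi> =
     (if s = T then \<psi>
      else let i = step_at \<gamma> s
           in T_mix pk T I Z r \<gamma> i s (T_back pk T I Z r \<gamma> \<psi> (nsteps \<gamma> - Suc i)))"

section \<open>Stable sets\<close>

definition Bb :: "path_kind \<Rightarrow> real \<Rightarrow> real \<Rightarrow> real \<Rightarrow> (('n::finite) path \<Rightarrow> real) set" where
  "Bb pk T r s =
     {\<psi>. \<psi> \<in> borel_measurable (path_alg pk r T s) \<and> bounded (\<psi> ` Paths pk r T)}"

type_synonym 'n operators = "real \<Rightarrow> ('n path \<Rightarrow> real) \<Rightarrow> 'n path \<Rightarrow> real"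

definition nonneg_linear_below ::
    "path_kind \<Rightarrow> real \<Rightarrow> real \<Rightarrow> real \<Rightarrow> ((('n::finite) path \<Rightarrow> real) \<Rightarrow> 'n path \<Rightarrow> real) \<Rightarrow> bool" where
  "nonneg_linear_below pk T r s L \<longleftrightarrow>
     (\<forall>\<psi>\<in>Bb pk T r T. L \<psi> \<in> Bb pk T r s) \<and>
     (\<forall>\<psi>\<in>Bb pk T r T. \<forall>\<phi>\<in>Bb pk T r T. \<forall>a b. \<forall>\<omega>\<in>Paths pk r T.
        L (\<lambda>\<omega>. a * \<psi> \<omega> + b * \<phi> \<omega>) \<omega> = a * L \<psi> \<omega> + b * L \<phi> \<omega>) \<and>
     (\<forall>\<psi>\<in>Bb pk T r T. (\<forall>\<omega>\<in>Paths pk r T. 0 \<le> \<psi> \<omega>) \<longrightarrow> (\<forall>\<omega>\<in>Paths pk r T. 0 \<le> L \<psi> \<omega>)) \<and>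
     (\<forall>f. \<forall>\<psi>\<in>Bb pk T r T. (\<forall>m. f m \<in> Bb pk T r T) \<and>
        (\<forall>\<omega>\<in>Paths pk r T. incseq (\<lambda>m. f m \<omega>) \<and> (\<lambda>m. f m \<omega>) \<longlonglongrightarrow> \<psi> \<omega>)
        \<longrightarrow> (\<forall>\<omega>\<in>Paths pk r T. (\<lambda>m. L (f m) \<omega>) \<longlonglongrightarrow> L \<psi> \<omega>))"

text \<open>Stability of the set \<open>\<Q>\<close> of measures, with the conditional expectations recorded in the set
  \<open>K\<close> of pairs $(Q, T^Q)$. Pairs are needed because conditions (3) and (4) are equalities at
  every path: different choices of $\gamma$ may give one and the same measure $Q$ and
  operators $T^\gamma$ that differ on a $Q$-null set of paths.\<close>

definition stable_set_with ::
    "path_kind \<Rightarrow> real \<Rightarrow> real \<Rightarrow> ('n::finite) path measure set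
       \<Rightarrow> ('n path measure \<times> 'n operators) set \<Rightarrow> bool" where
  "stable_set_with pk T r \<Q> K \<longleftrightarrow>
     fst ` K = \<Q> \<and>
     (\<forall>(Q, TQ)\<in>K. prob_on (path_alg pk r T T) Q) \<and>
     (\<forall>(Q, TQ)\<in>K. \<forall>s\<in>{r..T}.
        nonneg_linear_below pk T r s (TQ s) \<and>
        (\<forall>\<psi>\<in>Bb pk T r T.
           AE \<omega> in Q. real_cond_exp Q (path_alg pk r T s) \<psi> \<omega> = TQ s \<psi> \<omega>)) \<and>
     (\<forall>(Q, TQ)\<in>K. \<forall>t\<in>{r..T}. \<forall>s\<in>{r..t}. \<forall>\<psi>\<in>Bb pk T r T. \<forall>\<omega>\<in>Paths pk r T.
        TQ s \<psi> \<omega> = TQ s (TQ t \<psi>) \<omega>) \<and>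
     (\<forall>(Q, TQ)\<in>K. \<forall>(R, TR)\<in>K. \<forall>s\<in>{r..T}. \<exists>(S, TS)\<in>K.
        (\<forall>u\<in>{s..T}. \<forall>\<psi>\<in>Bb pk T r T. \<forall>\<omega>\<in>Paths pk r T. TS u \<psi> \<omega> = TR u \<psi> \<omega>) \<and>
        (\<forall>u\<in>{r..<s}. \<forall>\<phi>\<in>Bb pk T r s. \<forall>\<omega>\<in>Paths pk r T. TS u \<phi> \<omega> = TQ u \<phi> \<omega>)) \<and>
     (\<forall>(Q, TQ)\<in>K. \<forall>(R, TR)\<in>K. \<forall>s\<in>{r..T}. \<forall>A\<in>sets (path_alg pk r T s). \<exists>(S, TS)\<in>K.
        \<forall>u\<in>{s..T}. \<forall>\<psi>\<in>Bb pk T r T. \<forall>\<omega>\<in>Paths pk r T.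
          TS u \<psi> \<omega> = indicator A \<omega> * TQ u \<psi> \<omega> + indicator (- A) \<omega> * TR u \<psi> \<omega>)"

definition Q_set ::
    "path_kind \<Rightarrow> real \<Rightarrow> ('n::finite, 'e::topological_space) coefficient set \<Rightarrow> 'k set
       \<Rightarrow> ('n, 'e, 'k) problems \<Rightarrow> real \<Rightarrow> real ^ 'n \<Rightarrow> 'n path measure set" where
  "Q_set pk T \<Theta> I Z r y = Q_step pk T I Z r y ` Theta_T pk T \<Theta> r"

section \<open>Splicing of step processes\<close>

definition splices ::
    "path_kind \<Rightarrow> real \<Rightarrow> real \<Rightarrow> real \<Rightarrow> ('n::finite) path set \<Rightarrow> ('n, 'e) step_process
       \<Rightarrow> ('n, 'e) step_process \<Rightarrow> ('n, 'e) step_process \<Rightarrow> bool" where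
  "splices pk T r s A \<gamma> \<delta> \<eta> \<longleftrightarrow>
     (\<forall>\<omega>\<in>Paths pk r T.
        (\<forall>u\<in>{r..<s}. used_coef \<eta> u \<omega> = used_coef \<gamma> u \<omega>) \<and>
        (\<forall>u\<in>{s..<T}. used_coef \<eta> u \<omega> = (if \<omega> \<in> A then used_coef \<gamma> u \<omega> else used_coef \<delta> u \<omega>)))"

lemma splices_process:
  assumes "splices pk T r s A \<gamma> \<delta> \<eta>" "\<omega> \<in> Paths pk r T"
  shows "u \<in> {r..<s} \<Longrightarrow> process \<eta> u \<omega> = process \<gamma> u \<omega>"
    and "u \<in> {s..<T} \<Longrightarrow> process \<eta> u \<omega> = (if \<omega> \<in> A then process \<gamma> u \<omega> else process \<delta> u \<omega>)"
  using assms by (auto simp: splices_def process_def)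

end

theory Submission
  imports Defs
begin

text \<open>
  Both claims, that \<^const>\<open>T_step\<close> gives conditional expectations and that it behaves well under
  splicing, rest on identities between the operators at every path, and on one principle that
  turns such identities into statements about measures.

  The principle is \<open>unique_solution_cond_exp\<close>. Let \<open>Q\<close> be the only solution of a bounded
  martingale problem \<open>W\<close> from \<open>y\<close>, and let \<open>L\<close> be a non-negative linear operator, continuous from
  below, into the functionals known at time \<open>s\<close>, which leaves those functionals fixed and sends
  every product of an increment of \<open>W\<close> over $[u,v]$, $s \le u$, with an event known at time \<open>u\<close> to
  zero. Then \<open>\<psi> \<mapsto> \<integral> L \<psi> dQ\<close> is integration against a probability measure, and this measure
  solves \<open>W\<close> from \<open>y\<close>: up to time \<open>s\<close> it agrees with \<open>Q\<close>, and after \<open>s\<close> the increments vanish by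
  the assumption on \<open>L\<close>. By uniqueness it is \<open>Q\<close>, so \<open>L\<close> is a version of the conditional
  expectation given the past of \<open>s\<close>.

  For one coefficient \<open>\<theta>\<close>, started afresh at time \<open>s\<close> from the current position, the principle
  yields the tower property \<open>T_theta_tower\<close>, at every path because uniqueness holds for every
  starting point. That \<open>T_theta \<psi>\<close> is measurable follows from the weak continuity of the solutions
  in the starting point, \<open>weakly_continuous_imp_measurable_kernel\<close>; evaluation at a fixed time is
  not continuous for the Skorokhod topology, but averages over short time intervals are.

  For a step process, \<open>T_step_unfold\<close> writes the operator at time \<open>u\<close> as the operator of the
  coefficient in force at \<open>u\<close>, applied to the operator at the next node. Backward induction over
  the nodes transfers all properties from \<open>\<theta>\<close> to the step process, and the principle, now with
  the problem $Z^\gamma$, shows that \<^const>\<open>T_step\<close> is a conditional expectation. A backward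
  induction over the nodes of two step processes at once shows that the operators depend only on
  the coefficients in force (\<open>T_step_eq_if_used_coef_eq\<close>), and this is exactly what splicing
  controls, whatever representation of the spliced process is chosen.

  It remains to see that spliced processes exist among the step processes (\<open>splice_exists\<close>,
  \<open>step_structure_predictable\<close>), and that several cells on the first interval yield no new
  measures (\<open>merge_initial_cells\<close>): only one of them contains paths that start from \<open>y\<close>.
\<close>


section \<open>Paths and their $\sigma$-algebras\<close>

lemma space_path_alg [simp]: "space (path_alg pk r t u) = Paths pk r t"
  by (simp add: path_alg_def space_measure_of_conv)

lemma sets_path_alg:
  "sets (path_alg pk r t u) =
     sigma_sets (Paths pk r t) {{\<omega> \<in> Paths pk r t. \<omega> v \<in> B} | v B. v \<in> {r..u} \<and> B \<in> sets borel}"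
  unfolding path_alg_def by (rule sets_measure_of) auto

lemma measurable_coordinate:
  "v \<in> {r..u} \<Longrightarrow> (\<lambda>\<omega>. \<omega> v) \<in> borel_measurable (path_alg pk r t u)"
  by (rule measurableI) (auto simp: sets_path_alg vimage_def Int_def conj_commute)

lemma measurable_into_path_alg:
  fixes f :: "'a \<Rightarrow> ('n::finite) path"
  assumes "\<And>x. x \<in> space M \<Longrightarrow> f x \<in> Paths pk r t"
    and "\<And>v. v \<in> {r..u} \<Longrightarrow> (\<lambda>x. f x v) \<in> borel_measurable M"
  shows "f \<in> measurable M (path_alg pk r t u)"
  unfolding path_alg_def
proof (rule measurable_sigma_sets[OF sets_measure_of])
  fix y :: "'n path set" assume "y \<in> {{\<omega> \<in> Paths pk r t. \<omega> v \<in> B} | v B. v \<in> {r..u} \<and> B \<in> sets borel}"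
  then obtain v B where y: "y = {\<omega> \<in> Paths pk r t. \<omega> v \<in> B}" "v \<in> {r..u}" "B \<in> sets borel"
    by blast
  have "f -` y \<inter> space M = (\<lambda>x. f x v) -` B \<inter> space M"
    using y(1) assms(1) by auto
  then show "f -` y \<inter> space M \<in> sets M"
    using assms(2)[OF y(2)] y(3) by (simp add: measurable_sets)
qed (use assms(1) in auto)

lemma sets_path_alg_mono: "u \<le> u' \<Longrightarrow> sets (path_alg pk r t u) \<subseteq> sets (path_alg pk r t u')"
  unfolding sets_path_alg by (rule sigma_sets_mono') force

lemma measurable_path_alg_mono:
  "f \<in> measurable (path_alg pk r t u) N \<Longrightarrow> u \<le> u' \<Longrightarrow> f \<in> measurable (path_alg pk r t u') N"
  using sets_path_alg_mono[of u u' pk r t] unfolding measurable_def by auto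

text \<open>The generators have this property and it survives complements and countable unions. It is
  what makes pasting work: an event of the past of \<open>s\<close> does not see what is pasted after \<open>s\<close>.\<close>

lemma path_alg_event_determined:
  assumes "A \<in> sets (path_alg pk r t u)" "\<omega> \<in> Paths pk r t" "\<omega>' \<in> Paths pk r t"
    and "\<And>v. v \<in> {r..u} \<Longrightarrow> \<omega> v = \<omega>' v"
  shows "\<omega> \<in> A \<longleftrightarrow> \<omega>' \<in> A"
  using assms(1) unfolding sets_path_alg
  by (induction rule: sigma_sets.induct) (use assms(2-4) in auto)

lemma path_alg_function_determined:
  fixes f :: "('n::finite) path \<Rightarrow> real"
  assumes "f \<in> borel_measurable (path_alg pk r t u)" "\<omega> \<in> Paths pk r t" "\<omega>' \<in> Paths pk r t"
    and "\<And>v. v \<in> {r..u} \<Longrightarrow> \<omega> v = \<omega>' v"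
  shows "f \<omega> = f \<omega>'"
proof -
  have "f -` {f \<omega>'} \<inter> space (path_alg pk r t u) \<in> sets (path_alg pk r t u)"
    using assms(1) by (rule measurable_sets) auto
  from path_alg_event_determined[OF this assms(2-4)] show ?thesis
    using assms(2,3) by auto
qed

lemma eventually_in_at_right: "u < b \<Longrightarrow> eventually (\<lambda>v. u < v \<and> v < b) (at_right (u::real))"
  by (auto simp: eventually_at_right_field)

lemma eventually_in_at_left: "a < u \<Longrightarrow> eventually (\<lambda>v. a < v \<and> v < u) (at_left (u::real))"
  by (auto simp: eventually_at_left_field)

lemma restrict_in_Paths:
  fixes \<omega> :: "('n::finite) path"
  assumes "\<omega> \<in> Paths pk r t" "r \<le> a" "b \<le> t"
  shows "restrict \<omega> {a..b} \<in> Paths pk a b"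
proof (cases pk)
  case Continuous
  with assms have "continuous_on {a..b} \<omega>"
    by (auto simp: Paths_def intro: continuous_on_subset)
  then have "continuous_on {a..b} (restrict \<omega> {a..b})"
    by (rule continuous_on_eq) auto
  with Continuous show ?thesis by (simp add: Paths_def)
next
  case Cadlag
  with assms(1) have R: "\<And>u. u \<in> {r..<t} \<Longrightarrow> (\<omega> \<longlongrightarrow> \<omega> u) (at_right u)"
    and L: "\<And>u. u \<in> {r<..t} \<Longrightarrow> \<exists>l. (\<omega> \<longlongrightarrow> l) (at_left u)"
    by (auto simp: Paths_def cadlag_on_def)
  have "(restrict \<omega> {a..b} \<longlongrightarrow> restrict \<omega> {a..b} u) (at_right u)" if u: "u \<in> {a..<b}" for u
  proof -
    have "(\<omega> \<longlongrightarrow> \<omega> u) (at_right u)" using R u assms by auto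
    moreover have "eventually (\<lambda>v. \<omega> v = restrict \<omega> {a..b} v) (at_right u)"
      using eventually_in_at_right[of u b] u by (auto elim!: eventually_mono)
    ultimately show ?thesis using u by (auto intro: Lim_transform_eventually)
  qed
  moreover have "\<exists>l. (restrict \<omega> {a..b} \<longlongrightarrow> l) (at_left u)" if u: "u \<in> {a<..b}" for u
  proof -
    obtain l where "(\<omega> \<longlongrightarrow> l) (at_left u)" using L[of u] u assms by auto
    moreover have "eventually (\<lambda>v. \<omega> v = restrict \<omega> {a..b} v) (at_left u)"
      using eventually_in_at_left[of a u] u by (auto elim!: eventually_mono)
    ultimately show ?thesis by (blast intro: Lim_transform_eventually)
  qed
  ultimately show ?thesis using Cadlag by (simp add: Paths_def cadlag_on_def)
qed

lemma measurable_restrict_path: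
  "r \<le> a \<Longrightarrow> b \<le> u \<Longrightarrow> b \<le> t \<Longrightarrow>
     (\<lambda>\<omega>. restrict \<omega> {a..b}) \<in> measurable (path_alg pk r t u) (path_alg pk a b b)"
  by (rule measurable_into_path_alg) (auto intro: restrict_in_Paths measurable_coordinate)

lemma paste_before: "r \<le> u \<Longrightarrow> u \<le> s \<Longrightarrow> s \<le> T \<Longrightarrow> paste r s T \<omega> \<omega>' u = \<omega> u"
  by (simp add: paste_def)

lemma paste_after:
  "r \<le> s \<Longrightarrow> s \<le> u \<Longrightarrow> u \<le> T \<Longrightarrow> paste r s T \<omega> \<omega>' u = \<omega>' u + \<omega> s - \<omega>' s"
  by (cases "u = s") (simp_all add: paste_def)

text \<open>Only the increments of \<open>\<omega>'\<close> after \<open>s\<close> are used, so there is no jump at \<open>s\<close> whatever the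
  value \<open>\<omega>' s\<close> is.\<close>

lemma paste_in_Paths:
  fixes \<omega> \<omega>' :: "('n::finite) path"
  assumes w: "\<omega> \<in> Paths pk r T" and w': "\<omega>' \<in> Paths pk s T" and "r \<le> s" "s \<le> T"
  shows "paste r s T \<omega> \<omega>' \<in> Paths pk r T"
proof -
  let ?c = "\<omega> s - \<omega>' s" and ?p = "paste r s T \<omega> \<omega>'"
  have ext: "?p \<in> extensional {r..T}" by (simp add: paste_def)
  show ?thesis
  proof (cases pk)
    case Continuous
    have "continuous_on {r..s} ?p"
      by (rule continuous_on_eq[of _ \<omega>])
        (use w assms Continuous in \<open>auto simp: Paths_def paste_before intro: continuous_on_subset\<close>)
    moreover have "continuous_on {s..T} ?p"
      by (rule continuous_on_eq[of _ "\<lambda>u. \<omega>' u + ?c"])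
        (use w' assms Continuous in \<open>auto simp: Paths_def paste_after intro!: continuous_intros\<close>)
    ultimately have "continuous_on ({r..s} \<union> {s..T}) ?p"
      by (intro continuous_on_closed_Un) auto
    moreover have "{r..s} \<union> {s..T} = {r..T}" using assms by auto
    ultimately show ?thesis using Continuous ext by (simp add: Paths_def)
  next
    case Cadlag
    with w w' have R: "\<And>u. u \<in> {r..<T} \<Longrightarrow> (\<omega> \<longlongrightarrow> \<omega> u) (at_right u)"
      and L: "\<And>u. u \<in> {r<..T} \<Longrightarrow> \<exists>l. (\<omega> \<longlongrightarrow> l) (at_left u)"
      and R': "\<And>u. u \<in> {s..<T} \<Longrightarrow> (\<omega>' \<longlongrightarrow> \<omega>' u) (at_right u)"
      and L': "\<And>u. u \<in> {s<..T} \<Longrightarrow> \<exists>l. (\<omega>' \<longlongrightarrow> l) (at_left u)"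
      by (auto simp: Paths_def cadlag_on_def)
    have "(?p \<longlongrightarrow> ?p u) (at_right u)" if u: "u \<in> {r..<T}" for u
    proof (cases "u < s")
      case True
      have "(\<omega> \<longlongrightarrow> \<omega> u) (at_right u)" using R u by auto
      moreover have "eventually (\<lambda>v. \<omega> v = ?p v) (at_right u)"
        using eventually_in_at_right[OF True] u assms
        by (auto simp: paste_before elim!: eventually_mono)
      moreover have "?p u = \<omega> u" using True u assms by (simp add: paste_before)
      ultimately show ?thesis by (auto intro: Lim_transform_eventually)
    next
      case False
      have "((\<lambda>v. \<omega>' v + ?c) \<longlongrightarrow> \<omega>' u + ?c) (at_right u)"
        using R'[of u] u False by (intro tendsto_intros) auto
      moreover have "eventually (\<lambda>v. \<omega>' v + ?c = ?p v) (at_right u)"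
        using eventually_in_at_right[of u T] u assms False
        by (auto simp: paste_after elim!: eventually_mono)
      moreover have "?p u = \<omega>' u + ?c" using False u assms by (simp add: paste_after)
      ultimately show ?thesis by (auto intro: Lim_transform_eventually)
    qed
    moreover have "\<exists>l. (?p \<longlongrightarrow> l) (at_left u)" if u: "u \<in> {r<..T}" for u
    proof (cases "u \<le> s")
      case True
      obtain l where "(\<omega> \<longlongrightarrow> l) (at_left u)" using L u by blast
      moreover have "eventually (\<lambda>v. \<omega> v = ?p v) (at_left u)"
        using eventually_in_at_left[of r u] u assms True
        by (auto simp: paste_before elim!: eventually_mono)
      ultimately show ?thesis by (auto intro: Lim_transform_eventually)
    next
      case False
      obtain l where "(\<omega>' \<longlongrightarrow> l) (at_left u)" using L'[of u] u False by auto
      then have "((\<lambda>v. \<omega>' v + ?c) \<longlongrightarrow> l + ?c) (at_left u)"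
        by (intro tendsto_intros)
      moreover have "eventually (\<lambda>v. \<omega>' v + ?c = ?p v) (at_left u)"
        using eventually_in_at_left[of s u] u assms False
        by (auto simp: paste_after elim!: eventually_mono)
      ultimately show ?thesis by (auto intro: Lim_transform_eventually)
    qed
    ultimately show ?thesis using Cadlag ext by (simp add: Paths_def cadlag_on_def)
  qed
qed

lemma measurable_paste:
  fixes pk :: path_kind
  assumes "r \<le> s" "s \<le> u" "u \<le> T"
  shows "(\<lambda>(\<omega>, \<omega>'). paste r s T \<omega> \<omega>')
     \<in> measurable (path_alg pk r T s \<Otimes>\<^sub>M path_alg pk s T u) (path_alg pk r T u :: ('n::finite) path measure)"
proof (rule measurable_into_path_alg)
  fix v assume v: "v \<in> {r..u}"
  have c1: "(\<lambda>x. fst x w) \<in> borel_measurable (path_alg pk r T s \<Otimes>\<^sub>M path_alg pk s T u)"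
    if "w \<in> {r..s}" for w
    using measurable_compose[OF measurable_fst measurable_coordinate[OF that]] .
  have c2: "(\<lambda>x. snd x w) \<in> borel_measurable (path_alg pk r T s \<Otimes>\<^sub>M path_alg pk s T u)"
    if "w \<in> {s..u}" for w
    using measurable_compose[OF measurable_snd measurable_coordinate[OF that]] .
  have "(\<lambda>x. paste r s T (fst x) (snd x) v)
      \<in> borel_measurable (path_alg pk r T s \<Otimes>\<^sub>M path_alg pk s T u :: ('n path \<times> 'n path) measure)"
  proof (cases "v \<le> s")
    case True
    then show ?thesis using v assms c1[of v] by (simp add: paste_before)
  next
    case False
    then have "(\<lambda>x. snd x v + fst x s - snd x s) \<in> borel_measurable
        (path_alg pk r T s \<Otimes>\<^sub>M path_alg pk s T u :: ('n path \<times> 'n path) measure)"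
      using v assms by (intro borel_measurable_add borel_measurable_diff c1 c2) auto
    then show ?thesis using False v assms by (simp add: paste_after)
  qed
  then show "(\<lambda>x. (case x of (\<omega>, \<omega>') \<Rightarrow> paste r s T \<omega> \<omega>') v)
      \<in> borel_measurable (path_alg pk r T s \<Otimes>\<^sub>M path_alg pk s T u :: ('n path \<times> 'n path) measure)"
    by (simp add: case_prod_beta)
qed (use assms in \<open>auto simp: space_pair_measure intro: paste_in_Paths\<close>)

lemma measurable_paste_right:
  assumes "r \<le> s" "s \<le> u" "u \<le> T" "\<omega> \<in> Paths pk r T"
  shows "paste r s T \<omega> \<in> measurable (path_alg pk s T u) (path_alg pk r T u)"
  using measurable_compose[OF measurable_Pair1' measurable_paste[OF assms(1-3)], of \<omega> pk] assms(4)
  by simp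

section \<open>Regularity of paths in time\<close>

lemma Paths_cadlag:
  fixes \<omega> :: "('n::finite) path"
  assumes "\<omega> \<in> Paths pk r t"
  shows "cadlag_on r t \<omega>"
proof (cases pk)
  case Continuous
  with assms have c: "continuous_on {r..t} \<omega>" by (simp add: Paths_def)
  show ?thesis unfolding cadlag_on_def
  proof (intro conjI ballI)
    fix u assume u: "u \<in> {r..<t}"
    have "continuous_on {u..t} \<omega>" by (rule continuous_on_subset[OF c]) (use u in auto)
    then have "(\<omega> \<longlongrightarrow> \<omega> u) (at u within {u..t})" using u by (auto simp: continuous_on_def)
    then show "(\<omega> \<longlongrightarrow> \<omega> u) (at_right u)" using u by (simp add: at_within_Icc_at_right)
  next
    fix u assume u: "u \<in> {r<..t}"
    have "continuous_on {r..u} \<omega>" by (rule continuous_on_subset[OF c]) (use u in auto)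
    then have "(\<omega> \<longlongrightarrow> \<omega> u) (at u within {r..u})" using u by (auto simp: continuous_on_def)
    then show "\<exists>l. (\<omega> \<longlongrightarrow> l) (at_left u)" using u by (auto simp: at_within_Icc_at_left)
  qed
next
  case Cadlag
  with assms show ?thesis by (simp add: Paths_def)
qed

lemma path_right_continuous:
  "\<omega> \<in> Paths pk r t \<Longrightarrow> u \<in> {r..<t} \<Longrightarrow> (\<omega> \<longlongrightarrow> \<omega> u) (at_right u)"
  using Paths_cadlag unfolding cadlag_on_def by blast

text \<open>The points where the jump exceeds \<open>1 / Suc n\<close> do not accumulate inside the interval: on
  either side of a point \<open>y\<close> the function is uniformly close to its one-sided limit at \<open>y\<close>, which
  leaves no room for large jumps.\<close>

lemma countable_cadlag_discontinuities:
  fixes f :: "real \<Rightarrow> 'a::metric_space"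
  assumes R: "\<And>u. u \<in> {a<..<b} \<Longrightarrow> (f \<longlongrightarrow> f u) (at_right u)"
    and L: "\<And>u. u \<in> {a<..<b} \<Longrightarrow> \<exists>l. (f \<longlongrightarrow> l) (at_left u)"
  shows "countable {u \<in> {a<..<b}. \<not> isCont f u}"
proof -
  obtain l where l: "\<And>u. u \<in> {a<..<b} \<Longrightarrow> (f \<longlongrightarrow> l u) (at_left u)"
    using L by metis
  define D where "D n = {u \<in> {a<..<b}. 1 / real (Suc n) < dist (l u) (f u)}" for n
  \<comment> \<open>around \<open>x\<close> the function stays within half the bound of \<open>p\<close>, hence so do its value and its left limit at \<open>x\<close>\<close>
  have near: "x \<notin> D n"
    if cd: "c < x" "x < d" and e: "\<And>z. c < z \<Longrightarrow> z < d \<Longrightarrow> dist (f z) p < 1 / (2 * real (Suc n))"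
    for c d x p n
  proof
    assume x: "x \<in> D n"
    then have "((\<lambda>z. dist (f z) p) \<longlongrightarrow> dist (l x) p) (at_left x)"
      by (intro tendsto_intros l) (simp add: D_def)
    moreover have "eventually (\<lambda>z. dist (f z) p \<le> 1 / (2 * real (Suc n))) (at_left x)"
      using eventually_in_at_left[OF cd(1)]
      by eventually_elim (use e cd in \<open>force intro: less_imp_le\<close>)
    ultimately have "dist (l x) p \<le> 1 / (2 * real (Suc n))"
      by (rule tendsto_upperbound) simp
    moreover have "dist (f x) p < 1 / (2 * real (Suc n))" using e cd by blast
    moreover have "dist (l x) (f x) \<le> dist (l x) p + dist (f x) p"
      by (metis dist_commute dist_triangle)
    moreover have "1 / (2 * real (Suc n)) + 1 / (2 * real (Suc n)) = 1 / real (Suc n)"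
      by (simp add: field_simps)
    ultimately show False using x unfolding D_def by auto
  qed
  have "D n sparse_in {a<..<b}" for n
    unfolding sparse_in_open[OF open_greaterThanLessThan]
  proof
    fix y assume y: "y \<in> {a<..<b}"
    have pos: "0 < 1 / (2 * real (Suc n))" by simp
    have "eventually (\<lambda>x. x \<notin> D n) (at_right y)"
    proof -
      have "eventually (\<lambda>z. dist (f z) (f y) < 1 / (2 * real (Suc n))) (at_right y)"
        using tendstoD[OF R[OF y] pos] .
      then obtain d where "d > y" "\<And>z. y < z \<Longrightarrow> z < d \<Longrightarrow> dist (f z) (f y) < 1 / (2 * real (Suc n))"
        unfolding eventually_at_right_field by blast
      with near[of y _ d "f y" n] show ?thesis unfolding eventually_at_right_field by blast
    qed
    moreover have "eventually (\<lambda>x. x \<notin> D n) (at_left y)"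
    proof -
      have "eventually (\<lambda>z. dist (f z) (l y) < 1 / (2 * real (Suc n))) (at_left y)"
        using tendstoD[OF l[OF y] pos] .
      then obtain c where "c < y" "\<And>z. c < z \<Longrightarrow> z < y \<Longrightarrow> dist (f z) (l y) < 1 / (2 * real (Suc n))"
        unfolding eventually_at_left_field by blast
      with near[of c _ y "l y" n] show ?thesis unfolding eventually_at_left_field by blast
    qed
    ultimately show "\<not> y islimpt D n"
      unfolding islimpt_iff_eventually eventually_at_split by simp
  qed
  then have "countable ({a<..<b} \<inter> D n)" for n
    by (intro sparse_imp_countable) auto
  then have "countable (\<Union>n. {a<..<b} \<inter> D n)" by (rule countable_UN[OF countableI_type])
  moreover have "{u \<in> {a<..<b}. \<not> isCont f u} \<subseteq> (\<Union>n. {a<..<b} \<inter> D n)"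
  proof
    fix u assume u: "u \<in> {u \<in> {a<..<b}. \<not> isCont f u}"
    have "l u \<noteq> f u"
    proof
      assume "l u = f u"
      with l[of u] R[of u] u have "(f \<longlongrightarrow> f u) (at u)"
        by (simp add: filterlim_at_split)
      with u show False by (simp add: isCont_def)
    qed
    then obtain n where "1 / real (Suc n) < dist (l u) (f u)"
      using nat_approx_posE[of "dist (l u) (f u)"] by auto
    with u show "u \<in> (\<Union>n. {a<..<b} \<inter> D n)" by (auto simp: D_def)
  qed
  ultimately show ?thesis by (rule countable_subset[rotated])
qed

lemma path_countable_discontinuities:
  "\<omega> \<in> Paths pk r t \<Longrightarrow> countable {u \<in> {r<..<t}. \<not> isCont \<omega> u}"
  using Paths_cadlag[of \<omega> pk r t] unfolding cadlag_on_def
  by (intro countable_cadlag_discontinuities) auto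

lemma floor_above_greater: "(u::real) < (of_int \<lfloor>real (Suc n) * u\<rfloor> + 1) / real (Suc n)"
proof -
  have "real (Suc n) * u < of_int \<lfloor>real (Suc n) * u\<rfloor> + 1" by linarith
  then show ?thesis by (simp add: pos_less_divide_eq mult.commute)
qed

lemma tendsto_floor_above: "(\<lambda>n. (of_int \<lfloor>real (Suc n) * u\<rfloor> + 1) / real (Suc n)) \<longlonglongrightarrow> (u::real)"
proof (rule tendsto_sandwich[OF always_eventually always_eventually])
  show "(\<lambda>n. u) \<longlonglongrightarrow> u" by simp
  show "(\<lambda>n. u + 1 / real (Suc n)) \<longlonglongrightarrow> u"
    using tendsto_add[OF tendsto_const[of u] LIMSEQ_inverse_real_of_nat]
    by (simp add: inverse_eq_divide)
  show "\<forall>n. u \<le> (of_int \<lfloor>real (Suc n) * u\<rfloor> + 1) / real (Suc n)"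
    using floor_above_greater by (blast intro: less_imp_le)
  show "\<forall>n. (of_int \<lfloor>real (Suc n) * u\<rfloor> + 1) / real (Suc n) \<le> u + 1 / real (Suc n)"
  proof
    fix n
    have "of_int \<lfloor>real (Suc n) * u\<rfloor> + 1 \<le> real (Suc n) * u + 1" by linarith
    then have "(of_int \<lfloor>real (Suc n) * u\<rfloor> + 1) / real (Suc n) \<le> (real (Suc n) * u + 1) / real (Suc n)"
      by (intro divide_right_mono) auto
    also have "\<dots> = u + 1 / real (Suc n)" by (simp add: add_divide_distrib)
    finally show "(of_int \<lfloor>real (Suc n) * u\<rfloor> + 1) / real (Suc n) \<le> u + 1 / real (Suc n)" .
  qed
qed

text \<open>Progressive measurability of the coordinate process. By right continuity the value at \<open>u\<close>
  is the limit of the values on finer and finer grids strictly to the right of \<open>u\<close>; cutting the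
  grid points off at \<open>t\<close> keeps the approximations known at time \<open>t\<close>.\<close>

lemma measurable_evaluation:
  fixes pk :: path_kind
  assumes "r \<le> t" "t \<le> T"
  shows "(\<lambda>(u, \<omega>). \<omega> u) \<in> borel_measurable
    (restrict_space borel {r..t} \<Otimes>\<^sub>M (path_alg pk r T t :: ('n::finite) path measure))"
    (is "_ \<in> borel_measurable ?M")
proof (rule borel_measurable_LIMSEQ_metric)
  let ?v = "\<lambda>n u. min t ((of_int \<lfloor>real (Suc n) * u\<rfloor> + 1) / real (Suc n))"
  let ?f = "\<lambda>n (k::int) x. if r \<le> (of_int k + 1) / real (Suc n)
     then snd x (min t ((of_int k + 1) / real (Suc n))) else (0 :: real ^ 'n)"
  let ?g = "\<lambda>n (u, \<omega>). if r \<le> ?v n u then \<omega> (?v n u) else (0 :: real ^ 'n)"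
  show "?g n \<in> borel_measurable ?M" for n
  proof -
    have [measurable]: "fst \<in> borel_measurable ?M"
      using measurable_fst[of "restrict_space borel {r..t}"]
      by (rule measurable_compose) (auto intro: measurable_restrict_space1)
    have "(\<lambda>x. ?f n (\<lfloor>real (Suc n) * fst x\<rfloor>) x) \<in> borel_measurable ?M"
    proof (rule measurable_compose_countable[where f = "?f n" and g = "\<lambda>x. \<lfloor>real (Suc n) * fst x\<rfloor>"])
      fix k :: int
      show "?f n k \<in> borel_measurable ?M"
      proof (cases "r \<le> (of_int k + 1) / real (Suc n)")
        case True
        then have "min t ((of_int k + 1) / real (Suc n)) \<in> {r..t}" using assms by auto
        from measurable_compose[OF measurable_snd measurable_coordinate[OF this]] True
        show ?thesis by simp
      qed simp
      show "(\<lambda>x. \<lfloor>real (Suc n) * fst x\<rfloor>) \<in> measurable ?M (count_space UNIV)"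
        by measurable
    qed
    moreover have "?g n = (\<lambda>x. ?f n (\<lfloor>real (Suc n) * fst x\<rfloor>) x)"
      using assms by (auto simp: fun_eq_iff)
    ultimately show ?thesis by simp
  qed
  fix x :: "real \<times> 'n path" assume "x \<in> space ?M"
  then obtain u \<omega> where x: "x = (u, \<omega>)" "u \<in> {r..t}" "\<omega> \<in> Paths pk r T"
    by (auto simp: space_pair_measure space_restrict_space)
  note lt = floor_above_greater[of u]
  have ge: "r \<le> ?v n u" for n
    using x(2) order.strict_trans1[OF _ lt[of n], of r] assms by simp
  have "(\<lambda>n. \<omega> (?v n u)) \<longlonglongrightarrow> \<omega> u"
  proof (cases "u = t")
    case True
    then have "?v n u = u" for n using lt[of n] by (auto simp: min_def)
    then show ?thesis by simp
  next
    case False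
    then have u: "u < t" using x by auto
    have "(\<lambda>n. ?v n u) \<longlonglongrightarrow> min t u"
      by (intro tendsto_intros tendsto_floor_above)
    moreover have "min t u = u" using u by simp
    moreover have "u < ?v n u" for n using lt[of n] u by simp
    ultimately have "filterlim (\<lambda>n. ?v n u) (at_right u) sequentially"
      by (auto simp: filterlim_at less_imp_neq[THEN not_sym] intro!: always_eventually)
    moreover have "(\<omega> \<longlongrightarrow> \<omega> u) (at_right u)"
      using path_right_continuous[OF x(3)] u x(2) assms by auto
    ultimately show ?thesis by (rule filterlim_compose[rotated])
  qed
  then show "(\<lambda>n. ?g n x) \<longlonglongrightarrow> (case x of (u, \<omega>) \<Rightarrow> \<omega> u)"
    using ge by (simp add: x)
qed

section \<open>Weakly continuous families are kernels\<close>

lemma topspace_path_topology [simp]: "topspace (path_topology pk r t) = Paths pk r t"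
proof -
  have "openin (path_topology pk r t) (Paths pk r t)"
    unfolding openin_path_topology by (auto intro: zero_less_one)
  then show ?thesis
    by (metis openin_path_topology openin_subset openin_topspace subset_antisym)
qed

text \<open>The topology is generated by countably many radii around each path, hence sequential
  continuity suffices.\<close>

lemma continuous_map_path_topologyI:
  fixes F :: "('n::finite) path \<Rightarrow> real"
  assumes "\<And>\<omega> X. \<omega> \<in> Paths pk r t \<Longrightarrow> (\<And>n. X n \<in> Paths pk r t) \<Longrightarrow>
      (\<And>n. path_near pk r t (1 / real (Suc n)) \<omega> (X n)) \<Longrightarrow> (\<lambda>n. F (X n)) \<longlonglongrightarrow> F \<omega>"
  shows "continuous_map (path_topology pk r t) euclideanreal F"
  unfolding continuous_map topspace_path_topology
proof (intro conjI allI impI)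
  fix U :: "real set" assume U: "openin euclideanreal U"
  show "openin (path_topology pk r t) {\<omega> \<in> Paths pk r t. F \<omega> \<in> U}"
    unfolding openin_path_topology
  proof (intro conjI ballI)
    fix \<omega> assume w: "\<omega> \<in> {\<omega> \<in> Paths pk r t. F \<omega> \<in> U}"
    show "\<exists>e>0. \<forall>\<omega>'\<in>Paths pk r t. path_near pk r t e \<omega> \<omega>' \<longrightarrow> \<omega>' \<in> {\<omega> \<in> Paths pk r t. F \<omega> \<in> U}"
    proof (rule ccontr)
      assume "\<not> ?thesis"
      then have "\<forall>n. \<exists>\<omega>'\<in>Paths pk r t. path_near pk r t (1 / real (Suc n)) \<omega> \<omega>' \<and> F \<omega>' \<notin> U"
        by (auto dest: spec[of _ "1 / real (Suc _)"])
      then obtain X where X: "\<And>n. X n \<in> Paths pk r t"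
        "\<And>n. path_near pk r t (1 / real (Suc n)) \<omega> (X n)" "\<And>n. F (X n) \<notin> U"
        by metis
      have "(\<lambda>n. F (X n)) \<longlonglongrightarrow> F \<omega>" using assms w X by blast
      then have "eventually (\<lambda>n. F (X n) \<in> U) sequentially"
        using U w by (auto dest: topological_tendstoD)
      then show False using X by (auto simp: eventually_sequentially)
    qed
  qed auto
qed auto

text \<open>For uniform nearness the identity is a time change, so both kinds of path space can be
  treated through the Skorokhod form of nearness.\<close>

lemma path_near_time_change:
  assumes "path_near pk r t e \<omega> \<omega>'"
  obtains c where "strict_mono_on {r..t} c" "c ` {r..t} = {r..t}"
    "\<And>u. u \<in> {r..t} \<Longrightarrow> \<bar>c u - u\<bar> < e \<and> dist (\<omega> u) (\<omega>' (c u)) < e"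
proof (cases pk)
  case Continuous
  have "0 < e" if "u \<in> {r..t}" for u
  proof -
    have "dist (\<omega> u) (\<omega>' u) < e" using assms that Continuous by (auto simp: path_near_def)
    with zero_le_dist show ?thesis by (rule le_less_trans)
  qed
  with Continuous assms show ?thesis
    by (intro that[of id]) (auto simp: path_near_def strict_mono_on_def)
next
  case Cadlag
  with assms have "\<exists>c. strict_mono_on {r..t} c \<and> c ` {r..t} = {r..t} \<and>
      (\<forall>u\<in>{r..t}. \<bar>c u - u\<bar> < e \<and> dist (\<omega> u) (\<omega>' (c u)) < e)"
    unfolding path_near_def by simp
  then obtain c where "strict_mono_on {r..t} c \<and> c ` {r..t} = {r..t} \<and>
      (\<forall>u\<in>{r..t}. \<bar>c u - u\<bar> < e \<and> dist (\<omega> u) (\<omega>' (c u)) < e)" ..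
  then show ?thesis by (intro that[of c]) simp_all
qed

text \<open>A time change fixes both end points of the interval, so values converge there; at inner
  points the time change moves the argument a little, and continuity of the limit path is needed.\<close>

lemma path_near_tendsto:
  fixes \<omega> :: "('n::finite) path"
  assumes near: "\<And>n. path_near pk r t (1 / real (Suc n)) \<omega> (X n)"
    and u: "u \<in> {r..t}" "u = r \<or> u = t \<or> isCont \<omega> u"
  shows "(\<lambda>n. X n u) \<longlonglongrightarrow> \<omega> u"
proof -
  have "\<exists>z. \<bar>u - z\<bar> < 1 / real (Suc n) \<and> dist (\<omega> z) (X n u) < 1 / real (Suc n) \<and>
      (u = r \<or> u = t \<longrightarrow> z = u)" for n
  proof -
    obtain c where c: "strict_mono_on {r..t} c" "c ` {r..t} = {r..t}"
      "\<And>u. u \<in> {r..t} \<Longrightarrow> \<bar>c u - u\<bar> < 1 / real (Suc n) \<and> dist (\<omega> u) (X n (c u)) < 1 / real (Suc n)"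
      using path_near_time_change[OF near[of n]] by blast
    obtain z where z: "z \<in> {r..t}" "c z = u" using c(2) u(1) by (metis imageE)
    have range: "c x \<in> {r..t}" if "x \<in> {r..t}" for x using c(2) that by blast
    have "z = u" if "u = r \<or> u = t"
    proof (rule ccontr)
      assume "z \<noteq> u"
      then have "z < u \<or> u < z" by auto
      then show False
        using that z u(1) range[of u] strict_mono_onD[OF c(1), of z u] strict_mono_onD[OF c(1), of u z]
        by auto
    qed
    with z c(3)[OF z(1)] show ?thesis by auto
  qed
  then obtain z where z: "\<And>n. \<bar>u - z n\<bar> < 1 / real (Suc n)"
    "\<And>n. dist (\<omega> (z n)) (X n u) < 1 / real (Suc n)" "\<And>n. u = r \<or> u = t \<Longrightarrow> z n = u"
    by metis
  have inv: "(\<lambda>n. 1 / real (Suc n)) \<longlonglongrightarrow> 0"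
    using LIMSEQ_inverse_real_of_nat by (simp add: inverse_eq_divide)
  have "(\<lambda>n. \<omega> (z n)) \<longlonglongrightarrow> \<omega> u"
  proof (cases "u = r \<or> u = t")
    case True
    then show ?thesis using z(3) by simp
  next
    case False
    have "(\<lambda>n. z n) \<longlonglongrightarrow> u"
      by (rule tendsto_dist_iff[THEN iffD2], rule tendsto_sandwich[OF always_eventually always_eventually tendsto_const inv])
        (use z(1) in \<open>auto simp: dist_real_def abs_minus_commute less_imp_le\<close>)
    with False u show ?thesis by (auto intro: isCont_tendsto_compose)
  qed
  then have "(\<lambda>n. dist (\<omega> (z n)) (\<omega> u)) \<longlonglongrightarrow> 0"
    by (rule tendsto_dist_iff[THEN iffD1])
  from tendsto_add[OF inv this]
  have lim: "(\<lambda>n. 1 / real (Suc n) + dist (\<omega> (z n)) (\<omega> u)) \<longlonglongrightarrow> 0" by simp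
  have "dist (X n u) (\<omega> u) \<le> 1 / real (Suc n) + dist (\<omega> (z n)) (\<omega> u)" for n
    using dist_triangle[of "X n u" "\<omega> u" "\<omega> (z n)"] z(2)[of n] by (simp add: dist_commute)
  then have "(\<lambda>n. dist (X n u) (\<omega> u)) \<longlonglongrightarrow> 0"
    by (intro tendsto_sandwich[OF always_eventually always_eventually tendsto_const lim]) auto
  then show ?thesis by (rule tendsto_dist_iff[THEN iffD2])
qed

definition unit_interval_measure :: "real measure" where
  "unit_interval_measure = uniform_measure lborel {0..1}"

lemma prob_space_unit_interval_measure: "prob_space unit_interval_measure"
  unfolding unit_interval_measure_def by (rule prob_space_uniform_measure) auto

lemma sets_unit_interval_measure [measurable_cong, simp]: "sets unit_interval_measure = sets borel"
  by (simp add: unit_interval_measure_def)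

lemma space_unit_interval_measure [simp]: "space unit_interval_measure = UNIV"
  by (simp add: unit_interval_measure_def)

text \<open>The mean of \<open>g\<close> along the path over $[v, v + 1/(m+1)]$, the path being frozen at its end
  time. Freezing lets the same formula serve for \<open>v = T\<close>; the lower cut-off at \<open>v\<close> keeps the
  argument in range for negative \<open>h\<close>, which the uniform measure does not charge.\<close>

definition smoothed_evaluation ::
    "real \<Rightarrow> (real ^ 'n \<Rightarrow> real) \<Rightarrow> real \<Rightarrow> nat \<Rightarrow> ('n::finite) path \<Rightarrow> real" where
  "smoothed_evaluation T g v m \<omega> =
     (\<integral>h. g (\<omega> (max v (min T (v + h / real (Suc m))))) \<partial>unit_interval_measure)"

lemma measurable_smoothing_integrand:
  fixes g :: "real ^ 'n::finite \<Rightarrow> real" and pk :: path_kind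
  assumes g: "g \<in> borel_measurable borel" and v: "v \<in> {s..T}"
  shows "(\<lambda>(\<omega>, h). g (\<omega> (max v (min T (v + h / real (Suc m))))))
    \<in> borel_measurable ((path_alg pk s T T :: 'n path measure) \<Otimes>\<^sub>M unit_interval_measure)"
proof -
  have m: "(\<lambda>x. (max v (min T (v + snd x / real (Suc m))), fst x))
      \<in> measurable ((path_alg pk s T T :: 'n path measure) \<Otimes>\<^sub>M unit_interval_measure)
         (restrict_space borel {s..T} \<Otimes>\<^sub>M path_alg pk s T T)"
  proof (rule measurable_Pair)
    show "(\<lambda>x. max v (min T (v + snd x / real (Suc m))))
      \<in> measurable ((path_alg pk s T T :: 'n path measure) \<Otimes>\<^sub>M unit_interval_measure) (restrict_space borel {s..T})"
      using v by (intro measurable_restrict_space2) (auto, measurable)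
  qed measurable
  have "s \<le> T" using v by auto
  from measurable_compose[OF m measurable_compose[OF measurable_evaluation[OF this order_refl] g]]
  show ?thesis by (simp add: case_prod_beta)
qed

lemma measurable_smoothed_evaluation:
  fixes g :: "real ^ 'n::finite \<Rightarrow> real"
  assumes "g \<in> borel_measurable borel" "v \<in> {s..T}"
  shows "smoothed_evaluation T g v m \<in> borel_measurable (path_alg pk s T T)"
proof -
  interpret prob_space unit_interval_measure by (rule prob_space_unit_interval_measure)
  show ?thesis
    unfolding smoothed_evaluation_def
    using measurable_smoothing_integrand[OF assms, of m pk]
    by (intro borel_measurable_lebesgue_integral) (simp add: case_prod_beta)
qed

lemma smoothing_integrand_measurable_time:
  fixes g :: "real ^ 'n::finite \<Rightarrow> real"
  assumes "g \<in> borel_measurable borel" "v \<in> {s..T}" "\<omega> \<in> Paths pk s T"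
  shows "(\<lambda>h. g (\<omega> (max v (min T (v + h / real (Suc m)))))) \<in> borel_measurable unit_interval_measure"
  using measurable_compose[OF measurable_Pair1' measurable_smoothing_integrand[OF assms(1,2), of m pk], of \<omega>] assms(3)
  by simp

lemma smoothed_evaluation_bounds:
  fixes g :: "real ^ 'n::finite \<Rightarrow> real"
  assumes g: "g \<in> borel_measurable borel" "\<And>x. 0 \<le> g x \<and> g x \<le> 1"
    and "v \<in> {s..T}" "\<omega> \<in> Paths pk s T"
  shows "0 \<le> smoothed_evaluation T g v m \<omega> \<and> smoothed_evaluation T g v m \<omega> \<le> 1"
proof -
  interpret prob_space unit_interval_measure by (rule prob_space_unit_interval_measure)
  let ?f = "\<lambda>h. g (\<omega> (max v (min T (v + h / real (Suc m)))))"
  have "integrable unit_interval_measure ?f"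
    by (rule integrable_const_bound[of _ 1]) (use g(2) smoothing_integrand_measurable_time[OF assms(1,3,4)] in auto)
  then have "smoothed_evaluation T g v m \<omega> \<le> 1"
    unfolding smoothed_evaluation_def using g by (intro integral_le_const) auto
  moreover have "0 \<le> smoothed_evaluation T g v m \<omega>"
    unfolding smoothed_evaluation_def using g by (intro integral_nonneg_AE) auto
  ultimately show ?thesis by simp
qed

lemma smoothed_evaluation_tendsto:
  fixes g :: "real ^ 'n::finite \<Rightarrow> real"
  assumes g: "continuous_on UNIV g" "\<And>x. 0 \<le> g x \<and> g x \<le> 1"
    and v: "v \<in> {s..T}" and w: "\<omega> \<in> Paths pk s T"
  shows "(\<lambda>m. smoothed_evaluation T g v m \<omega>) \<longlonglongrightarrow> g (\<omega> v)"
proof -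
  interpret prob_space unit_interval_measure by (rule prob_space_unit_interval_measure)
  have gm: "g \<in> borel_measurable borel" using g(1) by (rule borel_measurable_continuous_onI)
  have "(\<lambda>m. smoothed_evaluation T g v m \<omega>) \<longlonglongrightarrow> (\<integral>h. g (\<omega> v) \<partial>unit_interval_measure)"
    unfolding smoothed_evaluation_def
  proof (rule integral_dominated_convergence[where w = "\<lambda>_. 1"])
    show "AE h in unit_interval_measure.
        (\<lambda>m. g (\<omega> (max v (min T (v + h / real (Suc m)))))) \<longlonglongrightarrow> g (\<omega> v)"
    proof (rule AE_I2)
      fix h :: real
      let ?u = "\<lambda>m. max v (min T (v + h / real (Suc m)))"
      have "(\<lambda>m. \<omega> (?u m)) \<longlonglongrightarrow> \<omega> v"
      proof (cases "h \<le> 0 \<or> v = T")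
        case True
        have "?u m = v" for m
        proof (cases "v = T")
          case False
          with True have "h / real (Suc m) \<le> 0" by (intro divide_nonpos_pos) auto
          then show ?thesis by simp
        qed simp
        then show ?thesis by simp
      next
        case False
        then have h: "0 < h" "v < T" using v by auto
        have "(\<lambda>m. h * inverse (real (Suc m))) \<longlonglongrightarrow> h * 0"
          by (intro tendsto_mult_left LIMSEQ_inverse_real_of_nat)
        then have "(\<lambda>m. v + h / real (Suc m)) \<longlonglongrightarrow> v + 0"
          by (intro tendsto_add tendsto_const) (simp add: divide_inverse)
        then have "?u \<longlonglongrightarrow> max v (min T (v + 0))"
          by (intro tendsto_max tendsto_min tendsto_const)
        moreover have "max v (min T (v + 0)) = v" using h by simp
        moreover have "v < ?u m" for m using h by simp
        ultimately have "filterlim ?u (at_right v) sequentially"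
          by (auto simp: filterlim_at less_imp_neq[THEN not_sym] intro!: always_eventually)
        moreover have "(\<omega> \<longlongrightarrow> \<omega> v) (at_right v)"
          using path_right_continuous[OF w] v h by auto
        ultimately show ?thesis by (rule filterlim_compose[rotated])
      qed
      with g(1) show "(\<lambda>m. g (\<omega> (?u m))) \<longlonglongrightarrow> g (\<omega> v)"
        by (auto intro: continuous_on_tendsto_compose[where s = UNIV])
    qed
  qed (use g gm smoothing_integrand_measurable_time[OF gm v w] in auto)
  then show ?thesis by (simp add: prob_space[simplified])
qed

text \<open>Nearby paths converge pointwise outside the countable set of discontinuities of the limit
  path, which the averaging ignores.\<close>

lemma smoothed_evaluation_sequentially_continuous:
  fixes g :: "real ^ 'n::finite \<Rightarrow> real"
  assumes g: "continuous_on UNIV g" "\<And>x. 0 \<le> g x \<and> g x \<le> 1"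
    and v: "v \<in> {s..T}" and w: "\<omega> \<in> Paths pk s T" and X: "\<And>n. X n \<in> Paths pk s T"
    and near: "\<And>n. path_near pk s T (1 / real (Suc n)) \<omega> (X n)"
  shows "(\<lambda>n. smoothed_evaluation T g v m (X n)) \<longlonglongrightarrow> smoothed_evaluation T g v m \<omega>"
proof -
  interpret prob_space unit_interval_measure by (rule prob_space_unit_interval_measure)
  have gm: "g \<in> borel_measurable borel" using g(1) by (rule borel_measurable_continuous_onI)
  let ?u = "\<lambda>h. max v (min T (v + h / real (Suc m)))"
  let ?D = "{u \<in> {s<..<T}. \<not> isCont \<omega> u}"
  have "{h. v + h / real (Suc m) \<in> ?D} \<subseteq> (\<lambda>u. (u - v) * real (Suc m)) ` ?D"
    by (rule subsetI, rule_tac x = "v + x / real (Suc m)" in image_eqI) auto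
  then have null: "countable {h. v + h / real (Suc m) \<in> ?D}"
    using path_countable_discontinuities[OF w] by (meson countable_image countable_subset)
  show ?thesis
    unfolding smoothed_evaluation_def
  proof (rule integral_dominated_convergence[where w = "\<lambda>_. 1"])
    have "AE h in lborel. h \<notin> {h. v + h / real (Suc m) \<in> ?D}"
      using countable_imp_null_set_lborel[OF null] by (rule AE_not_in)
    then have "AE h in lborel. h \<in> {0..1} \<longrightarrow> (\<lambda>n. g (X n (?u h))) \<longlonglongrightarrow> g (\<omega> (?u h))"
    proof (rule AE_mp, intro AE_I2 impI)
      fix h :: real
      assume h: "h \<notin> {h. v + h / real (Suc m) \<in> ?D}" "h \<in> {0..1}"
      have "0 \<le> h / real (Suc m)" using h(2) by simp
      then have u: "?u h = min T (v + h / real (Suc m))" using v by auto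
      have "(\<lambda>n. X n (?u h)) \<longlonglongrightarrow> \<omega> (?u h)"
      proof (rule path_near_tendsto[OF near])
        show "?u h \<in> {s..T}" using v by auto
        show "?u h = s \<or> ?u h = T \<or> isCont \<omega> (?u h)"
        proof (cases "v + h / real (Suc m) < T")
          case True
          then have e: "?u h = v + h / real (Suc m)" using u by simp
          show ?thesis
          proof (cases "?u h = s")
            case False
            then have "s < ?u h" using \<open>?u h \<in> {s..T}\<close> by auto
            with h(1) True e show ?thesis by auto
          qed simp
        qed (use v in auto)
      qed
      with g(1) show "(\<lambda>n. g (X n (?u h))) \<longlonglongrightarrow> g (\<omega> (?u h))"
        by (auto intro: continuous_on_tendsto_compose[where s = UNIV])
    qed
    then show "AE h in unit_interval_measure. (\<lambda>n. g (X n (?u h))) \<longlonglongrightarrow> g (\<omega> (?u h))"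
      unfolding unit_interval_measure_def by (rule AE_uniform_measureI[rotated]) simp
  qed (use g gm smoothing_integrand_measurable_time[OF gm v] w X in auto)
qed

text \<open>With smoothed evaluations the integrals are continuous in the starting point by weak
  continuity; the evaluations themselves are limits of smoothed ones.\<close>

lemma measurable_product_of_evaluations:
  fixes q :: "real ^ 'n::finite \<Rightarrow> 'n path measure"
  assumes q: "\<And>x. prob_on (path_alg pk s T T) (q x)" "weakly_continuous pk s T q"
    and J: "finite J" "J \<subseteq> {s..T}"
    and g: "\<And>v. v \<in> J \<Longrightarrow> continuous_on UNIV (g v)" "\<And>v x. v \<in> J \<Longrightarrow> 0 \<le> g v x \<and> g v x \<le> (1::real)"
  shows "(\<lambda>x. \<integral>\<omega>. (\<Prod>v\<in>J. g v (\<omega> v)) \<partial>q x) \<in> borel_measurable borel"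
proof (rule borel_measurable_LIMSEQ_real)
  define F where "F m \<omega> = (\<Prod>v\<in>J. smoothed_evaluation T (g v) v m \<omega>)" for m \<omega>
  have gm: "g v \<in> borel_measurable borel" if "v \<in> J" for v
    using g(1)[OF that] by (rule borel_measurable_continuous_onI)
  have bounds: "0 \<le> F m \<omega> \<and> F m \<omega> \<le> 1" if "\<omega> \<in> Paths pk s T" for m \<omega>
  proof -
    have "0 \<le> smoothed_evaluation T (g v) v m \<omega> \<and> smoothed_evaluation T (g v) v m \<omega> \<le> 1"
      if "v \<in> J" for v
      using smoothed_evaluation_bounds[OF gm g(2)] that J \<open>\<omega> \<in> Paths pk s T\<close> by blast
    then show ?thesis unfolding F_def by (auto intro: prod_nonneg prod_le_1)
  qed
  show "(\<lambda>x. \<integral>\<omega>. F m \<omega> \<partial>q x) \<in> borel_measurable borel" for m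
  proof (rule borel_measurable_continuous_onI)
    have "continuous_map (path_topology pk s T) euclideanreal (F m)"
    proof (rule continuous_map_path_topologyI)
      fix \<omega> :: "'n path" and X assume *: "\<omega> \<in> Paths pk s T" "\<And>n. X n \<in> Paths pk s T"
        "\<And>n. path_near pk s T (1 / real (Suc n)) \<omega> (X n)"
      show "(\<lambda>n. F m (X n)) \<longlonglongrightarrow> F m \<omega>"
        unfolding F_def
        using * J by (intro tendsto_prod smoothed_evaluation_sequentially_continuous g) auto
    qed
    moreover have "bounded (F m ` Paths pk s T)"
      using bounds by (intro boundedI[of _ 1]) fastforce
    ultimately show "continuous_on UNIV (\<lambda>x. \<integral>\<omega>. F m \<omega> \<partial>q x)"
      using q(2) unfolding weakly_continuous_def by blast
  qed
  fix x
  interpret prob_space "q x" using q(1)[of x] by (simp add: prob_on_def)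
  have sets: "sets (q x) = sets (path_alg pk s T T)" using q(1)[of x] by (simp add: prob_on_def)
  then have space: "space (q x) = Paths pk s T" by (metis sets_eq_imp_space_eq space_path_alg)
  show "(\<lambda>m. \<integral>\<omega>. F m \<omega> \<partial>q x) \<longlonglongrightarrow> (\<integral>\<omega>. (\<Prod>v\<in>J. g v (\<omega> v)) \<partial>q x)"
  proof (rule integral_dominated_convergence[where w = "\<lambda>_. 1"])
    show "F m \<in> borel_measurable (q x)" for m
      unfolding F_def measurable_cong_sets[OF sets refl]
      using J by (intro borel_measurable_prod measurable_smoothed_evaluation gm) auto
    show "(\<lambda>\<omega>. \<Prod>v\<in>J. g v (\<omega> v)) \<in> borel_measurable (q x)"
      unfolding measurable_cong_sets[OF sets refl]
      using J by (intro borel_measurable_prod measurable_compose[OF measurable_coordinate gm]) auto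
    show "AE \<omega> in q x. (\<lambda>m. F m \<omega>) \<longlonglongrightarrow> (\<Prod>v\<in>J. g v (\<omega> v))"
      unfolding F_def
      using J by (intro AE_I2 tendsto_prod smoothed_evaluation_tendsto[where pk = pk and s = s] g)
        (auto simp: space)
  qed (use bounds space in auto)
qed

text \<open>Cylinders over closed sets form a generator that is stable under intersections and whose
  indicators are limits of products of continuous functions of finitely many coordinates.\<close>

lemma sets_path_alg_closed_cylinders:
  "sets (path_alg pk s T T :: ('n::finite) path measure) = sigma_sets (Paths pk s T)
     {{\<omega> \<in> Paths pk s T. \<forall>v\<in>J. \<omega> v \<in> C v} | J C. finite J \<and> J \<subseteq> {s..T} \<and> (\<forall>v. closed (C v))}"
    (is "_ = sigma_sets _ ?G")
proof
  show "sigma_sets (Paths pk s T) ?G \<subseteq> sets (path_alg pk s T T)"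
  proof (rule sets.sigma_sets_subset[of ?G "path_alg pk s T T", simplified])
    show "?G \<subseteq> sets (path_alg pk s T T)"
    proof
      fix A assume "A \<in> ?G"
      then obtain J C where A: "A = {\<omega> \<in> Paths pk s T. \<forall>v\<in>J. \<omega> v \<in> C v}"
        "finite J" "J \<subseteq> {s..T}" "\<And>v. closed (C v)" by blast
      have "{\<omega> \<in> space (path_alg pk s T T). \<omega> v \<in> C v} \<in> sets (path_alg pk s T T)" if "v \<in> J" for v
        using measurable_sets[OF measurable_coordinate[of v s T pk T] borel_closed[OF A(4)[of v]]] A(3) that
        by (auto simp: vimage_def Int_def conj_commute)
      then have "{\<omega> \<in> space (path_alg pk s T T). \<forall>v\<in>J. \<omega> v \<in> C v} \<in> sets (path_alg pk s T T)"
        using A(2) by (intro sets.sets_Collect_finite_All) auto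
      then show "A \<in> sets (path_alg pk s T T)" by (simp add: A(1))
    qed
  qed
  let ?M = "sigma (Paths pk s T) ?G"
  have G: "?G \<subseteq> Pow (Paths pk s T)" by auto
  have sp: "space ?M = Paths pk s T" using G by (rule space_measure_of)
  have "(\<lambda>\<omega>. \<omega>) \<in> measurable ?M (path_alg pk s T T)"
  proof (rule measurable_into_path_alg)
    fix v assume v: "v \<in> {s..T}"
    show "(\<lambda>\<omega>. \<omega> v) \<in> borel_measurable ?M"
      unfolding borel_eq_closed
    proof (rule measurable_measure_of)
      fix C :: "(real ^ 'n) set" assume "C \<in> Collect closed"
      then have "{\<omega> \<in> Paths pk s T. \<forall>v\<in>{v}. \<omega> v \<in> (\<lambda>_. C) v} \<in> ?G"
        using v by (intro CollectI exI[of _ "{v}"] exI[of _ "\<lambda>_. C"]) auto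
      then have "{\<omega> \<in> Paths pk s T. \<omega> v \<in> C} \<in> sets ?M"
        using G by (auto simp: sets_measure_of)
      then show "(\<lambda>\<omega>. \<omega> v) -` C \<inter> space ?M \<in> sets ?M"
        unfolding sp by (simp add: vimage_def Int_def conj_commute)
    qed auto
  qed (simp add: sp)
  then have "A \<in> sets ?M" if "A \<in> sets (path_alg pk s T T)" for A
    using measurable_sets[OF _ that, of "\<lambda>\<omega>. \<omega>" ?M] sets.sets_into_space[OF that] sp
    by (simp add: Int_absorb2)
  then show "sets (path_alg pk s T T) \<subseteq> sigma_sets (Paths pk s T) ?G"
    using sets_measure_of[OF G] by blast
qed

lemma continuous_approximation_of_closed_set:
  fixes C :: "'a::metric_space set"
  assumes "closed C"
  obtains g :: "nat \<Rightarrow> 'a \<Rightarrow> real"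
  where "\<And>n. continuous_on UNIV (g n)" "\<And>n x. 0 \<le> g n x \<and> g n x \<le> 1"
    "\<And>x. (\<lambda>n. g n x) \<longlonglongrightarrow> indicator C x"
proof (cases "C = {}")
  case True
  then show ?thesis by (intro that[of "\<lambda>_ _. 0"]) auto
next
  case False
  show ?thesis
  proof
    let ?g = "\<lambda>n x. max 0 (1 - real n * infdist x C)"
    show "continuous_on UNIV (?g n)" for n by (intro continuous_intros)
    show "0 \<le> ?g n x \<and> ?g n x \<le> 1" for n x by (simp add: infdist_nonneg)
    show "(\<lambda>n. ?g n x) \<longlonglongrightarrow> indicator C x" for x
    proof (cases "x \<in> C")
      case True
      then show ?thesis by simp
    next
      case xC: False
      then have pos: "0 < infdist x C"
        using assms False in_closed_iff_infdist_zero infdist_nonneg[of x C] by force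
      obtain N where N: "1 \<le> real N * infdist x C"
        using reals_Archimedean3[OF pos, rule_format, of 1] by (auto intro: less_imp_le)
      have "?g n x = 0" if "N \<le> n" for n
      proof -
        have "real N * infdist x C \<le> real n * infdist x C"
          using that pos by (intro mult_right_mono) auto
        with N show ?thesis by linarith
      qed
      then have "eventually (\<lambda>n. ?g n x = 0) sequentially"
        unfolding eventually_sequentially by blast
      with xC show ?thesis by (simp add: tendsto_eventually)
    qed
  qed
qed

lemma weakly_continuous_imp_measurable_kernel:
  fixes q :: "real ^ 'n::finite \<Rightarrow> 'n path measure"
  assumes q: "\<And>x. prob_on (path_alg pk s T T) (q x)" "weakly_continuous pk s T q"
  shows "q \<in> measurable borel (prob_algebra (path_alg pk s T T))"
proof (rule measurable_prob_algebra_generated[OF sets_path_alg_closed_cylinders])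
  let ?G = "{{\<omega> \<in> Paths pk s T. \<forall>v\<in>J. \<omega> v \<in> C v} | J C.
      finite J \<and> J \<subseteq> {s..T} \<and> (\<forall>v. closed (C v :: (real ^ 'n) set))}"
  show "Int_stable ?G"
  proof (rule Int_stableI)
    fix A B assume "A \<in> ?G" "B \<in> ?G"
    then obtain J C K E where *: "A = {\<omega> \<in> Paths pk s T. \<forall>v\<in>J. \<omega> v \<in> C v}"
      "finite J" "J \<subseteq> {s..T}" "\<And>v. closed (C v)"
      "B = {\<omega> \<in> Paths pk s T. \<forall>v\<in>K. \<omega> v \<in> E v}" "finite K" "K \<subseteq> {s..T}" "\<And>v. closed (E v)"
      by blast
    let ?F = "\<lambda>v. (if v \<in> J then C v else UNIV) \<inter> (if v \<in> K then E v else UNIV)"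
    have "A \<inter> B = {\<omega> \<in> Paths pk s T. \<forall>v\<in>J \<union> K. \<omega> v \<in> ?F v}"
      unfolding *(1,5) by (auto split: if_splits)
    moreover have "closed (?F v)" for v using *(4,8) by (intro closed_Int) auto
    ultimately show "A \<inter> B \<in> ?G"
      using *(2,3,6,7) by (intro CollectI exI[of _ "J \<union> K"] exI[of _ ?F]) auto
  qed
  show "?G \<subseteq> Pow (Paths pk s T)" by auto
  show "prob_space (q x)" for x using q(1)[of x] by (simp add: prob_on_def)
  show sets: "sets (q x) = sets (path_alg pk s T T)" for x using q(1)[of x] by (simp add: prob_on_def)
  then have space: "space (q x) = Paths pk s T" for x by (metis sets_eq_imp_space_eq space_path_alg)
  fix A assume "A \<in> ?G"
  then obtain J C where A: "A = {\<omega> \<in> Paths pk s T. \<forall>v\<in>J. \<omega> v \<in> C v}"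
    "finite J" "J \<subseteq> {s..T}" "\<And>v. closed (C v)" by blast
  have "\<exists>g. (\<forall>n. continuous_on UNIV (g n)) \<and> (\<forall>n x. 0 \<le> g n x \<and> g n x \<le> (1::real)) \<and>
      (\<forall>x. (\<lambda>n. g n x) \<longlonglongrightarrow> indicator (C v) x)" for v
    using continuous_approximation_of_closed_set[OF A(4)[of v]] by metis
  then obtain g where g: "\<And>v n. continuous_on UNIV (g v n)"
    "\<And>v n x. 0 \<le> g v n x \<and> g v n x \<le> (1::real)" "\<And>v x. (\<lambda>n. g v n x) \<longlonglongrightarrow> indicator (C v) x"
    by metis
  have "A \<in> sets (path_alg pk s T T)"
    unfolding sets_path_alg_closed_cylinders using A by (intro sigma_sets.Basic) blast
  have "(\<lambda>x. measure (q x) A) \<in> borel_measurable borel"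
  proof (rule borel_measurable_LIMSEQ_real)
    show "(\<lambda>x. \<integral>\<omega>. (\<Prod>v\<in>J. g v n (\<omega> v)) \<partial>q x) \<in> borel_measurable borel" for n
      by (rule measurable_product_of_evaluations[OF q A(2,3) g(1,2)])
    fix x
    interpret prob_space "q x" using q(1)[of x] by (simp add: prob_on_def)
    have "(\<lambda>n. \<integral>\<omega>. (\<Prod>v\<in>J. g v n (\<omega> v)) \<partial>q x) \<longlonglongrightarrow> (\<integral>\<omega>. indicator A \<omega> \<partial>q x)"
    proof (rule integral_dominated_convergence[where w = "\<lambda>_. 1"])
      show "AE \<omega> in q x. (\<lambda>n. \<Prod>v\<in>J. g v n (\<omega> v)) \<longlonglongrightarrow> (indicator A \<omega> :: real)"
      proof (rule AE_I2)
        fix \<omega> assume "\<omega> \<in> space (q x)"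
        have "(\<lambda>n. \<Prod>v\<in>J. g v n (\<omega> v)) \<longlonglongrightarrow> (\<Prod>v\<in>J. indicator (C v) (\<omega> v))"
          by (intro tendsto_prod g)
        moreover have "(\<Prod>v\<in>J. indicator (C v) (\<omega> v)) = (indicator A \<omega> :: real)"
        proof (cases "\<forall>v\<in>J. \<omega> v \<in> C v")
          case True
          with \<open>\<omega> \<in> space (q x)\<close> show ?thesis by (simp add: A(1) space)
        next
          case False
          then show ?thesis using A(2) by (auto simp: A(1) indicator_def intro!: prod_zero)
        qed
        ultimately show "(\<lambda>n. \<Prod>v\<in>J. g v n (\<omega> v)) \<longlonglongrightarrow> (indicator A \<omega> :: real)" by simp
      qed
      show "(\<lambda>\<omega>. \<Prod>v\<in>J. g v n (\<omega> v)) \<in> borel_measurable (q x)" for n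
        unfolding measurable_cong_sets[OF sets refl] using A(3)
        by (intro borel_measurable_prod
              measurable_compose[OF measurable_coordinate borel_measurable_continuous_onI[OF g(1)]]) auto
      show "(indicator A :: _ \<Rightarrow> real) \<in> borel_measurable (q x)"
        using \<open>A \<in> sets (path_alg pk s T T)\<close> by (intro borel_measurable_indicator) (simp add: sets)
      show "AE \<omega> in q x. norm (\<Prod>v\<in>J. g v n (\<omega> v)) \<le> 1" for n
        using g(2) by (intro AE_I2) (simp add: abs_prod prod_le_1)
    qed simp
    then show "(\<lambda>n. \<integral>\<omega>. (\<Prod>v\<in>J. g v n (\<omega> v)) \<partial>q x) \<longlonglongrightarrow> measure (q x) A"
      using \<open>A \<in> sets (path_alg pk s T T)\<close> by (simp add: sets)
  qed
  then have "(\<lambda>x. ennreal (measure (q x) A)) \<in> borel_measurable borel" by measurable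
  moreover have "emeasure (q x) A = ennreal (measure (q x) A)" for x
  proof -
    interpret prob_space "q x" using q(1)[of x] by (simp add: prob_on_def)
    show ?thesis by (rule emeasure_eq_measure)
  qed
  ultimately show "(\<lambda>x. emeasure (q x) A) \<in> borel_measurable borel" by simp
qed

text \<open>Integrals against a kernel are expectations of image laws on the reals, to which the
  measurability of the expectation in the law applies.\<close>

lemma borel_measurable_integral_kernel:
  fixes f :: "'a \<Rightarrow> 'b \<Rightarrow> real"
  assumes f: "(\<lambda>(x, y). f x y) \<in> borel_measurable (M \<Otimes>\<^sub>M N)"
    and L: "L \<in> measurable M (prob_algebra N)"
  shows "(\<lambda>x. \<integral>y. f x y \<partial>L x) \<in> borel_measurable M"
proof -
  have L': "L \<in> measurable M (subprob_algebra N)" using L by (rule measurable_prob_algebraD)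
  have "(\<lambda>x. \<integral>z. z \<partial>distr (L x) borel (f x)) \<in> borel_measurable M"
    by (rule measurable_compose[OF measurable_distr2[OF _ L'] integral_measurable_subprob_algebra])
      (use f in auto)
  moreover have "(\<integral>z. z \<partial>distr (L x) borel (f x)) = (\<integral>y. f x y \<partial>L x)" if x: "x \<in> space M" for x
  proof (rule integral_distr)
    have "sets (L x) = sets N" using L' x by (rule sets_kernel)
    moreover have "f x \<in> borel_measurable N"
      using measurable_compose[OF measurable_Pair1' f, OF x] by simp
    ultimately show "f x \<in> measurable (L x) borel" by (simp cong: measurable_cong_sets)
  qed simp
  ultimately show ?thesis by (simp cong: measurable_cong)
qed

section \<open>Positive functionals are integrals\<close>

definition bounded_measurable :: "'a measure \<Rightarrow> ('a \<Rightarrow> real) set" where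
  "bounded_measurable M = {f \<in> borel_measurable M. \<exists>c. \<forall>x\<in>space M. \<bar>f x\<bar> \<le> c}"

lemma bounded_measurable_cong:
  "f \<in> bounded_measurable M \<Longrightarrow> (\<And>x. x \<in> space M \<Longrightarrow> f x = g x) \<Longrightarrow> g \<in> bounded_measurable M"
  unfolding bounded_measurable_def using measurable_cong[of M f g borel] by auto

lemma bounded_measurable_linear:
  assumes "f \<in> bounded_measurable M" "g \<in> bounded_measurable M"
  shows "(\<lambda>x. a * f x + b * g x) \<in> bounded_measurable M"
proof -
  obtain c d where c: "\<And>x. x \<in> space M \<Longrightarrow> \<bar>f x\<bar> \<le> c" and d: "\<And>x. x \<in> space M \<Longrightarrow> \<bar>g x\<bar> \<le> d"
    using assms unfolding bounded_measurable_def by blast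
  have "\<bar>a * f x + b * g x\<bar> \<le> \<bar>a\<bar> * c + \<bar>b\<bar> * d" if "x \<in> space M" for x
  proof -
    have "\<bar>a * f x + b * g x\<bar> \<le> \<bar>a\<bar> * \<bar>f x\<bar> + \<bar>b\<bar> * \<bar>g x\<bar>"
      using abs_triangle_ineq[of "a * f x" "b * g x"] by (simp add: abs_mult)
    also have "\<dots> \<le> \<bar>a\<bar> * c + \<bar>b\<bar> * d"
      using c[OF that] d[OF that] by (intro add_mono mult_left_mono) auto
    finally show ?thesis .
  qed
  with assms show ?thesis unfolding bounded_measurable_def by auto
qed

lemma bounded_measurable_mult:
  assumes "f \<in> bounded_measurable M" "g \<in> bounded_measurable M"
  shows "(\<lambda>x. f x * g x) \<in> bounded_measurable M"
proof -
  obtain c d where c: "\<And>x. x \<in> space M \<Longrightarrow> \<bar>f x\<bar> \<le> c" and d: "\<And>x. x \<in> space M \<Longrightarrow> \<bar>g x\<bar> \<le> d"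
    using assms unfolding bounded_measurable_def by blast
  have "\<bar>f x * g x\<bar> \<le> c * d" if "x \<in> space M" for x
    unfolding abs_mult using c[OF that] d[OF that] by (intro mult_mono) auto
  with assms show ?thesis unfolding bounded_measurable_def by auto
qed

lemma bounded_measurable_const: "(\<lambda>_. c) \<in> bounded_measurable M"
  unfolding bounded_measurable_def by auto

lemma bounded_measurable_indicator: "A \<in> sets M \<Longrightarrow> indicator A \<in> bounded_measurable M"
  unfolding bounded_measurable_def by (auto intro!: exI[of _ 1] split: split_indicator)

lemma bounded_measurable_sum:
  "(\<And>i. i \<in> J \<Longrightarrow> f i \<in> bounded_measurable M) \<Longrightarrow> (\<lambda>x. \<Sum>i\<in>J. f i x) \<in> bounded_measurable M"
proof (induction J rule: infinite_finite_induct)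
  case (insert j J)
  then show ?case using bounded_measurable_linear[of "f j" M "\<lambda>x. \<Sum>i\<in>J. f i x" 1 1] by auto
qed (simp_all add: bounded_measurable_const)

lemma (in finite_measure) integrable_bounded_measurable:
  assumes "f \<in> bounded_measurable M"
  shows "integrable M f"
proof -
  obtain c where "\<forall>x\<in>space M. \<bar>f x\<bar> \<le> c" using assms unfolding bounded_measurable_def by blast
  with assms show ?thesis
    unfolding bounded_measurable_def by (intro integrable_const_bound[of _ c] AE_I2) auto
qed

text \<open>A Daniell-type representation on bounded measurable functions. The measure of a set is the
  value of the functional at its indicator; continuity from below gives countable additivity and
  then extends the identity from simple to bounded functions.\<close>

lemma positive_functional_integral:
  fixes \<Lambda> :: "('a \<Rightarrow> real) \<Rightarrow> real"
  assumes lin: "\<And>f g a b. f \<in> bounded_measurable M \<Longrightarrow> g \<in> bounded_measurable M \<Longrightarrow>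
        \<Lambda> (\<lambda>x. a * f x + b * g x) = a * \<Lambda> f + b * \<Lambda> g"
    and nonneg: "\<And>f. f \<in> bounded_measurable M \<Longrightarrow> (\<And>x. x \<in> space M \<Longrightarrow> 0 \<le> f x) \<Longrightarrow> 0 \<le> \<Lambda> f"
    and below: "\<And>F f. (\<And>m. F m \<in> bounded_measurable M) \<Longrightarrow> f \<in> bounded_measurable M \<Longrightarrow>
        (\<And>x. x \<in> space M \<Longrightarrow> incseq (\<lambda>m. F m x)) \<Longrightarrow>
        (\<And>x. x \<in> space M \<Longrightarrow> (\<lambda>m. F m x) \<longlonglongrightarrow> f x) \<Longrightarrow> (\<lambda>m. \<Lambda> (F m)) \<longlonglongrightarrow> \<Lambda> f"
    and one: "\<Lambda> (\<lambda>_. 1) = 1"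
  obtains S where "prob_space S" "sets S = sets M"
    "\<And>f. f \<in> bounded_measurable M \<Longrightarrow> (\<integral>x. f x \<partial>S) = \<Lambda> f"
proof -
  have zero: "\<Lambda> (\<lambda>x. 0) = 0"
    using lin[OF bounded_measurable_const bounded_measurable_const, of 0 0 0 0] by simp
  have additive: "\<Lambda> (\<lambda>x. f x + g x) = \<Lambda> f + \<Lambda> g"
    if "f \<in> bounded_measurable M" "g \<in> bounded_measurable M" for f g
    using lin[OF that, of 1 1] by simp
  have sum: "\<Lambda> (\<lambda>x. \<Sum>i<n. f i x) = (\<Sum>i<n. \<Lambda> (f i))"
    if "\<And>i. f i \<in> bounded_measurable M" for f and n :: nat
    by (induction n) (simp_all add: zero additive that bounded_measurable_sum)
  define S where "S = measure_of (space M) (sets M) (\<lambda>A. ennreal (\<Lambda> (indicator A)))"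
  have setsS: "sets S = sets M" and spaceS: "space S = space M"
    by (simp_all add: S_def space_measure_of_conv sets.space_closed)
  have emeasureS: "emeasure S A = ennreal (\<Lambda> (indicator A))" if A: "A \<in> sets M" for A
    unfolding S_def
  proof (rule emeasure_measure_of_sigma[OF sets.sigma_algebra_axioms _ _ A])
    show "positive (sets M) (\<lambda>A. ennreal (\<Lambda> (indicator A)))"
      using zero by (simp add: positive_def indicator_def[abs_def])
    show "countably_additive (sets M) (\<lambda>A. ennreal (\<Lambda> (indicator A)))"
    proof (rule countably_additiveI)
      fix A :: "nat \<Rightarrow> 'a set"
      assume A: "range A \<subseteq> sets M" "disjoint_family A" "\<Union> (range A) \<in> sets M"
      have bm: "indicator (A i) \<in> bounded_measurable M" for i
        using A(1) by (intro bounded_measurable_indicator) auto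
      have "(\<lambda>n. \<Lambda> (\<lambda>x. \<Sum>i<n. indicator (A i) x)) \<longlonglongrightarrow> \<Lambda> (indicator (\<Union> (range A)))"
      proof (rule below)
        show "(\<lambda>x. \<Sum>i<n. indicator (A i) x) \<in> bounded_measurable M" for n
          using bm by (intro bounded_measurable_sum) (simp add: fun_eq_iff)
        show "incseq (\<lambda>m. \<Sum>i<m. indicat_real (A i) x)" for x
          by (intro incseq_SucI) simp
        show "(\<lambda>m. \<Sum>i<m. indicat_real (A i) x) \<longlonglongrightarrow> indicator (\<Union> (range A)) x" for x
          using indicator_sums[of A x] A(2) by (auto simp: sums_def disjoint_family_on_def)
      qed (rule bounded_measurable_indicator[OF A(3)])
      then have "(\<lambda>i. \<Lambda> (indicator (A i))) sums \<Lambda> (indicator (\<Union> (range A)))"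
        unfolding sums_def using sum[of "\<lambda>i. indicator (A i)", OF bm] by simp
      then show "(\<Sum>i. ennreal (\<Lambda> (indicator (A i)))) = ennreal (\<Lambda> (indicator (\<Union> (range A))))"
        using nonneg[OF bm] by (intro suminf_ennreal_eq) auto
    qed
  qed
  have "\<Lambda> (indicator (space M)) = 1"
  proof -
    have bm: "indicator (space M) \<in> bounded_measurable M"
      by (rule bounded_measurable_indicator) simp
    have "0 \<le> \<Lambda> (\<lambda>x. 1 * 1 + (- 1) * indicator (space M) x)"
      by (intro nonneg bounded_measurable_linear bounded_measurable_const bm) simp
    moreover have "0 \<le> \<Lambda> (\<lambda>x. 1 * indicator (space M) x + (- 1) * 1)"
      by (intro nonneg bounded_measurable_linear bounded_measurable_const bm) simp
    ultimately show ?thesis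
      using lin[OF bounded_measurable_const bm, of 1 1 "- 1"] lin[OF bm bounded_measurable_const, of 1 "-1" 1]
        one by simp
  qed
  then have prob: "prob_space S"
    by (intro prob_spaceI) (simp add: emeasureS spaceS)
  then interpret S: prob_space S .
  have bmS: "bounded_measurable S = bounded_measurable M"
    using setsS spaceS measurable_cong_sets[OF setsS refl] by (auto simp: bounded_measurable_def)
  have below_integral: "(\<lambda>m. \<integral>x. F m x \<partial>S) \<longlonglongrightarrow> (\<integral>x. f x \<partial>S)"
    if F: "\<And>m. F m \<in> bounded_measurable M" and f: "f \<in> bounded_measurable M"
      and F0: "\<And>m x. 0 \<le> F m x" and inc: "\<And>x. x \<in> space M \<Longrightarrow> incseq (\<lambda>m. F m x)"
      and lim: "\<And>x. x \<in> space M \<Longrightarrow> (\<lambda>m. F m x) \<longlonglongrightarrow> f x" for F f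
  proof (rule integral_dominated_convergence[where w = f])
    show "integrable S f" using f by (intro S.integrable_bounded_measurable) (simp add: bmS)
    show "AE x in S. norm (F m x) \<le> f x" for m
      using F0 incseq_le[OF inc lim] by (intro AE_I2) (auto simp: spaceS)
  qed (use F f lim in \<open>auto simp: bmS[symmetric] bounded_measurable_def spaceS setsS measurable_cong_sets[OF setsS refl]\<close>)
  have pos: "f \<in> bounded_measurable M \<longrightarrow> (\<integral>x. f x \<partial>S) = \<Lambda> f"
    if "f \<in> borel_measurable M" "\<And>x. 0 \<le> f x" for f
    using that
  proof (induction rule: borel_measurable_induct_real)
    case (set A)
    then have "measure S A = \<Lambda> (indicator A)"
      unfolding measure_def emeasureS[OF set]
      using nonneg[OF bounded_measurable_indicator[OF set]] by simp
    then show ?case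
      using set sets.sets_into_space[OF set] by (simp add: setsS spaceS Int_absorb2)
  next
    case (mult u c)
    show ?case
    proof (cases "c = 0")
      case True
      then show ?thesis using zero by simp
    next
      case False
      show ?thesis
      proof
        assume "(\<lambda>x. c * u x) \<in> bounded_measurable M"
        from bounded_measurable_linear[OF this bounded_measurable_const, of "1 / c" 0 0] False
        have "u \<in> bounded_measurable M" by simp
        with mult.IH lin[OF this bounded_measurable_const, of c 0 0]
        show "(\<integral>x. c * u x \<partial>S) = \<Lambda> (\<lambda>x. c * u x)" by simp
      qed
    qed
  next
    case (add u v)
    show ?case
    proof
      assume "(\<lambda>x. v x + u x) \<in> bounded_measurable M"
      then obtain c where c: "\<And>x. x \<in> space M \<Longrightarrow> \<bar>v x + u x\<bar> \<le> c"
        unfolding bounded_measurable_def by blast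
      have "\<bar>u x\<bar> \<le> c" "\<bar>v x\<bar> \<le> c" if "x \<in> space M" for x
        using c[OF that] add.hyps(2,4)[of x] by auto
      then have "u \<in> bounded_measurable M" "v \<in> bounded_measurable M"
        using add.hyps(1,3) unfolding bounded_measurable_def by blast+
      moreover from this have "integrable S u" "integrable S v"
        by (auto intro!: S.integrable_bounded_measurable simp: bmS)
      ultimately show "(\<integral>x. v x + u x \<partial>S) = \<Lambda> (\<lambda>x. v x + u x)"
        using add.IH by (simp add: additive)
    qed
  next
    case (seq U)
    show ?case
    proof
      assume f: "f \<in> bounded_measurable M"
      have inc: "incseq (\<lambda>m. U m x)" for x
        using seq.hyps(3) by (auto simp: incseq_def le_fun_def)
      obtain c where c: "\<And>x. x \<in> space M \<Longrightarrow> \<bar>f x\<bar> \<le> c"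
        using f unfolding bounded_measurable_def by blast
      have "\<bar>U m x\<bar> \<le> c" if "x \<in> space M" for m x
        using incseq_le[OF inc seq.hyps(4)[OF that], of m] c[OF that] seq.hyps(2)[of m x] by simp
      then have U: "U m \<in> bounded_measurable M" for m
        using seq.hyps(1) unfolding bounded_measurable_def by blast
      have "(\<lambda>m. \<integral>x. U m x \<partial>S) \<longlonglongrightarrow> (\<integral>x. f x \<partial>S)"
        by (rule below_integral[OF U f seq.hyps(2) inc seq.hyps(4)])
      moreover have "(\<lambda>m. \<integral>x. U m x \<partial>S) \<longlonglongrightarrow> \<Lambda> f"
        using below[OF U f inc seq.hyps(4)] seq.IH U by simp
      ultimately show "(\<integral>x. f x \<partial>S) = \<Lambda> f" by (rule LIMSEQ_unique)
    qed
  qed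
  have "(\<integral>x. f x \<partial>S) = \<Lambda> f" if f: "f \<in> bounded_measurable M" for f
  proof -
    define p n where "p x = max 0 (f x)" and "n x = max 0 (- f x)" for x
    obtain c where c: "\<And>x. x \<in> space M \<Longrightarrow> \<bar>f x\<bar> \<le> c"
      using f unfolding bounded_measurable_def by blast
    have "\<bar>p x\<bar> \<le> c" "\<bar>n x\<bar> \<le> c" if "x \<in> space M" for x
      using c[OF that] by (auto simp: p_def n_def)
    moreover have "p \<in> borel_measurable M" "n \<in> borel_measurable M"
      using f unfolding bounded_measurable_def p_def n_def by auto
    ultimately have pn: "p \<in> bounded_measurable M" "n \<in> bounded_measurable M"
      unfolding bounded_measurable_def by blast+
    have "f = (\<lambda>x. 1 * p x + (- 1) * n x)" by (auto simp: p_def n_def)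
    then have "\<Lambda> f = \<Lambda> p - \<Lambda> n" using lin[OF pn, of 1 "- 1"] by simp
    also have "\<dots> = (\<integral>x. p x \<partial>S) - (\<integral>x. n x \<partial>S)"
      using pos[of p] pos[of n] pn by (auto simp: bounded_measurable_def p_def n_def)
    also have "\<dots> = (\<integral>x. p x - n x \<partial>S)"
      using pn by (intro Bochner_Integration.integral_diff[symmetric] S.integrable_bounded_measurable)
        (simp_all add: bmS)
    also have "(\<lambda>x. p x - n x) = f" by (auto simp: p_def n_def)
    finally show ?thesis by simp
  qed
  with prob setsS show ?thesis by (rule that)
qed

section \<open>Bounded adapted functionals of the path\<close>

lemma Bb_eq: "Bb pk T r s = bounded_measurable (path_alg pk r T s)"
  unfolding Bb_def bounded_measurable_def bounded_iff by auto

lemma Bb_mono: "f \<in> Bb pk T r s \<Longrightarrow> s \<le> s' \<Longrightarrow> f \<in> Bb pk T r s'"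
  unfolding Bb_def using measurable_path_alg_mono by auto

lemma Bb_cong:
  "f \<in> Bb pk T r s \<Longrightarrow> (\<And>\<omega>. \<omega> \<in> Paths pk r T \<Longrightarrow> f \<omega> = g \<omega>) \<Longrightarrow> g \<in> Bb pk T r s"
  unfolding Bb_eq by (erule bounded_measurable_cong) simp

lemma Bb_linear:
  "f \<in> Bb pk T r s \<Longrightarrow> g \<in> Bb pk T r s \<Longrightarrow> (\<lambda>\<omega>. a * f \<omega> + b * g \<omega>) \<in> Bb pk T r s"
  unfolding Bb_eq by (rule bounded_measurable_linear)

lemma Bb_diff: "f \<in> Bb pk T r s \<Longrightarrow> g \<in> Bb pk T r s \<Longrightarrow> (\<lambda>\<omega>. f \<omega> - g \<omega>) \<in> Bb pk T r s"
  using Bb_linear[of f pk T r s g 1 "- 1"] by simp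

lemma Bb_mult: "f \<in> Bb pk T r s \<Longrightarrow> g \<in> Bb pk T r s \<Longrightarrow> (\<lambda>\<omega>. f \<omega> * g \<omega>) \<in> Bb pk T r s"
  unfolding Bb_eq by (rule bounded_measurable_mult)

lemma Bb_const: "(\<lambda>_. c) \<in> Bb pk T r s"
  unfolding Bb_eq by (rule bounded_measurable_const)

lemma Bb_indicator: "A \<in> sets (path_alg pk r T s) \<Longrightarrow> indicator A \<in> Bb pk T r s"
  unfolding Bb_eq by (rule bounded_measurable_indicator)

lemma Bb_sum: "(\<And>i. i \<in> J \<Longrightarrow> f i \<in> Bb pk T r s) \<Longrightarrow> (\<lambda>\<omega>. \<Sum>i\<in>J. f i \<omega>) \<in> Bb pk T r s"
  unfolding Bb_eq by (rule bounded_measurable_sum)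

lemma Bb_determined:
  "f \<in> Bb pk T r s \<Longrightarrow> \<omega> \<in> Paths pk r T \<Longrightarrow> \<omega>' \<in> Paths pk r T \<Longrightarrow>
     (\<And>v. v \<in> {r..s} \<Longrightarrow> \<omega> v = \<omega>' v) \<Longrightarrow> f \<omega> = f \<omega>'"
  unfolding Bb_def by (blast intro: path_alg_function_determined)

lemma prob_onD:
  assumes "prob_on (path_alg pk r t t) Q"
  shows "prob_space Q" "sets Q = sets (path_alg pk r t t)" "space Q = Paths pk r t"
proof -
  show "prob_space Q" and *: "sets Q = sets (path_alg pk r t t)"
    using assms by (simp_all add: prob_on_def)
  show "space Q = Paths pk r t" using sets_eq_imp_space_eq[OF *] by simp
qed

lemma bounded_measurable_prob_on:
  assumes "prob_on (path_alg pk r T T) Q"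
  shows "bounded_measurable Q = Bb pk T r T"
  using prob_onD[OF assms] measurable_cong_sets[OF prob_onD(2)[OF assms] refl]
  by (auto simp: Bb_eq bounded_measurable_def)

lemma integrable_Bb:
  assumes "prob_on (path_alg pk r T T) Q" "f \<in> Bb pk T r T"
  shows "integrable Q f"
proof -
  interpret prob_space Q using prob_onD(1)[OF assms(1)] .
  show ?thesis
    using assms(2) bounded_measurable_prob_on[OF assms(1)] by (intro integrable_bounded_measurable) simp
qed

lemma subalgebra_path_alg:
  assumes "prob_on (path_alg pk r T T) Q" "u \<le> T"
  shows "subalgebra Q (path_alg pk r T u)"
  using prob_onD[OF assms(1)] sets_path_alg_mono[OF assms(2), of pk r T] by (auto simp: subalgebra_def)

lemma sigma_finite_subalgebra_path_alg:
  assumes "prob_on (path_alg pk r T T) Q" "u \<le> T"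
  shows "sigma_finite_subalgebra Q (path_alg pk r T u)"
proof -
  interpret prob_space Q using prob_onD(1)[OF assms(1)] .
  show ?thesis
    using subalgebra_path_alg[OF assms]
    by (intro finite_measure_subalgebra_is_sigma_finite)
      (simp add: finite_measure_subalgebra_def finite_measure_axioms finite_measure_subalgebra_axioms_def)
qed

lemma cond_exp_Bb_iff:
  fixes Q :: "('n::finite) path measure"
  assumes Q: "prob_on (path_alg pk r T T) Q" and u: "u \<le> T"
    and f: "f \<in> Bb pk T r T" and g: "g \<in> Bb pk T r u"
  shows "(AE \<omega> in Q. real_cond_exp Q (path_alg pk r T u) f \<omega> = g \<omega>) \<longleftrightarrow>
    (\<forall>B\<in>sets (path_alg pk r T u). (\<integral>\<omega>. indicator B \<omega> * f \<omega> \<partial>Q) = (\<integral>\<omega>. indicator B \<omega> * g \<omega> \<partial>Q))"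
proof -
  interpret sigma_finite_subalgebra Q "path_alg pk r T u"
    by (rule sigma_finite_subalgebra_path_alg[OF Q u])
  have fi: "integrable Q f" and gi: "integrable Q g"
    using integrable_Bb[OF Q] f Bb_mono[OF g u] by auto
  show ?thesis
  proof
    assume AE: "AE \<omega> in Q. real_cond_exp Q (path_alg pk r T u) f \<omega> = g \<omega>"
    show "\<forall>B\<in>sets (path_alg pk r T u).
        (\<integral>\<omega>. indicator B \<omega> * f \<omega> \<partial>Q) = (\<integral>\<omega>. indicator B \<omega> * g \<omega> \<partial>Q)"
    proof
      fix B :: "'n path set" assume B: "B \<in> sets (path_alg pk r T u)"
      have BQ: "B \<in> sets Q" using B subalgebra_path_alg[OF Q u] by (auto simp: subalgebra_def)
      have "(\<integral>\<omega>. indicator B \<omega> * f \<omega> \<partial>Q) =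
          (\<integral>\<omega>. indicator B \<omega> * real_cond_exp Q (path_alg pk r T u) f \<omega> \<partial>Q)"
        using real_cond_exp_intA[OF fi B] by (simp add: set_lebesgue_integral_def)
      also have "\<dots> = (\<integral>\<omega>. indicator B \<omega> * g \<omega> \<partial>Q)"
        using AE BQ gi by (intro integral_cong_AE) auto
      finally show "(\<integral>\<omega>. indicator B \<omega> * f \<omega> \<partial>Q) = (\<integral>\<omega>. indicator B \<omega> * g \<omega> \<partial>Q)" .
    qed
  next
    assume "\<forall>B\<in>sets (path_alg pk r T u).
        (\<integral>\<omega>. indicator B \<omega> * f \<omega> \<partial>Q) = (\<integral>\<omega>. indicator B \<omega> * g \<omega> \<partial>Q)"
    then show "AE \<omega> in Q. real_cond_exp Q (path_alg pk r T u) f \<omega> = g \<omega>"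
      using fi gi g
      by (intro real_cond_exp_charact) (auto simp: set_lebesgue_integral_def Bb_def)
  qed
qed

text \<open>For bounded adapted problems the martingale property says that increments are orthogonal to
  the events of the past, a condition that is linear in the measure and free of conditional
  expectations.\<close>

lemma is_solution_iff:
  fixes Q :: "('n::finite) path measure"
  assumes W: "\<And>k u. k \<in> I \<Longrightarrow> u \<in> {r..T} \<Longrightarrow> W k r u \<in> Bb pk T r u"
  shows "is_solution pk r T I W y Q \<longleftrightarrow>
     prob_on (path_alg pk r T T) Q \<and> measure Q {\<omega> \<in> Paths pk r T. \<omega> r = y} = 1 \<and>
     (\<forall>k\<in>I. \<forall>u\<in>{r..T}. \<forall>v\<in>{u..T}. \<forall>B\<in>sets (path_alg pk r T u).
        (\<integral>\<omega>. indicator B \<omega> * (W k r v \<omega> - W k r u \<omega>) \<partial>Q) = 0)"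
proof (cases "prob_on (path_alg pk r T T) Q")
  case True
  have "martingale_on Q (path_alg pk r T) {r..T} (W k r) \<longleftrightarrow>
      (\<forall>u\<in>{r..T}. \<forall>v\<in>{u..T}. \<forall>B\<in>sets (path_alg pk r T u).
        (\<integral>\<omega>. indicator B \<omega> * (W k r v \<omega> - W k r u \<omega>) \<partial>Q) = 0)" if k: "k \<in> I" for k
  proof -
    have WT: "W k r u \<in> Bb pk T r T" if "u \<in> {r..T}" for u
      using Bb_mono[OF W[OF k that], of T] that by simp
    have int: "integrable Q (\<lambda>\<omega>. indicator B \<omega> * W k r v \<omega>)"
      if "v \<in> {r..T}" "u \<in> {r..T}" "B \<in> sets (path_alg pk r T u)" for u v B
      using Bb_mult[OF Bb_mono[OF Bb_indicator[OF that(3)]] WT[OF that(1)]] that(2)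
      by (intro integrable_Bb[OF True]) auto
    have "(AE \<omega> in Q. real_cond_exp Q (path_alg pk r T u) (W k r v) \<omega> = W k r u \<omega>) \<longleftrightarrow>
        (\<forall>B\<in>sets (path_alg pk r T u). (\<integral>\<omega>. indicator B \<omega> * (W k r v \<omega> - W k r u \<omega>) \<partial>Q) = 0)"
      if uv: "u \<in> {r..T}" "v \<in> {r..T}" for u v
    proof -
      have "(\<integral>\<omega>. indicator B \<omega> * (W k r v \<omega> - W k r u \<omega>) \<partial>Q) =
          (\<integral>\<omega>. indicator B \<omega> * W k r v \<omega> \<partial>Q) - (\<integral>\<omega>. indicator B \<omega> * W k r u \<omega> \<partial>Q)"
        if "B \<in> sets (path_alg pk r T u)" for B
        using int[OF uv(2,1) that] int[OF uv(1,1) that] by (simp add: right_diff_distrib)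
      then show ?thesis
        using cond_exp_Bb_iff[OF True _ WT[OF uv(2)] W[OF k uv(1)]] uv by auto
    qed
    moreover have "W k r u \<in> borel_measurable (path_alg pk r T u) \<and> integrable Q (W k r u)"
      if "u \<in> {r..T}" for u
      using W[OF k that] integrable_Bb[OF True WT[OF that]] by (auto simp: Bb_def)
    ultimately show ?thesis
      unfolding martingale_on_def by auto
  qed
  with True prob_onD(3)[OF True] show ?thesis
    unfolding is_solution_def by auto
qed (simp add: is_solution_def)

section \<open>Uniqueness identifies conditional expectations\<close>

lemma nonneg_linear_belowD:
  assumes "nonneg_linear_below pk T r s L"
  shows "\<psi> \<in> Bb pk T r T \<Longrightarrow> L \<psi> \<in> Bb pk T r s"
    and "\<psi> \<in> Bb pk T r T \<Longrightarrow> \<phi> \<in> Bb pk T r T \<Longrightarrow> \<omega> \<in> Paths pk r T \<Longrightarrow>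
        L (\<lambda>\<omega>. a * \<psi> \<omega> + b * \<phi> \<omega>) \<omega> = a * L \<psi> \<omega> + b * L \<phi> \<omega>"
    and "\<psi> \<in> Bb pk T r T \<Longrightarrow> (\<And>\<omega>. \<omega> \<in> Paths pk r T \<Longrightarrow> 0 \<le> \<psi> \<omega>) \<Longrightarrow> \<omega> \<in> Paths pk r T \<Longrightarrow> 0 \<le> L \<psi> \<omega>"
    and "(\<And>m. F m \<in> Bb pk T r T) \<Longrightarrow> \<psi> \<in> Bb pk T r T \<Longrightarrow>
        (\<And>\<omega>. \<omega> \<in> Paths pk r T \<Longrightarrow> incseq (\<lambda>m. F m \<omega>)) \<Longrightarrow>
        (\<And>\<omega>. \<omega> \<in> Paths pk r T \<Longrightarrow> (\<lambda>m. F m \<omega>) \<longlonglongrightarrow> \<psi> \<omega>) \<Longrightarrow> \<omega> \<in> Paths pk r T \<Longrightarrow>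
        (\<lambda>m. L (F m) \<omega>) \<longlonglongrightarrow> L \<psi> \<omega>"
  using assms unfolding nonneg_linear_below_def by blast+

lemma nonneg_linear_below_mono:
  assumes L: "nonneg_linear_below pk T r s L"
    and "\<psi> \<in> Bb pk T r T" "\<phi> \<in> Bb pk T r T" "\<And>\<omega>. \<omega> \<in> Paths pk r T \<Longrightarrow> \<psi> \<omega> \<le> \<phi> \<omega>" "\<omega> \<in> Paths pk r T"
  shows "L \<psi> \<omega> \<le> L \<phi> \<omega>"
proof -
  have "0 \<le> L (\<lambda>\<omega>. 1 * \<phi> \<omega> + (- 1) * \<psi> \<omega>) \<omega>"
    using assms by (intro nonneg_linear_belowD(3)[OF L] Bb_linear) auto
  then show ?thesis
    using nonneg_linear_belowD(2)[OF L assms(3,2,5), of 1 "- 1"] by simp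
qed

lemma nonneg_linear_below_cong:
  assumes L: "nonneg_linear_below pk T r s L"
    and "\<psi> \<in> Bb pk T r T" "\<And>\<omega>. \<omega> \<in> Paths pk r T \<Longrightarrow> \<psi> \<omega> = \<phi> \<omega>" "\<omega> \<in> Paths pk r T"
  shows "L \<psi> \<omega> = L \<phi> \<omega>"
proof -
  have \<phi>: "\<phi> \<in> Bb pk T r T" using Bb_cong assms(2,3) by blast
  show ?thesis
    using nonneg_linear_below_mono[OF L assms(2) \<phi> _ assms(4)]
      nonneg_linear_below_mono[OF L \<phi> assms(2) _ assms(4)] assms(3)
    by (simp add: antisym)
qed

text \<open>Off \<open>B\<close>, a function supported in \<open>B\<close> is sent to zero, because it is dominated by a multiple
  of the indicator of \<open>B\<close>, which \<open>L\<close> fixes. So at each path only the part of \<open>\<psi>\<close> on the side of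
  that path, \<open>B\<close> or its complement, contributes.\<close>

lemma nonneg_linear_below_pull_out:
  assumes L: "nonneg_linear_below pk T r s L" and s: "s \<le> T"
    and Lid: "\<And>\<phi> \<omega>. \<phi> \<in> Bb pk T r s \<Longrightarrow> \<omega> \<in> Paths pk r T \<Longrightarrow> L \<phi> \<omega> = \<phi> \<omega>"
    and B: "B \<in> sets (path_alg pk r T s)" and \<psi>: "\<psi> \<in> Bb pk T r T" and \<omega>: "\<omega> \<in> Paths pk r T"
  shows "L (\<lambda>\<omega>. indicator B \<omega> * \<psi> \<omega>) \<omega> = indicator B \<omega> * L \<psi> \<omega>"
proof -
  note D = nonneg_linear_belowD[OF L]
  have ind: "indicator C \<in> Bb pk T r T" if "C \<in> sets (path_alg pk r T s)" for C
    using Bb_mono[OF Bb_indicator[OF that] s] .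
  obtain c where c: "\<And>\<omega>. \<omega> \<in> Paths pk r T \<Longrightarrow> \<bar>\<psi> \<omega>\<bar> \<le> c"
    using \<psi> unfolding Bb_def bounded_iff by auto
  have vanish: "L (\<lambda>\<omega>. indicator C \<omega> * \<psi> \<omega>) \<omega> = 0"
    if C: "C \<in> sets (path_alg pk r T s)" and "\<omega> \<notin> C" for C
  proof (rule antisym)
    have zero: "L (\<lambda>\<omega>. a * indicator C \<omega> + 0 * indicator C \<omega>) \<omega> = 0" for a
      unfolding D(2)[OF ind[OF C] ind[OF C] \<omega>] using Lid[OF Bb_indicator[OF C] \<omega>] that(2) by simp
    note mono = nonneg_linear_below_mono[OF L _ _ _ \<omega>]
    have "L (\<lambda>\<omega>. indicator C \<omega> * \<psi> \<omega>) \<omega> \<le> L (\<lambda>\<omega>. c * indicator C \<omega> + 0 * indicator C \<omega>) \<omega>"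
      using c by (intro mono Bb_mult Bb_linear ind[OF C] \<psi>) (force simp: abs_le_iff split: split_indicator)
    then show "L (\<lambda>\<omega>. indicator C \<omega> * \<psi> \<omega>) \<omega> \<le> 0" unfolding zero .
    have "L (\<lambda>\<omega>. - c * indicator C \<omega> + 0 * indicator C \<omega>) \<omega> \<le> L (\<lambda>\<omega>. indicator C \<omega> * \<psi> \<omega>) \<omega>"
      using c by (intro mono Bb_mult Bb_linear ind[OF C] \<psi>) (force simp: abs_le_iff split: split_indicator)
    then show "0 \<le> L (\<lambda>\<omega>. indicator C \<omega> * \<psi> \<omega>) \<omega>" unfolding zero .
  qed
  let ?B = "Paths pk r T - B"
  have B': "?B \<in> sets (path_alg pk r T s)" using sets.compl_sets[OF B] by simp
  have "L \<psi> \<omega> = L (\<lambda>\<omega>. 1 * (indicator B \<omega> * \<psi> \<omega>) + 1 * (indicator ?B \<omega> * \<psi> \<omega>)) \<omega>"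
    by (rule nonneg_linear_below_cong[OF L \<psi> _ \<omega>]) (simp split: split_indicator)
  also have "\<dots> = L (\<lambda>\<omega>. indicator B \<omega> * \<psi> \<omega>) \<omega> + L (\<lambda>\<omega>. indicator ?B \<omega> * \<psi> \<omega>) \<omega>"
    unfolding D(2)[OF Bb_mult[OF ind[OF B] \<psi>] Bb_mult[OF ind[OF B'] \<psi>] \<omega>] by simp
  finally show ?thesis using vanish[OF B] vanish[OF B'] \<omega> by (cases "\<omega> \<in> B") simp_all
qed

text \<open>The functional \<open>\<psi> \<mapsto> \<integral> L \<psi> dQ\<close> is integration against a measure \<open>S\<close> that again solves the
  problem from \<open>y\<close>: \<open>S\<close> agrees with \<open>Q\<close> on the past of \<open>s\<close> because \<open>L\<close> fixes what is known at \<open>s\<close>,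
  and later increments are killed by \<open>L\<close>. Uniqueness gives \<open>S = Q\<close>.\<close>

lemma unique_solution_invariant:
  fixes Q :: "('n::finite) path measure"
  assumes W: "\<And>k u. k \<in> I \<Longrightarrow> u \<in> {r..T} \<Longrightarrow> W k r u \<in> Bb pk T r u"
    and uniq: "\<exists>!Q. is_solution pk r T I W y Q" and Q: "is_solution pk r T I W y Q"
    and s: "s \<in> {r..T}" and L: "nonneg_linear_below pk T r s L"
    and Lid: "\<And>\<phi> \<omega>. \<phi> \<in> Bb pk T r s \<Longrightarrow> \<omega> \<in> Paths pk r T \<Longrightarrow> L \<phi> \<omega> = \<phi> \<omega>"
    and Lmart: "\<And>k u v B \<omega>. k \<in> I \<Longrightarrow> u \<in> {s..T} \<Longrightarrow> v \<in> {u..T} \<Longrightarrow>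
        B \<in> sets (path_alg pk r T u) \<Longrightarrow> \<omega> \<in> Paths pk r T \<Longrightarrow>
        L (\<lambda>\<omega>. indicator B \<omega> * (W k r v \<omega> - W k r u \<omega>)) \<omega> = 0"
    and \<psi>: "\<psi> \<in> Bb pk T r T"
  shows "(\<integral>\<omega>. L \<psi> \<omega> \<partial>Q) = (\<integral>\<omega>. \<psi> \<omega> \<partial>Q)"
proof -
  have Qp: "prob_on (path_alg pk r T T) Q" and Q1: "measure Q {\<omega> \<in> Paths pk r T. \<omega> r = y} = 1"
    and Qm: "\<And>k u v B. k \<in> I \<Longrightarrow> u \<in> {r..T} \<Longrightarrow> v \<in> {u..T} \<Longrightarrow> B \<in> sets (path_alg pk r T u) \<Longrightarrow>
      (\<integral>\<omega>. indicator B \<omega> * (W k r v \<omega> - W k r u \<omega>) \<partial>Q) = 0"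
    using Q is_solution_iff[where W = W and Q = Q and y = y, OF W] by blast+
  interpret prob_space Q using prob_onD(1)[OF Qp] .
  note space = prob_onD(3)[OF Qp]
  have sT: "s \<le> T" using s by simp
  have LT: "L f \<in> Bb pk T r T" if "f \<in> Bb pk T r T" for f
    using Bb_mono[OF nonneg_linear_belowD(1)[OF L that] sT] .
  have Li: "integrable Q (L f)" if "f \<in> Bb pk T r T" for f
    using integrable_Bb[OF Qp LT[OF that]] .
  obtain S where S: "prob_space S" "sets S = sets (path_alg pk r T T)"
    "\<And>f. f \<in> Bb pk T r T \<Longrightarrow> (\<integral>\<omega>. f \<omega> \<partial>S) = (\<integral>\<omega>. L f \<omega> \<partial>Q)"
  proof (rule positive_functional_integral[of "path_alg pk r T T" "\<lambda>f. \<integral>\<omega>. L f \<omega> \<partial>Q"], unfold Bb_eq[symmetric])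
    fix f g :: "'n path \<Rightarrow> real" and a b assume fg: "f \<in> Bb pk T r T" "g \<in> Bb pk T r T"
    have "(\<integral>\<omega>. L (\<lambda>\<omega>. a * f \<omega> + b * g \<omega>) \<omega> \<partial>Q) = (\<integral>\<omega>. a * L f \<omega> + b * L g \<omega> \<partial>Q)"
      using nonneg_linear_belowD(2)[OF L fg] by (intro Bochner_Integration.integral_cong) (auto simp: space)
    then show "(\<integral>\<omega>. L (\<lambda>\<omega>. a * f \<omega> + b * g \<omega>) \<omega> \<partial>Q) = a * (\<integral>\<omega>. L f \<omega> \<partial>Q) + b * (\<integral>\<omega>. L g \<omega> \<partial>Q)"
      using Li fg by simp
  next
    fix f :: "'n path \<Rightarrow> real" assume "f \<in> Bb pk T r T" "\<And>x. x \<in> space (path_alg pk r T T) \<Longrightarrow> 0 \<le> f x"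
    then show "0 \<le> (\<integral>\<omega>. L f \<omega> \<partial>Q)"
      using nonneg_linear_belowD(3)[OF L] by (intro integral_nonneg_AE AE_I2) (auto simp: space)
  next
    fix F and f :: "'n path \<Rightarrow> real" assume F: "\<And>m. F m \<in> Bb pk T r T" and f: "f \<in> Bb pk T r T"
      and inc: "\<And>x. x \<in> space (path_alg pk r T T) \<Longrightarrow> incseq (\<lambda>m. F m x)"
      and lim: "\<And>x. x \<in> space (path_alg pk r T T) \<Longrightarrow> (\<lambda>m. F m x) \<longlonglongrightarrow> f x"
    show "(\<lambda>m. \<integral>\<omega>. L (F m) \<omega> \<partial>Q) \<longlonglongrightarrow> (\<integral>\<omega>. L f \<omega> \<partial>Q)"
    proof (rule integral_dominated_convergence[where w = "\<lambda>\<omega>. \<bar>L (F 0) \<omega>\<bar> + \<bar>L f \<omega>\<bar>"])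
      show "integrable Q (\<lambda>\<omega>. \<bar>L (F 0) \<omega>\<bar> + \<bar>L f \<omega>\<bar>)" using Li F f by simp
      show "AE \<omega> in Q. norm (L (F m) \<omega>) \<le> \<bar>L (F 0) \<omega>\<bar> + \<bar>L f \<omega>\<bar>" for m
      proof (rule AE_I2)
        fix \<omega> assume "\<omega> \<in> space Q"
        then have w: "\<omega> \<in> Paths pk r T" by (simp add: space)
        have "L (F 0) \<omega> \<le> L (F m) \<omega>"
          using inc by (intro nonneg_linear_below_mono[OF L F F _ w]) (auto simp: incseq_def)
        moreover have "L (F m) \<omega> \<le> L f \<omega>"
          using incseq_le[OF inc lim] by (intro nonneg_linear_below_mono[OF L F f _ w]) auto
        ultimately show "norm (L (F m) \<omega>) \<le> \<bar>L (F 0) \<omega>\<bar> + \<bar>L f \<omega>\<bar>" by simp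
      qed
      show "AE \<omega> in Q. (\<lambda>m. L (F m) \<omega>) \<longlonglongrightarrow> L f \<omega>"
        using nonneg_linear_belowD(4)[OF L F f] inc lim by (intro AE_I2) (auto simp: space)
    qed (use borel_measurable_integrable[OF Li] F f in auto)
  next
    have "(\<integral>\<omega>. L (\<lambda>_. 1) \<omega> \<partial>Q) = (\<integral>\<omega>. 1 \<partial>Q)"
      using Lid[OF Bb_const] by (intro Bochner_Integration.integral_cong) (auto simp: space)
    then show "(\<integral>\<omega>. L (\<lambda>_. 1) \<omega> \<partial>Q) = 1" by (simp add: prob_space)
  qed blast
  have Sp: "prob_on (path_alg pk r T T) S" using S(1,2) by (simp add: prob_on_def)
  interpret S: prob_space S by (rule S(1))
  have early: "(\<integral>\<omega>. f \<omega> \<partial>S) = (\<integral>\<omega>. f \<omega> \<partial>Q)" if f: "f \<in> Bb pk T r s" for f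
  proof -
    have "(\<integral>\<omega>. f \<omega> \<partial>S) = (\<integral>\<omega>. L f \<omega> \<partial>Q)" using S(3) Bb_mono[OF f sT] .
    also have "\<dots> = (\<integral>\<omega>. f \<omega> \<partial>Q)"
      using Lid[OF f] by (intro Bochner_Integration.integral_cong) (auto simp: space)
    finally show ?thesis .
  qed
  have WT: "W k r u \<in> Bb pk T r T" if "k \<in> I" "u \<in> {r..T}" for k u
    using Bb_mono[OF W[OF that], of T] that by simp
  have incr: "(\<lambda>\<omega>. indicator B \<omega> * (W k r v \<omega> - W k r u \<omega>)) \<in> Bb pk T r v"
    if "k \<in> I" "u \<in> {r..T}" "v \<in> {u..T}" "B \<in> sets (path_alg pk r T u)" for k u v B
    using Bb_mono[OF Bb_indicator[OF that(4)], of v] W[OF that(1,2)] W[OF that(1), of v] that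
    by (intro Bb_mult Bb_diff) (auto intro: Bb_mono)
  have late: "(\<integral>\<omega>. indicator B \<omega> * (W k r v \<omega> - W k r u \<omega>) \<partial>S) = 0"
    if kuv: "k \<in> I" "u \<in> {s..T}" "v \<in> {u..T}" "B \<in> sets (path_alg pk r T u)" for k u v B
  proof -
    have "(\<lambda>\<omega>. indicator B \<omega> * (W k r v \<omega> - W k r u \<omega>)) \<in> Bb pk T r T"
      using incr[OF kuv(1) _ kuv(3,4)] kuv(2,3) s by (auto intro: Bb_mono)
    then have "(\<integral>\<omega>. indicator B \<omega> * (W k r v \<omega> - W k r u \<omega>) \<partial>S) =
        (\<integral>\<omega>. L (\<lambda>\<omega>. indicator B \<omega> * (W k r v \<omega> - W k r u \<omega>)) \<omega> \<partial>Q)" by (rule S(3))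
    also have "\<dots> = (\<integral>\<omega>. 0 \<partial>Q)"
      using Lmart[OF kuv] by (intro Bochner_Integration.integral_cong) (auto simp: space)
    finally show ?thesis by simp
  qed
  have "is_solution pk r T I W y S"
  proof (rule is_solution_iff[where W = W, OF W, THEN iffD2], assumption, assumption, intro conjI ballI)
    have m: "{\<omega> \<in> Paths pk r T. \<omega> r = y} \<in> sets (path_alg pk r T u)" if "r \<le> u" for u
      using measurable_sets[OF measurable_coordinate[of r r u pk T], of "{y}"] that
      by (auto simp: vimage_def Int_def conj_commute)
    then have "{\<omega> \<in> Paths pk r T. \<omega> r = y} \<in> sets S" "{\<omega> \<in> Paths pk r T. \<omega> r = y} \<in> sets Q"
      using s prob_onD(2)[OF Qp] S(2) by auto
    with early[OF Bb_indicator[OF m]] s Q1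
    show "measure S {\<omega> \<in> Paths pk r T. \<omega> r = y} = 1"
      by (simp add: sets.Int_space_eq2)
  next
    fix k u v and B :: "'n path set" assume k: "k \<in> I" and u: "u \<in> {r..T}" and v: "v \<in> {u..T}" and B: "B \<in> sets (path_alg pk r T u)"
    \<comment> \<open>an interval that contains \<open>s\<close> is cut at \<open>s\<close>\<close>
    consider "v \<le> s" | "s \<le> u" | "u < s" "s < v" by linarith
    then show "(\<integral>\<omega>. indicator B \<omega> * (W k r v \<omega> - W k r u \<omega>) \<partial>S) = 0"
    proof cases
      case 1
      then show ?thesis using early[OF Bb_mono[OF incr[OF k u v B]]] Qm[OF k u v B] by simp
    next
      case 2
      with u have "u \<in> {s..T}" by simp
      then show ?thesis using late k v B by blast
    next
      case 3
      then have us: "s \<in> {u..T}" and ss: "s \<in> {s..T}" and vs: "v \<in> {s..T}" using s u v by auto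
      have Bs: "B \<in> sets (path_alg pk r T s)" using sets_path_alg_mono[of u s pk r T] 3 B by auto
      have sr: "s \<in> {r..T}" using s .
      have "(\<integral>\<omega>. indicator B \<omega> * (W k r v \<omega> - W k r u \<omega>) \<partial>S) =
        (\<integral>\<omega>. indicator B \<omega> * (W k r v \<omega> - W k r s \<omega>) + indicator B \<omega> * (W k r s \<omega> - W k r u \<omega>) \<partial>S)"
        by (simp add: algebra_simps)
      also have "\<dots> = (\<integral>\<omega>. indicator B \<omega> * (W k r v \<omega> - W k r s \<omega>) \<partial>S) +
          (\<integral>\<omega>. indicator B \<omega> * (W k r s \<omega> - W k r u \<omega>) \<partial>S)"
        using vs sT by (intro Bochner_Integration.integral_add integrable_Bb[OF Sp]
            Bb_mono[OF incr[OF k sr vs Bs]] Bb_mono[OF incr[OF k u us B]]) auto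
      also have "\<dots> = 0"
        using late[OF k ss vs Bs] early[OF incr[OF k u us B]] Qm[OF k u us B] by simp
      finally show ?thesis .
    qed
  qed (rule Sp)
  with uniq Q have "S = Q" by blast
  with S(3)[OF \<psi>] show ?thesis by simp
qed

text \<open>As events of the past of \<open>s\<close> can be taken out of \<open>L\<close>, invariance of \<open>Q\<close> under \<open>L\<close> is the
  defining property of the conditional expectation.\<close>

lemma unique_solution_cond_exp:
  fixes Q :: "('n::finite) path measure"
  assumes W: "\<And>k u. k \<in> I \<Longrightarrow> u \<in> {r..T} \<Longrightarrow> W k r u \<in> Bb pk T r u"
    and uniq: "\<exists>!Q. is_solution pk r T I W y Q" and Q: "is_solution pk r T I W y Q"
    and s: "s \<in> {r..T}" and L: "nonneg_linear_below pk T r s L"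
    and Lid: "\<And>\<phi> \<omega>. \<phi> \<in> Bb pk T r s \<Longrightarrow> \<omega> \<in> Paths pk r T \<Longrightarrow> L \<phi> \<omega> = \<phi> \<omega>"
    and Lmart: "\<And>k u v B \<omega>. k \<in> I \<Longrightarrow> u \<in> {s..T} \<Longrightarrow> v \<in> {u..T} \<Longrightarrow>
        B \<in> sets (path_alg pk r T u) \<Longrightarrow> \<omega> \<in> Paths pk r T \<Longrightarrow>
        L (\<lambda>\<omega>. indicator B \<omega> * (W k r v \<omega> - W k r u \<omega>)) \<omega> = 0"
    and \<psi>: "\<psi> \<in> Bb pk T r T"
  shows "AE \<omega> in Q. real_cond_exp Q (path_alg pk r T s) \<psi> \<omega> = L \<psi> \<omega>"
proof -
  have Qp: "prob_on (path_alg pk r T T) Q" using Q by (simp add: is_solution_def)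
  have sT: "s \<le> T" using s by simp
  have "(\<integral>\<omega>. indicator B \<omega> * \<psi> \<omega> \<partial>Q) = (\<integral>\<omega>. indicator B \<omega> * L \<psi> \<omega> \<partial>Q)"
    if B: "B \<in> sets (path_alg pk r T s)" for B
  proof -
    have B\<psi>: "(\<lambda>\<omega>. indicator B \<omega> * \<psi> \<omega>) \<in> Bb pk T r T"
      using Bb_mult[OF Bb_mono[OF Bb_indicator[OF B] sT] \<psi>] by simp
    have "(\<integral>\<omega>. indicator B \<omega> * \<psi> \<omega> \<partial>Q) = (\<integral>\<omega>. L (\<lambda>\<omega>. indicator B \<omega> * \<psi> \<omega>) \<omega> \<partial>Q)"
      by (rule unique_solution_invariant[OF W uniq Q s L _ _ B\<psi>, symmetric]) (simp_all add: Lid Lmart)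
    also have "\<dots> = (\<integral>\<omega>. indicator B \<omega> * L \<psi> \<omega> \<partial>Q)"
      using nonneg_linear_below_pull_out[OF L sT Lid B \<psi>] prob_onD(3)[OF Qp] by (intro Bochner_Integration.integral_cong) auto
    finally show ?thesis .
  qed
  then show ?thesis
    using cond_exp_Bb_iff[OF Qp sT \<psi> nonneg_linear_belowD(1)[OF L \<psi>]] by simp
qed

locale theta_family =
  fixes pk :: path_kind and T :: real
    and \<Theta> :: "('n::finite, 'e::topological_space) coefficient set"
    and I :: "'k set" and Z :: "('n, 'e, 'k) problems"
  assumes hypothesis: "Theta_hypothesis pk T \<Theta> I Z"
begin

abbreviation \<Omega> :: "real \<Rightarrow> 'n path set" where
  "\<Omega> r \<equiv> Paths pk r T"

abbreviation \<B> :: "real \<Rightarrow> real \<Rightarrow> 'n path set set" where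
  "\<B> r u \<equiv> sets (path_alg pk r T u)"

abbreviation Zc where "Zc \<theta> \<equiv> on_paths (Z \<theta>)"

abbreviation Qc where "Qc \<equiv> Q_theta pk T I Z"

abbreviation Tc where "Tc \<equiv> T_theta pk T I Z"

section \<open>The martingale problem of a single coefficient\<close>

lemma unique_solution_coefficient:
  "\<theta> \<in> \<Theta> \<Longrightarrow> 0 \<le> s \<Longrightarrow> s < T \<Longrightarrow> \<exists>!Q. is_solution pk s T I (Zc \<theta>) x Q"
  using hypothesis unfolding Theta_hypothesis_def by auto

lemma is_solution_Q_theta:
  "\<theta> \<in> \<Theta> \<Longrightarrow> 0 \<le> s \<Longrightarrow> s < T \<Longrightarrow> is_solution pk s T I (Zc \<theta>) x (Qc \<theta> s x)"
  unfolding Q_theta_def by (rule theI'[OF unique_solution_coefficient])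

lemma prob_on_Q_theta:
  "\<theta> \<in> \<Theta> \<Longrightarrow> 0 \<le> s \<Longrightarrow> s < T \<Longrightarrow> prob_on (path_alg pk s T T) (Qc \<theta> s x)"
  using is_solution_Q_theta unfolding is_solution_def by blast

lemma AE_Q_theta_start:
  assumes "\<theta> \<in> \<Theta>" "0 \<le> s" "s < T"
  shows "AE \<omega> in Qc \<theta> s x. \<omega> s = x"
proof -
  interpret prob_space "Qc \<theta> s x" using prob_onD(1)[OF prob_on_Q_theta[OF assms]] .
  have "prob {\<omega> \<in> space (Qc \<theta> s x). \<omega> s = x} = 1"
    using is_solution_Q_theta[OF assms] unfolding is_solution_def by blast
  then show ?thesis by (rule AE_prob_1[THEN AE_mp]) simp
qed

lemma measurable_Q_theta:
  assumes "\<theta> \<in> \<Theta>" "0 \<le> s" "s < T"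
  shows "Qc \<theta> s \<in> measurable borel (prob_algebra (path_alg pk s T T))"
proof (rule weakly_continuous_imp_measurable_kernel)
  show "weakly_continuous pk s T (Qc \<theta> s)"
    using hypothesis assms unfolding Theta_hypothesis_def by blast
qed (rule prob_on_Q_theta[OF assms])

lemma problem_in_Bb:
  assumes "\<theta> \<in> \<Theta>" "k \<in> I" "0 \<le> r" "r \<le> a" "a \<le> b" "b \<le> T"
  shows "Zc \<theta> k a b \<in> Bb pk T r b"
proof -
  have add: "additive_problem pk T I (Z \<theta>)" and bd: "bounded_problem pk T I (Z \<theta>)"
    using hypothesis assms(1) unfolding Theta_hypothesis_def by blast+
  have "Z \<theta> k a b \<in> borel_measurable (path_alg pk a b b)"
    using add assms unfolding additive_problem_def by simp
  from measurable_compose[OF measurable_restrict_path this, of r b T]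
  have "Zc \<theta> k a b \<in> borel_measurable (path_alg pk r T b)"
    using assms by (simp add: on_paths_def[abs_def])
  moreover have "bounded (Zc \<theta> k a b ` \<Omega> r)"
  proof (rule bounded_subset)
    show "bounded (Z \<theta> k a b ` Paths pk a b)"
      using bd assms unfolding bounded_problem_def by simp
    show "Zc \<theta> k a b ` \<Omega> r \<subseteq> Z \<theta> k a b ` Paths pk a b"
      using assms by (auto simp: on_paths_def intro!: imageI restrict_in_Paths[of _ pk r T])
  qed
  ultimately show ?thesis by (simp add: Bb_def)
qed

lemma problem_additive:
  assumes "\<theta> \<in> \<Theta>" "k \<in> I" "0 \<le> r" "r \<le> a" "a \<le> b" "b \<le> c" "c \<le> T" "\<omega> \<in> \<Omega> r"
  shows "Zc \<theta> k a c \<omega> = Zc \<theta> k a b \<omega> + Zc \<theta> k b c \<omega>"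
proof -
  let ?\<omega> = "restrict \<omega> {a..c}"
  have "additive_problem pk T I (Z \<theta>)"
    using hypothesis assms(1) unfolding Theta_hypothesis_def by blast
  moreover have "?\<omega> \<in> Paths pk a c" using restrict_in_Paths assms by blast
  ultimately have "Zc \<theta> k a c ?\<omega> = Zc \<theta> k a b ?\<omega> + Zc \<theta> k b c ?\<omega>"
    using assms unfolding additive_problem_def by auto
  moreover have "restrict ?\<omega> {a..b} = restrict \<omega> {a..b}" "restrict ?\<omega> {b..c} = restrict \<omega> {b..c}"
    using assms by (auto simp: restrict_def fun_eq_iff)
  ultimately show ?thesis by (simp add: on_paths_def)
qed

lemma problem_zero:
  assumes "\<theta> \<in> \<Theta>" "k \<in> I" "0 \<le> r" "r \<le> a" "a \<le> T" "\<omega> \<in> \<Omega> r"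
  shows "Zc \<theta> k a a \<omega> = 0"
  using problem_additive[of \<theta> k r a a a \<omega>] assms by simp

section \<open>Canonical conditional expectations of a single coefficient\<close>

lemma Bb_pasted:
  assumes "\<psi> \<in> Bb pk T r u" "\<omega> \<in> \<Omega> r" "r \<le> s" "s \<le> u" "u \<le> T"
  shows "(\<lambda>\<omega>'. \<psi> (paste r s T \<omega> \<omega>')) \<in> Bb pk T s u"
proof -
  have "(\<lambda>\<omega>'. \<psi> (paste r s T \<omega> \<omega>')) \<in> borel_measurable (path_alg pk s T u)"
    using measurable_compose[OF measurable_paste_right] assms unfolding Bb_def by blast
  moreover have "bounded ((\<lambda>\<omega>'. \<psi> (paste r s T \<omega> \<omega>')) ` \<Omega> s)"
    by (rule bounded_subset[of "\<psi> ` \<Omega> r"])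
      (use assms in \<open>auto simp: Bb_def intro!: imageI paste_in_Paths\<close>)
  ultimately show ?thesis by (simp add: Bb_def)
qed

lemma integrable_pasted:
  assumes "\<theta> \<in> \<Theta>" "\<psi> \<in> Bb pk T r T" "\<omega> \<in> \<Omega> r" "0 \<le> r" "r \<le> s" "s < T"
  shows "integrable (Qc \<theta> s x) (\<lambda>\<omega>'. \<psi> (paste r s T \<omega> \<omega>'))"
  using assms by (intro integrable_Bb[OF prob_on_Q_theta] Bb_pasted) auto

text \<open>The operator at time \<open>s\<close> averages over paths that follow \<open>\<omega>\<close> up to \<open>s\<close>; hence anything
  known at time \<open>s\<close> may be treated as a constant.\<close>

lemma T_theta_cong:
  assumes "\<theta> \<in> \<Theta>" "\<omega> \<in> \<Omega> r" "0 \<le> r" "r \<le> s" "s < T"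
    and "\<And>\<omega>'. \<omega>' \<in> \<Omega> r \<Longrightarrow> (\<And>v. v \<in> {r..s} \<Longrightarrow> \<omega>' v = \<omega> v) \<Longrightarrow> \<psi> \<omega>' = \<phi> \<omega>'"
  shows "Tc r \<theta> s \<psi> \<omega> = Tc r \<theta> s \<phi> \<omega>"
  unfolding T_theta_def
proof (rule Bochner_Integration.integral_cong[OF refl])
  fix \<omega>' assume "\<omega>' \<in> space (Qc \<theta> s (\<omega> s))"
  then have "\<omega>' \<in> \<Omega> s" using prob_onD(3)[OF prob_on_Q_theta] assms by auto
  then show "\<psi> (paste r s T \<omega> \<omega>') = \<phi> (paste r s T \<omega> \<omega>')"
    using assms by (intro assms(6) paste_in_Paths) (auto simp: paste_before)
qed

lemma T_theta_in_Bb: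
  assumes "\<theta> \<in> \<Theta>" "\<psi> \<in> Bb pk T r T" "0 \<le> r" "r \<le> s" "s < T"
  shows "Tc r \<theta> s \<psi> \<in> Bb pk T r s"
proof -
  have "(\<lambda>\<omega>. \<omega> s) \<in> borel_measurable (path_alg pk r T s :: 'n path measure)"
    using assms by (intro measurable_coordinate) auto
  from measurable_compose[OF this measurable_Q_theta]
  have L: "(\<lambda>\<omega>. Qc \<theta> s (\<omega> s)) \<in> measurable (path_alg pk r T s) (prob_algebra (path_alg pk s T T))"
    using assms by auto
  have "(\<lambda>(\<omega>, \<omega>'). \<psi> (paste r s T \<omega> \<omega>')) \<in> borel_measurable (path_alg pk r T s \<Otimes>\<^sub>M path_alg pk s T T)"
    using measurable_compose[OF measurable_paste[of r s T T pk], of \<psi> borel] assms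
    by (simp add: Bb_def case_prod_beta)
  from borel_measurable_integral_kernel[OF this L]
  have m: "Tc r \<theta> s \<psi> \<in> borel_measurable (path_alg pk r T s)"
    unfolding T_theta_def .
  obtain c where c: "\<And>\<omega>. \<omega> \<in> \<Omega> r \<Longrightarrow> \<bar>\<psi> \<omega>\<bar> \<le> c"
    using assms(2) unfolding Bb_def bounded_iff by auto
  have "\<bar>Tc r \<theta> s \<psi> \<omega>\<bar> \<le> c" if w: "\<omega> \<in> \<Omega> r" for \<omega>
  proof -
    note Q = prob_on_Q_theta[OF assms(1) order_trans[OF assms(3,4)] assms(5), of "\<omega> s"]
    interpret prob_space "Qc \<theta> s (\<omega> s)" using prob_onD(1)[OF Q] .
    note int = integrable_pasted[OF assms(1,2) w assms(3-5), of "\<omega> s"]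
    have b: "\<bar>\<psi> (paste r s T \<omega> \<omega>')\<bar> \<le> c" if "\<omega>' \<in> space (Qc \<theta> s (\<omega> s))" for \<omega>'
      using c paste_in_Paths[OF w] that assms prob_onD(3)[OF Q] by auto
    have "Tc r \<theta> s \<psi> \<omega> \<le> c"
      unfolding T_theta_def using b by (intro integral_le_const[OF int] AE_I2) (auto simp: abs_le_iff)
    moreover have "- c \<le> Tc r \<theta> s \<psi> \<omega>"
      unfolding T_theta_def using b by (intro integral_ge_const[OF int] AE_I2) (force simp: abs_le_iff)
    ultimately show ?thesis by simp
  qed
  with m show ?thesis unfolding Bb_def bounded_iff by auto
qed

lemma T_theta_nonneg_linear_below:
  assumes "\<theta> \<in> \<Theta>" "0 \<le> r" "r \<le> s" "s < T"
  shows "nonneg_linear_below pk T r s (Tc r \<theta> s)"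
  unfolding nonneg_linear_below_def
proof (intro conjI ballI allI impI)
  note int = integrable_pasted[OF assms(1) _ _ assms(2-4)]
  have s: "0 \<le> s" using assms by simp
  note Q = prob_on_Q_theta[OF assms(1) s assms(4)]
  have in_paths: "paste r s T \<omega> \<omega>' \<in> \<Omega> r" if "\<omega> \<in> \<Omega> r" "\<omega>' \<in> space (Qc \<theta> s (\<omega> s))" for \<omega> \<omega>'
    using paste_in_Paths[OF that(1)] that(2) prob_onD(3)[OF Q] assms by auto
  show "Tc r \<theta> s \<psi> \<in> Bb pk T r s" if "\<psi> \<in> Bb pk T r T" for \<psi>
    using T_theta_in_Bb[OF assms(1) that assms(2-4)] .
  show "Tc r \<theta> s (\<lambda>\<omega>. a * \<psi> \<omega> + b * \<phi> \<omega>) \<omega> = a * Tc r \<theta> s \<psi> \<omega> + b * Tc r \<theta> s \<phi> \<omega>"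
    if "\<psi> \<in> Bb pk T r T" "\<phi> \<in> Bb pk T r T" "\<omega> \<in> \<Omega> r" for \<psi> \<phi> a b \<omega>
    unfolding T_theta_def using int[OF that(1,3)] int[OF that(2,3)] by simp
  show "0 \<le> Tc r \<theta> s \<psi> \<omega>"
    if "\<psi> \<in> Bb pk T r T" "\<forall>\<omega>\<in>\<Omega> r. 0 \<le> \<psi> \<omega>" "\<omega> \<in> \<Omega> r" for \<psi> \<omega>
    unfolding T_theta_def using in_paths that by (intro integral_nonneg_AE AE_I2) auto
  fix F \<psi> \<omega> assume \<psi>: "\<psi> \<in> Bb pk T r T" and w: "\<omega> \<in> \<Omega> r"
    and F: "(\<forall>m. F m \<in> Bb pk T r T) \<and>
      (\<forall>\<omega>\<in>\<Omega> r. incseq (\<lambda>m. F m \<omega>) \<and> (\<lambda>m. F m \<omega>) \<longlonglongrightarrow> \<psi> \<omega>)"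
  have Fm: "F m \<in> Bb pk T r T" for m using F by blast
  show "(\<lambda>m. Tc r \<theta> s (F m) \<omega>) \<longlonglongrightarrow> Tc r \<theta> s \<psi> \<omega>"
    unfolding T_theta_def
  proof (rule integral_dominated_convergence[where
        w = "\<lambda>\<omega>'. \<bar>F 0 (paste r s T \<omega> \<omega>')\<bar> + \<bar>\<psi> (paste r s T \<omega> \<omega>')\<bar>"])
    show "AE \<omega>' in Qc \<theta> s (\<omega> s). norm (F m (paste r s T \<omega> \<omega>')) \<le>
        \<bar>F 0 (paste r s T \<omega> \<omega>')\<bar> + \<bar>\<psi> (paste r s T \<omega> \<omega>')\<bar>" for m
    proof (rule AE_I2)
      fix \<omega>' assume "\<omega>' \<in> space (Qc \<theta> s (\<omega> s))"
      then have p: "paste r s T \<omega> \<omega>' \<in> \<Omega> r" using in_paths w by blast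
      have "F 0 (paste r s T \<omega> \<omega>') \<le> F m (paste r s T \<omega> \<omega>')"
        using F p by (auto simp: incseq_def)
      moreover have "F m (paste r s T \<omega> \<omega>') \<le> \<psi> (paste r s T \<omega> \<omega>')"
        using F p by (intro incseq_le) auto
      ultimately show "norm (F m (paste r s T \<omega> \<omega>')) \<le>
        \<bar>F 0 (paste r s T \<omega> \<omega>')\<bar> + \<bar>\<psi> (paste r s T \<omega> \<omega>')\<bar>" by simp
    qed
    show "AE \<omega>' in Qc \<theta> s (\<omega> s). (\<lambda>m. F m (paste r s T \<omega> \<omega>')) \<longlonglongrightarrow> \<psi> (paste r s T \<omega> \<omega>')"
      using F in_paths[OF w] by (intro AE_I2) auto
  qed (use int[OF \<psi> w] int[OF Fm w] in \<open>auto intro: borel_measurable_integrable\<close>)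
qed

lemma T_theta_pull_out:
  assumes "\<theta> \<in> \<Theta>" "\<phi> \<in> Bb pk T r s" "\<omega> \<in> \<Omega> r" "0 \<le> r" "r \<le> s" "s < T"
  shows "Tc r \<theta> s (\<lambda>\<omega>. \<phi> \<omega> * \<psi> \<omega>) \<omega> = \<phi> \<omega> * Tc r \<theta> s \<psi> \<omega>"
proof -
  have "Tc r \<theta> s (\<lambda>\<omega>. \<phi> \<omega> * \<psi> \<omega>) \<omega> = Tc r \<theta> s (\<lambda>\<omega>'. \<phi> \<omega> * \<psi> \<omega>') \<omega>"
    using Bb_determined[OF assms(2) _ assms(3)] by (intro T_theta_cong[OF assms(1,3-6)]) simp
  also have "\<dots> = \<phi> \<omega> * Tc r \<theta> s \<psi> \<omega>" by (simp add: T_theta_def)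
  finally show ?thesis .
qed

lemma T_theta_known:
  assumes "\<theta> \<in> \<Theta>" "\<phi> \<in> Bb pk T r s" "\<omega> \<in> \<Omega> r" "0 \<le> r" "r \<le> s" "s < T"
  shows "Tc r \<theta> s \<phi> \<omega> = \<phi> \<omega>"
proof -
  have "0 \<le> s" using assms by simp
  interpret prob_space "Qc \<theta> s (\<omega> s)"
    using prob_onD(1)[OF prob_on_Q_theta[OF assms(1) \<open>0 \<le> s\<close> assms(6)]] .
  have "Tc r \<theta> s (\<lambda>_. 1) \<omega> = 1" by (simp add: T_theta_def prob_space)
  with T_theta_pull_out[OF assms, of "\<lambda>_. 1"] show ?thesis by simp
qed

text \<open>Almost every path under the solution from \<open>\<omega> s\<close> starts at \<open>\<omega> s\<close>, and then pasting leaves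
  it unchanged after \<open>s\<close>. So this is the martingale property of that solution.\<close>

lemma T_theta_increment:
  assumes \<theta>: "\<theta> \<in> \<Theta>" and k: "k \<in> I" and w: "\<omega> \<in> \<Omega> r" and r: "0 \<le> r" "r \<le> s" "s < T"
    and uv: "s \<le> u" "u \<le> v" "v \<le> T" and B: "B \<in> \<B> r u"
  shows "Tc r \<theta> s (\<lambda>\<omega>. indicator B \<omega> * Zc \<theta> k u v \<omega>) \<omega> = 0"
proof -
  have s: "0 \<le> s" using r by simp
  have uT: "u \<le> T" using uv by simp
  let ?Q = "Qc \<theta> s (\<omega> s)" and ?B = "{\<omega>' \<in> \<Omega> s. paste r s T \<omega> \<omega>' \<in> B}"
  have B': "?B \<in> \<B> s u"
    using measurable_sets[OF measurable_paste_right[OF r(2) uv(1) uT w] B]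
    by (simp add: vimage_def Int_def conj_commute)
  have "Tc r \<theta> s (\<lambda>\<omega>. indicator B \<omega> * Zc \<theta> k u v \<omega>) \<omega> =
      (\<integral>\<omega>'. indicator ?B \<omega>' * (Zc \<theta> k s v \<omega>' - Zc \<theta> k s u \<omega>') \<partial>?Q)"
    unfolding T_theta_def
  proof (rule integral_cong_AE)
    have "(\<lambda>\<omega>. indicator B \<omega> * Zc \<theta> k u v \<omega>) \<in> Bb pk T r T"
      using Bb_mono[OF Bb_indicator[OF B] uT] problem_in_Bb[OF \<theta> k r(1), of u v] uv r
      by (intro Bb_mult) (auto intro: Bb_mono)
    from integrable_pasted[OF \<theta> this w r]
    show "(\<lambda>\<omega>'. indicator B (paste r s T \<omega> \<omega>') * Zc \<theta> k u v (paste r s T \<omega> \<omega>')) \<in> borel_measurable ?Q"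
      by simp
    have "(\<lambda>\<omega>'. indicator ?B \<omega>' * (Zc \<theta> k s v \<omega>' - Zc \<theta> k s u \<omega>')) \<in> Bb pk T s T"
      using Bb_mono[OF Bb_indicator[OF B'] uT] uv
      by (intro Bb_mult Bb_diff Bb_mono[OF problem_in_Bb[OF \<theta> k s order_refl]]) auto
    from integrable_Bb[OF prob_on_Q_theta[OF \<theta> s r(3)] this]
    show "(\<lambda>\<omega>'. indicator ?B \<omega>' * (Zc \<theta> k s v \<omega>' - Zc \<theta> k s u \<omega>')) \<in> borel_measurable ?Q"
      by simp
    show "AE \<omega>' in ?Q. indicator B (paste r s T \<omega> \<omega>') * Zc \<theta> k u v (paste r s T \<omega> \<omega>') =
        indicator ?B \<omega>' * (Zc \<theta> k s v \<omega>' - Zc \<theta> k s u \<omega>')"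
      using AE_Q_theta_start[OF \<theta> s r(3), of "\<omega> s"] AE_space
    proof eventually_elim
      fix \<omega>' assume e: "\<omega>' s = \<omega> s" and "\<omega>' \<in> space ?Q"
      then have w': "\<omega>' \<in> \<Omega> s" using prob_onD(3)[OF prob_on_Q_theta[OF \<theta> s r(3)]] by simp
      have "restrict (paste r s T \<omega> \<omega>') {u..v} = restrict \<omega>' {u..v}"
        using e uv r by (auto simp: restrict_def fun_eq_iff paste_after)
      then have "Zc \<theta> k u v (paste r s T \<omega> \<omega>') = Zc \<theta> k u v \<omega>'" by (simp add: on_paths_def)
      moreover have "Zc \<theta> k s v \<omega>' = Zc \<theta> k s u \<omega>' + Zc \<theta> k u v \<omega>'"
        using problem_additive[OF \<theta> k s order_refl uv w'] .
      ultimately show "indicator B (paste r s T \<omega> \<omega>') * Zc \<theta> k u v (paste r s T \<omega> \<omega>') =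
        indicator ?B \<omega>' * (Zc \<theta> k s v \<omega>' - Zc \<theta> k s u \<omega>')"
        using w' by (simp add: indicator_def)
    qed
  qed
  also have "\<dots> = 0"
  proof -
    have "Zc \<theta> k' s u' \<in> Bb pk T s u'" if "k' \<in> I" "u' \<in> {s..T}" for k' u'
      using problem_in_Bb[OF \<theta> that(1) s] that(2) by simp
    from is_solution_iff[where W = "Zc \<theta>", OF this, THEN iffD1, OF _ _ is_solution_Q_theta[OF \<theta> s r(3), of "\<omega> s"]]
    show ?thesis using k uv B' by auto
  qed
  finally show ?thesis .
qed

text \<open>With \<open>\<omega>\<close> fixed up to \<open>s\<close>, this is the invariance of the solution from \<open>\<omega> s\<close> at time \<open>s\<close>
  under its own operator at time \<open>t\<close>, that is, the Markov property. It is an instance of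
  \<open>unique_solution_invariant\<close>.\<close>

lemma T_theta_tower:
  assumes \<theta>: "\<theta> \<in> \<Theta>" and \<psi>: "\<psi> \<in> Bb pk T r T" and w: "\<omega> \<in> \<Omega> r"
    and r: "0 \<le> r" "r \<le> s" "s \<le> t" "t < T"
  shows "Tc r \<theta> s (Tc r \<theta> t \<psi>) \<omega> = Tc r \<theta> s \<psi> \<omega>"
proof -
  have s: "0 \<le> s" "s < T" and rt: "r \<le> t" using r by auto
  let ?Q = "Qc \<theta> s (\<omega> s)" and ?\<psi> = "\<lambda>\<omega>'. \<psi> (paste r s T \<omega> \<omega>')"
  have \<psi>': "?\<psi> \<in> Bb pk T s T" using Bb_pasted[OF \<psi> w] r by simp
  have "Tc r \<theta> s (Tc r \<theta> t \<psi>) \<omega> = (\<integral>\<omega>'. Tc s \<theta> t ?\<psi> \<omega>' \<partial>?Q)"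
    unfolding T_theta_def[of pk T I Z r \<theta> s]
  proof (rule integral_cong_AE)
    show "(\<lambda>\<omega>'. Tc r \<theta> t \<psi> (paste r s T \<omega> \<omega>')) \<in> borel_measurable ?Q"
      using integrable_pasted[OF \<theta> Bb_mono[OF T_theta_in_Bb[OF \<theta> \<psi> r(1) rt r(4)]] w r(1,2) s(2), of "\<omega> s"] r
      by auto
    show "Tc s \<theta> t ?\<psi> \<in> borel_measurable ?Q"
      using integrable_Bb[OF prob_on_Q_theta[OF \<theta> s] Bb_mono[OF T_theta_in_Bb[OF \<theta> \<psi>' s(1) r(3,4)]], of "\<omega> s"] r
      by auto
    show "AE \<omega>' in ?Q. Tc r \<theta> t \<psi> (paste r s T \<omega> \<omega>') = Tc s \<theta> t ?\<psi> \<omega>'"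
      using AE_Q_theta_start[OF \<theta> s, of "\<omega> s"] AE_space
    proof eventually_elim
      fix \<omega>' assume e: "\<omega>' s = \<omega> s" and "\<omega>' \<in> space ?Q"
      have "paste r s T \<omega> \<omega>' t = \<omega>' t" using r e by (simp add: paste_after)
      moreover have "paste r t T (paste r s T \<omega> \<omega>') \<omega>'' = paste r s T \<omega> (paste s t T \<omega>' \<omega>'')" for \<omega>''
        using r s by (auto simp: paste_def fun_eq_iff restrict_def)
      ultimately show "Tc r \<theta> t \<psi> (paste r s T \<omega> \<omega>') = Tc s \<theta> t ?\<psi> \<omega>'"
        by (simp add: T_theta_def)
    qed
  qed
  also have "\<dots> = (\<integral>\<omega>'. ?\<psi> \<omega>' \<partial>?Q)"
  proof (rule unique_solution_invariant[where W = "Zc \<theta>" and I = I and y = "\<omega> s"])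
    show "Zc \<theta> k s u \<in> Bb pk T s u" if "k \<in> I" "u \<in> {s..T}" for k u
      using problem_in_Bb[OF \<theta> that(1) s(1)] that(2) by simp
    show "Tc s \<theta> t (\<lambda>\<omega>. indicator B \<omega> * (Zc \<theta> k s v \<omega> - Zc \<theta> k s u \<omega>)) \<omega>' = 0"
      if *: "k \<in> I" "u \<in> {t..T}" "v \<in> {u..T}" "B \<in> \<B> s u" "\<omega>' \<in> \<Omega> s" for k u v B \<omega>'
    proof -
      have "Tc s \<theta> t (\<lambda>\<omega>. indicator B \<omega> * (Zc \<theta> k s v \<omega> - Zc \<theta> k s u \<omega>)) \<omega>' =
          Tc s \<theta> t (\<lambda>\<omega>. indicator B \<omega> * Zc \<theta> k u v \<omega>) \<omega>'"
        using problem_additive[OF \<theta> *(1) s(1) order_refl, of u v] * r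
        by (intro T_theta_cong[OF \<theta> *(5) s(1) r(3,4)]) simp
      also have "\<dots> = 0" using * r by (intro T_theta_increment[OF \<theta> *(1,5) s(1) r(3,4)]) auto
      finally show ?thesis .
    qed
  qed (use unique_solution_coefficient[OF \<theta> s] is_solution_Q_theta[OF \<theta> s] \<psi>'
      T_theta_nonneg_linear_below[OF \<theta> s(1) r(3,4)] T_theta_known[OF \<theta> _ _ s(1) r(3,4)] r in auto)
  also have "\<dots> = Tc r \<theta> s \<psi> \<omega>" by (simp add: T_theta_def)
  finally show ?thesis .
qed

end

section \<open>Subdivisions and cells of a step process\<close>

text \<open>Backward induction along a finite set of times, for properties of all times in between: one
  may assume the property at all later times of the set.\<close>

lemma backward_induct:
  fixes P :: "real \<Rightarrow> bool"
  assumes "finite D" "a \<le> u" "u \<le> b" and base: "P b"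
    and step: "\<And>u. a \<le> u \<Longrightarrow> u < b \<Longrightarrow> (\<And>w. w \<in> D \<Longrightarrow> u < w \<Longrightarrow> w \<le> b \<Longrightarrow> P w) \<Longrightarrow> P u"
  shows "P u"
  using assms(2,3)
proof (induction "card {d \<in> D. u < d}" arbitrary: u rule: less_induct)
  case less
  show ?case
  proof (cases "u = b")
    case False
    show ?thesis
    proof (rule step)
      fix w assume w: "w \<in> D" "u < w" "w \<le> b"
      then have "{d \<in> D. w < d} \<subset> {d \<in> D. u < d}" by auto
      then have "card {d \<in> D. w < d} < card {d \<in> D. u < d}"
        using assms(1) by (intro psubset_card_mono) auto
      then show "P w" using less w by simp
    qed (use less False in auto)
  qed (simp add: base)
qed

definition next_node :: "('n::finite, 'e) step_process \<Rightarrow> real \<Rightarrow> real" where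
  "next_node \<gamma> u = node \<gamma> (Suc (step_at \<gamma> u))"

text \<open>The requirements on a step process that concern its subdivision, cells and coefficients.
  Predictability is a consequence, see \<open>step_structure_predictable\<close>.\<close>

definition step_structure ::
    "path_kind \<Rightarrow> real \<Rightarrow> ('n::finite, 'e) coefficient set \<Rightarrow> real \<Rightarrow> ('n, 'e) step_process \<Rightarrow> bool" where
  "step_structure pk T \<Theta> r \<gamma> \<longleftrightarrow> node \<gamma> 0 = r \<and> node \<gamma> (nsteps \<gamma>) = T \<and>
     (\<forall>i<nsteps \<gamma>.
        node \<gamma> i < node \<gamma> (Suc i) \<and>
        finite (idx \<gamma> i) \<and>
        (\<Union>j\<in>idx \<gamma> i. cell \<gamma> i j) = Paths pk r T \<and>
        disjoint_family_on (cell \<gamma> i) (idx \<gamma> i) \<and>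
        (\<forall>j\<in>idx \<gamma> i. cell \<gamma> i j \<in> sets (path_alg pk r T (node \<gamma> i)) \<and> coef \<gamma> i j \<in> \<Theta>))"

context
  fixes pk :: path_kind and T r :: real and \<Theta> :: "('n::finite, 'e) coefficient set"
    and \<gamma> :: "('n, 'e) step_process"
  assumes \<gamma>: "step_structure pk T \<Theta> r \<gamma>"
begin

lemma node_ends: "node \<gamma> 0 = r" "node \<gamma> (nsteps \<gamma>) = T"
  using \<gamma> by (simp_all add: step_structure_def)

lemma node_strict_mono: "i < j \<Longrightarrow> j \<le> nsteps \<gamma> \<Longrightarrow> node \<gamma> i < node \<gamma> j"
proof (induction j)
  case (Suc j)
  have "node \<gamma> j < node \<gamma> (Suc j)" using \<gamma> Suc.prems by (simp add: step_structure_def)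
  with Suc show ?case by (cases "i = j") auto
qed simp

lemma node_mono: "i \<le> j \<Longrightarrow> j \<le> nsteps \<gamma> \<Longrightarrow> node \<gamma> i \<le> node \<gamma> j"
  using node_strict_mono[of i j] by (cases "i = j") auto

lemma node_range: "i \<le> nsteps \<gamma> \<Longrightarrow> r \<le> node \<gamma> i \<and> node \<gamma> i \<le> T"
  using node_mono[of 0 i] node_mono[of i "nsteps \<gamma>"] node_ends by simp

lemma step_at_unique:
  assumes "i < nsteps \<gamma>" "node \<gamma> i \<le> u" "u < node \<gamma> (Suc i)"
  shows "step_at \<gamma> u = i"
  unfolding step_at_def
proof (rule the_equality)
  fix j assume j: "j < nsteps \<gamma> \<and> node \<gamma> j \<le> u \<and> u < node \<gamma> (Suc j)"
  have "\<not> i < j" using node_mono[of "Suc i" j] assms j by auto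
  moreover have "\<not> j < i" using node_mono[of "Suc j" i] assms j by auto
  ultimately show "j = i" by simp
qed (use assms in simp)

lemma step_at:
  assumes "r \<le> u" "u < T"
  shows "step_at \<gamma> u < nsteps \<gamma>" "node \<gamma> (step_at \<gamma> u) \<le> u" "u < next_node \<gamma> u" "next_node \<gamma> u \<le> T"
proof -
  let ?j = "LEAST j. u < node \<gamma> j"
  have ex: "u < node \<gamma> (nsteps \<gamma>)" using assms node_ends by simp
  then have j: "u < node \<gamma> ?j" "?j \<le> nsteps \<gamma>" by (auto intro: LeastI Least_le)
  then have "?j \<noteq> 0" using assms node_ends by (metis leD)
  then obtain i where i: "?j = Suc i" by (metis not0_implies_Suc)
  then have "\<not> u < node \<gamma> i" using not_less_Least[of i "\<lambda>j. u < node \<gamma> j"] by simp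
  with i j have *: "i < nsteps \<gamma>" "node \<gamma> i \<le> u" "u < node \<gamma> (Suc i)" by auto
  with step_at_unique[OF this] show "step_at \<gamma> u < nsteps \<gamma>" "node \<gamma> (step_at \<gamma> u) \<le> u" "u < next_node \<gamma> u"
    by (simp_all add: next_node_def)
  show "next_node \<gamma> u \<le> T"
    using step_at_unique[OF *] node_range[of "Suc i"] * by (simp add: next_node_def)
qed

lemma step_at_between:
  assumes "r \<le> u" "u \<le> t" "t < next_node \<gamma> u" "u < T"
  shows "step_at \<gamma> t = step_at \<gamma> u" "next_node \<gamma> t = next_node \<gamma> u"
proof -
  show "step_at \<gamma> t = step_at \<gamma> u"
    using step_at[of u] assms by (intro step_at_unique) (auto simp: next_node_def)
  then show "next_node \<gamma> t = next_node \<gamma> u" by (simp add: next_node_def)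
qed

lemma step_induct [consumes 3]:
  assumes "r \<le> u" "u \<le> T" and "P T"
    and "\<And>u. r \<le> u \<Longrightarrow> u < T \<Longrightarrow> P (next_node \<gamma> u) \<Longrightarrow> P u"
  shows "P u"
proof (rule backward_induct[of "node \<gamma> ` {..nsteps \<gamma>}" r u T P])
  fix u assume u: "r \<le> u" "u < T" and IH: "\<And>w. w \<in> node \<gamma> ` {..nsteps \<gamma>} \<Longrightarrow> u < w \<Longrightarrow> w \<le> T \<Longrightarrow> P w"
  have "next_node \<gamma> u \<in> node \<gamma> ` {..nsteps \<gamma>}" using step_at[OF u] by (auto simp: next_node_def)
  then have "P (next_node \<gamma> u)" using step_at(3,4)[OF u] by (rule IH)
  with u show "P u" by (rule assms(4))
qed (use assms(1-3) in simp_all)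

lemma cell_index_unique:
  assumes "i < nsteps \<gamma>" "\<omega> \<in> Paths pk r T"
  shows "\<exists>!j. j \<in> idx \<gamma> i \<and> \<omega> \<in> cell \<gamma> i j"
proof -
  have "(\<Union>j\<in>idx \<gamma> i. cell \<gamma> i j) = Paths pk r T" and d: "disjoint_family_on (cell \<gamma> i) (idx \<gamma> i)"
    using \<gamma> assms(1) by (simp_all add: step_structure_def)
  with assms(2) obtain j where "j \<in> idx \<gamma> i" "\<omega> \<in> cell \<gamma> i j" by blast
  with d show ?thesis by (intro ex1I[of _ j]) (auto simp: disjoint_family_on_def)
qed

lemma cell_sum:
  fixes F :: "nat \<Rightarrow> real"
  assumes "i < nsteps \<gamma>" "\<omega> \<in> Paths pk r T" "j \<in> idx \<gamma> i" "\<omega> \<in> cell \<gamma> i j"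
  shows "(\<Sum>j\<in>idx \<gamma> i. indicator (cell \<gamma> i j) \<omega> * F j) = F j"
proof -
  have fin: "finite (idx \<gamma> i)" using \<gamma> assms(1) by (simp add: step_structure_def)
  have "indicator (cell \<gamma> i l) \<omega> * F l = (if l = j then F j else 0)" if "l \<in> idx \<gamma> i" for l
    using cell_index_unique[OF assms(1,2)] assms(3,4) that by (auto simp: indicator_def)
  then show ?thesis using fin assms(3) by (simp add: sum.delta cong: sum.cong)
qed

lemma used_coef_cell:
  assumes "r \<le> u" "u < T" "\<omega> \<in> Paths pk r T"
  obtains j where "j \<in> idx \<gamma> (step_at \<gamma> u)" "\<omega> \<in> cell \<gamma> (step_at \<gamma> u) j"
    "used_coef \<gamma> u \<omega> = coef \<gamma> (step_at \<gamma> u) j" "used_coef \<gamma> u \<omega> \<in> \<Theta>"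
proof -
  note un = cell_index_unique[OF step_at(1)[OF assms(1,2)] assms(3)]
  from theI'[OF un] show ?thesis
    using \<gamma> step_at(1)[OF assms(1,2)]
    by (intro that[of "THE j. j \<in> idx \<gamma> (step_at \<gamma> u) \<and> \<omega> \<in> cell \<gamma> (step_at \<gamma> u) j"])
      (auto simp: used_coef_def Let_def step_structure_def)
qed

lemma used_coef_eqI:
  assumes "r \<le> u" "u < T" "\<omega> \<in> Paths pk r T" "i = step_at \<gamma> u" "j \<in> idx \<gamma> i" "\<omega> \<in> cell \<gamma> i j"
  shows "used_coef \<gamma> u \<omega> = coef \<gamma> i j"
  using cell_index_unique[OF step_at(1)[OF assms(1,2)] assms(3)] assms(4-6)
  by (simp add: used_coef_def Let_def the1_equality)

text \<open>The cells are fixed at the last node before \<open>u\<close>, so the coefficient in force is known there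
  and stays the same until the next node.\<close>

lemma used_coef_determined:
  assumes "r \<le> u" "u \<le> t" "t < next_node \<gamma> u" "u < T" "\<omega> \<in> Paths pk r T" "\<omega>' \<in> Paths pk r T"
    and "\<And>v. v \<in> {r..u} \<Longrightarrow> \<omega>' v = \<omega> v"
  shows "used_coef \<gamma> t \<omega>' = used_coef \<gamma> u \<omega>"
proof -
  let ?i = "step_at \<gamma> u"
  obtain j where j: "j \<in> idx \<gamma> ?i" "\<omega> \<in> cell \<gamma> ?i j" "used_coef \<gamma> u \<omega> = coef \<gamma> ?i j"
    using used_coef_cell[OF assms(1,4,5)] by blast
  have "cell \<gamma> ?i j \<in> sets (path_alg pk r T (node \<gamma> ?i))"
    using \<gamma> step_at(1)[OF assms(1,4)] j(1) by (simp add: step_structure_def)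
  from path_alg_event_determined[OF this assms(6,5)] assms(7) step_at(2)[OF assms(1,4)] j(2)
  have "\<omega>' \<in> cell \<gamma> ?i j" by auto
  then have "used_coef \<gamma> t \<omega>' = coef \<gamma> ?i j"
    using assms step_at_between[OF assms(1-4)] step_at[OF assms(1,4)] j(1)
    by (intro used_coef_eqI) auto
  with j(3) show ?thesis by simp
qed

end

section \<open>Canonical conditional expectations of a step process\<close>

context theta_family
begin

abbreviation Ts where "Ts \<equiv> T_step pk T I Z"

context
  fixes r :: real and \<gamma> :: "('n, 'e) step_process"
  assumes r: "0 \<le> r" and \<gamma>: "step_structure pk T \<Theta> r \<gamma>"
begin

lemma T_step_end: "Ts r \<gamma> T \<psi> = \<psi>"
  by (simp add: T_step_def)

lemma T_back_eq_T_step: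
  assumes "i < nsteps \<gamma>"
  shows "T_back pk T I Z r \<gamma> \<psi> (nsteps \<gamma> - Suc i) = Ts r \<gamma> (node \<gamma> (Suc i)) \<psi>"
proof (cases "Suc i = nsteps \<gamma>")
  case True
  then show ?thesis using node_ends[OF \<gamma>] by (simp add: T_step_end)
next
  case False
  with assms have i: "Suc i < nsteps \<gamma>" by simp
  then have "node \<gamma> (Suc i) < T" using node_strict_mono[OF \<gamma> i] node_ends[OF \<gamma>] by simp
  moreover have "step_at \<gamma> (node \<gamma> (Suc i)) = Suc i"
    using i node_strict_mono[OF \<gamma>, of "Suc i" "Suc (Suc i)"] by (intro step_at_unique[OF \<gamma>]) auto
  moreover have "nsteps \<gamma> - Suc i = Suc (nsteps \<gamma> - Suc (Suc i))" using i by simp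
  moreover have "nsteps \<gamma> - Suc (nsteps \<gamma> - Suc (Suc i)) = Suc i" using i by simp
  ultimately show ?thesis by (simp add: T_step_def Let_def)
qed

lemma T_step_mix:
  assumes "r \<le> u" "u < T"
  shows "Ts r \<gamma> u \<psi> = T_mix pk T I Z r \<gamma> (step_at \<gamma> u) u (Ts r \<gamma> (next_node \<gamma> u) \<psi>)"
  using assms T_back_eq_T_step[OF step_at(1)[OF \<gamma> assms]]
  by (simp add: T_step_def Let_def next_node_def)

text \<open>On each path exactly one cell contributes. In this form the recursion mentions only the
  coefficient in force and the next node.\<close>

lemma T_step_unfold:
  assumes "r \<le> u" "u < T" "\<omega> \<in> \<Omega> r"
  shows "Ts r \<gamma> u \<psi> \<omega> = Tc r (used_coef \<gamma> u \<omega>) u (Ts r \<gamma> (next_node \<gamma> u) \<psi>) \<omega>"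
proof -
  obtain j where "j \<in> idx \<gamma> (step_at \<gamma> u)" "\<omega> \<in> cell \<gamma> (step_at \<gamma> u) j"
    "used_coef \<gamma> u \<omega> = coef \<gamma> (step_at \<gamma> u) j"
    using used_coef_cell[OF \<gamma> assms] by blast
  with cell_sum[OF \<gamma> step_at(1)[OF \<gamma> assms(1,2)] assms(3)] show ?thesis
    by (simp add: T_step_mix[OF assms(1,2)] T_mix_def)
qed

lemma used_coef_in: "r \<le> u \<Longrightarrow> u < T \<Longrightarrow> \<omega> \<in> \<Omega> r \<Longrightarrow> used_coef \<gamma> u \<omega> \<in> \<Theta>"
  using used_coef_cell[OF \<gamma>] by metis

lemma T_step_nonneg_linear_below:
  assumes "r \<le> u" "u \<le> T"
  shows "nonneg_linear_below pk T r u (Ts r \<gamma> u)"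
  using \<gamma> assms
proof (induction rule: step_induct)
  case 1
  show ?case unfolding nonneg_linear_below_def T_step_end by auto
next
  case (2 u)
  let ?w = "next_node \<gamma> u"
  note w = step_at[OF \<gamma> 2(1,2)]
  note D = nonneg_linear_belowD[OF 2(3)]
  note mono = nonneg_linear_below_mono[OF 2(3)]
  have wT: "Ts r \<gamma> ?w \<psi> \<in> Bb pk T r T" if "\<psi> \<in> Bb pk T r T" for \<psi>
    using Bb_mono[OF D(1)[OF that]] w(4) by simp
  note th = T_theta_nonneg_linear_below[OF used_coef_in[OF 2(1,2)] r 2(1,2)]
  note E = nonneg_linear_belowD[OF th]
  note unf = T_step_unfold[OF 2(1,2)]
  show ?case
    unfolding nonneg_linear_below_def
  proof (intro conjI ballI allI impI)
    fix \<psi> :: "'n path \<Rightarrow> real" assume \<psi>: "\<psi> \<in> Bb pk T r T"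
    show "Ts r \<gamma> u \<psi> \<in> Bb pk T r u"
      unfolding T_step_mix[OF 2(1,2)] T_mix_def
    proof (intro Bb_sum Bb_mult)
      fix j assume j: "j \<in> idx \<gamma> (step_at \<gamma> u)"
      then have "cell \<gamma> (step_at \<gamma> u) j \<in> \<B> r (node \<gamma> (step_at \<gamma> u))" "coef \<gamma> (step_at \<gamma> u) j \<in> \<Theta>"
        using \<gamma> w(1) by (auto simp: step_structure_def)
      then show "indicator (cell \<gamma> (step_at \<gamma> u) j) \<in> Bb pk T r u"
        and "Tc r (coef \<gamma> (step_at \<gamma> u) j) u (Ts r \<gamma> ?w \<psi>) \<in> Bb pk T r u"
        using w(2) T_theta_in_Bb[OF _ wT[OF \<psi>] r 2(1,2)] by (auto intro: Bb_mono[OF Bb_indicator])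
    qed
    fix \<omega> assume \<omega>: "\<omega> \<in> \<Omega> r"
    show "Ts r \<gamma> u (\<lambda>\<omega>. a * \<psi> \<omega> + b * \<phi> \<omega>) \<omega> = a * Ts r \<gamma> u \<psi> \<omega> + b * Ts r \<gamma> u \<phi> \<omega>"
      if \<phi>: "\<phi> \<in> Bb pk T r T" for \<phi> a b
      unfolding unf[OF \<omega>] E(2)[OF \<omega> wT[OF \<psi>] wT[OF \<phi>] \<omega>, symmetric]
      by (rule T_theta_cong[OF used_coef_in[OF 2(1,2) \<omega>] \<omega> r 2(1,2)]) (rule D(2)[OF \<psi> \<phi>])
    show "0 \<le> Ts r \<gamma> u \<psi> \<omega>" if "\<forall>\<omega>\<in>\<Omega> r. 0 \<le> \<psi> \<omega>"
      unfolding unf[OF \<omega>] using that D(3)[OF \<psi>] by (intro E(3)[OF \<omega> wT[OF \<psi>] _ \<omega>]) auto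
    fix F assume "(\<forall>m. F m \<in> Bb pk T r T) \<and> (\<forall>\<omega>\<in>\<Omega> r. incseq (\<lambda>m. F m \<omega>) \<and> (\<lambda>m. F m \<omega>) \<longlonglongrightarrow> \<psi> \<omega>)"
    then have F: "\<And>m. F m \<in> Bb pk T r T" "\<And>\<omega>. \<omega> \<in> \<Omega> r \<Longrightarrow> incseq (\<lambda>m. F m \<omega>)"
      "\<And>\<omega>. \<omega> \<in> \<Omega> r \<Longrightarrow> (\<lambda>m. F m \<omega>) \<longlonglongrightarrow> \<psi> \<omega>" by auto
    show "(\<lambda>m. Ts r \<gamma> u (F m) \<omega>) \<longlonglongrightarrow> Ts r \<gamma> u \<psi> \<omega>"
      unfolding unf[OF \<omega>]
    proof (rule E(4)[OF \<omega> wT[OF F(1)] wT[OF \<psi>] _ _ \<omega>])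
      show "incseq (\<lambda>m. Ts r \<gamma> ?w (F m) \<omega>')" if "\<omega>' \<in> \<Omega> r" for \<omega>'
        using F(2) by (intro incseq_SucI mono[OF F(1) F(1) _ that]) (simp add: incseq_Suc_iff)
      show "(\<lambda>m. Ts r \<gamma> ?w (F m) \<omega>') \<longlonglongrightarrow> Ts r \<gamma> ?w \<psi> \<omega>'" if "\<omega>' \<in> \<Omega> r" for \<omega>'
        using D(4)[OF F(1) \<psi> F(2,3) that] .
    qed
  qed
qed

lemma T_step_in_Bb: "r \<le> u \<Longrightarrow> u \<le> T \<Longrightarrow> \<psi> \<in> Bb pk T r T \<Longrightarrow> Ts r \<gamma> u \<psi> \<in> Bb pk T r u"
  by (rule nonneg_linear_belowD(1)[OF T_step_nonneg_linear_below])

lemma T_step_in_Bb_T: "r \<le> u \<Longrightarrow> u \<le> T \<Longrightarrow> \<psi> \<in> Bb pk T r T \<Longrightarrow> Ts r \<gamma> u \<psi> \<in> Bb pk T r T"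
  by (rule Bb_mono[OF T_step_in_Bb])

lemma T_step_known:
  assumes "r \<le> u" "u \<le> T" "\<phi> \<in> Bb pk T r u" "\<omega> \<in> \<Omega> r"
  shows "Ts r \<gamma> u \<phi> \<omega> = \<phi> \<omega>"
proof -
  have "\<forall>\<phi>\<in>Bb pk T r u. \<forall>\<omega>\<in>\<Omega> r. Ts r \<gamma> u \<phi> \<omega> = \<phi> \<omega>"
    using \<gamma> assms(1,2)
  proof (induction rule: step_induct)
    case 1
    show ?case by (simp add: T_step_end)
  next
    case (2 u)
    note w = step_at[OF \<gamma> 2(1,2)]
    show ?case
    proof (intro ballI)
      fix \<phi> :: "'n path \<Rightarrow> real" and \<omega> assume \<phi>: "\<phi> \<in> Bb pk T r u" and \<omega>: "\<omega> \<in> \<Omega> r"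
      have "Ts r \<gamma> u \<phi> \<omega> = Tc r (used_coef \<gamma> u \<omega>) u \<phi> \<omega>"
        unfolding T_step_unfold[OF 2(1,2) \<omega>]
        using 2(3) Bb_mono[OF \<phi>] w(3)
        by (intro T_theta_cong[OF used_coef_in[OF 2(1,2) \<omega>] \<omega> r 2(1,2)]) simp
      also have "\<dots> = \<phi> \<omega>" by (rule T_theta_known[OF used_coef_in[OF 2(1,2) \<omega>] \<phi> \<omega> r 2(1,2)])
      finally show "Ts r \<gamma> u \<phi> \<omega> = \<phi> \<omega>" .
    qed
  qed
  with assms show ?thesis by blast
qed

text \<open>A functional that is known by the next node is fixed by the operator at that node.\<close>

lemma T_step_local:
  assumes "r \<le> u" "u < T" "w \<le> next_node \<gamma> u" "\<phi> \<in> Bb pk T r w" "\<omega> \<in> \<Omega> r"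
  shows "Ts r \<gamma> u \<phi> \<omega> = Tc r (used_coef \<gamma> u \<omega>) u \<phi> \<omega>"
  unfolding T_step_unfold[OF assms(1,2,5)]
  using step_at[OF \<gamma> assms(1,2)] assms
  by (intro T_theta_cong[OF used_coef_in[OF assms(1,2,5)] assms(5) r assms(1,2)] T_step_known
      Bb_mono[OF assms(4,3)]) auto

text \<open>Backward induction on \<open>s\<close>. If \<open>t\<close> lies beyond the next node, the recursion reduces the claim
  to that node; otherwise \<open>s\<close> and \<open>t\<close> share a coefficient, whose own tower property applies.\<close>

lemma T_step_tower:
  assumes "r \<le> s" "s \<le> t" "t \<le> T" "\<psi> \<in> Bb pk T r T" "\<omega> \<in> \<Omega> r"
  shows "Ts r \<gamma> s (Ts r \<gamma> t \<psi>) \<omega> = Ts r \<gamma> s \<psi> \<omega>"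
proof -
  have "s \<le> T" using assms by simp
  have "\<forall>t\<in>{s..T}. \<forall>\<psi>\<in>Bb pk T r T. \<forall>\<omega>\<in>\<Omega> r. Ts r \<gamma> s (Ts r \<gamma> t \<psi>) \<omega> = Ts r \<gamma> s \<psi> \<omega>"
    using \<gamma> assms(1) \<open>s \<le> T\<close>
  proof (induction rule: step_induct)
    case 1
    show ?case by (simp add: T_step_end)
  next
    case (2 s)
    note w = step_at[OF \<gamma> 2(1,2)]
    show ?case
    proof (intro ballI)
      fix t and \<psi> :: "'n path \<Rightarrow> real" and \<omega> assume t: "t \<in> {s..T}" and \<psi>: "\<psi> \<in> Bb pk T r T" and \<omega>: "\<omega> \<in> \<Omega> r"
      let ?\<theta> = "used_coef \<gamma> s \<omega>" and ?w = "next_node \<gamma> s"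
      note \<theta> = used_coef_in[OF 2(1,2) \<omega>]
      show "Ts r \<gamma> s (Ts r \<gamma> t \<psi>) \<omega> = Ts r \<gamma> s \<psi> \<omega>"
      proof (cases "t < ?w")
        case False
        with t have tw: "t \<in> {?w..T}" by simp
        have eq: "Ts r \<gamma> ?w (Ts r \<gamma> t \<psi>) \<omega>' = Ts r \<gamma> ?w \<psi> \<omega>'" if "\<omega>' \<in> \<Omega> r" for \<omega>'
          using 2(3) tw \<psi> that by blast
        show ?thesis
          unfolding T_step_unfold[OF 2(1,2) \<omega>] by (rule T_theta_cong[OF \<theta> \<omega> r 2(1,2)]) (rule eq)
      next
        case True
        then have t': "r \<le> t" "t < T" "s \<le> t" using t 2 w(4) by auto
        have "Ts r \<gamma> s (Ts r \<gamma> t \<psi>) \<omega> = Tc r ?\<theta> s (Ts r \<gamma> t \<psi>) \<omega>"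
          using True t' by (intro T_step_local[OF 2(1,2) _ T_step_in_Bb[OF t'(1) _ \<psi>] \<omega>]) auto
        also have "\<dots> = Tc r ?\<theta> s (Tc r ?\<theta> t (Ts r \<gamma> ?w \<psi>)) \<omega>"
        proof (rule T_theta_cong[OF \<theta> \<omega> r 2(1,2)])
          fix \<omega>' assume \<omega>': "\<omega>' \<in> \<Omega> r" "\<And>v. v \<in> {r..s} \<Longrightarrow> \<omega>' v = \<omega> v"
          have "used_coef \<gamma> t \<omega>' = ?\<theta>"
            by (rule used_coef_determined[OF \<gamma> 2(1) t'(3) True 2(2) \<omega> \<omega>'])
          moreover have "next_node \<gamma> t = ?w" using step_at_between(2)[OF \<gamma> 2(1) t'(3) True 2(2)] .
          ultimately show "Ts r \<gamma> t \<psi> \<omega>' = Tc r ?\<theta> t (Ts r \<gamma> ?w \<psi>) \<omega>'"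
            using T_step_unfold[OF t'(1,2) \<omega>'(1)] by simp
        qed
        also have "\<dots> = Tc r ?\<theta> s (Ts r \<gamma> ?w \<psi>) \<omega>"
          using w 2 by (intro T_theta_tower[OF \<theta> T_step_in_Bb_T[OF _ w(4) \<psi>] \<omega> r 2(1) t'(3,2)]) simp
        also have "\<dots> = Ts r \<gamma> s \<psi> \<omega>" using T_step_unfold[OF 2(1,2) \<omega>] by simp
        finally show ?thesis .
      qed
    qed
  qed
  with assms show ?thesis by auto
qed

section \<open>The martingale problem of a step process\<close>

lemma Z_step_in_Bb:
  assumes "k \<in> I" "r \<le> u" "u \<le> T"
  shows "Z_step Z \<gamma> k r u \<in> Bb pk T r u"
proof -
  have "(\<lambda>\<omega>. let a = max r (node \<gamma> i); b = min u (node \<gamma> (Suc i)) in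
     if a \<le> b then \<Sum>j\<in>idx \<gamma> i. indicator (cell \<gamma> i j) \<omega> * Zc (coef \<gamma> i j) k a b \<omega> else 0) \<in> Bb pk T r u"
    if i: "i < nsteps \<gamma>" for i
  proof (cases "max r (node \<gamma> i) \<le> min u (node \<gamma> (Suc i))")
    case True
    have n: "r \<le> node \<gamma> i" using node_range[OF \<gamma>, of i] i by simp
    have "(\<lambda>\<omega>. \<Sum>j\<in>idx \<gamma> i. indicator (cell \<gamma> i j) \<omega> *
        Zc (coef \<gamma> i j) k (max r (node \<gamma> i)) (min u (node \<gamma> (Suc i))) \<omega>) \<in> Bb pk T r u"
    proof (intro Bb_sum Bb_mult)
      fix j assume j: "j \<in> idx \<gamma> i"
      then have *: "cell \<gamma> i j \<in> \<B> r (node \<gamma> i)" "coef \<gamma> i j \<in> \<Theta>"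
        using \<gamma> i by (auto simp: step_structure_def)
      show "indicator (cell \<gamma> i j) \<in> Bb pk T r u"
        using True Bb_mono[OF Bb_indicator[OF *(1)]] by simp
      show "Zc (coef \<gamma> i j) k (max r (node \<gamma> i)) (min u (node \<gamma> (Suc i))) \<in> Bb pk T r u"
        using True assms by (intro Bb_mono[OF problem_in_Bb[OF *(2) assms(1) r]]) auto
    qed
    with True show ?thesis by (simp add: Let_def)
  next
    case False
    then show ?thesis by (auto simp: Let_def Bb_const)
  qed
  then show ?thesis
    unfolding Z_step_def[abs_def] by (intro Bb_sum) auto
qed

text \<open>Of the sum over all steps, terms of earlier steps are the same at \<open>u\<close> and \<open>v\<close>, and terms of
  later steps vanish at both. If \<open>v\<close> is the next node, the following step contributes an increment
  over a single point, which is zero by additivity.\<close>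

lemma Z_step_increment:
  assumes k: "k \<in> I" and u: "r \<le> u" "u < T" and v: "u \<le> v" "v \<le> next_node \<gamma> u" and \<omega>: "\<omega> \<in> \<Omega> r"
  shows "Z_step Z \<gamma> k r v \<omega> - Z_step Z \<gamma> k r u \<omega> = Zc (used_coef \<gamma> u \<omega>) k u v \<omega>"
proof -
  define f where "f i u = (let a = max r (node \<gamma> i); b = min u (node \<gamma> (Suc i)) in
     if a \<le> b then \<Sum>j\<in>idx \<gamma> i. indicator (cell \<gamma> i j) \<omega> * Zc (coef \<gamma> i j) k a b \<omega> else 0)" for i u
  let ?i = "step_at \<gamma> u"
  note i = step_at[OF \<gamma> u, unfolded next_node_def]
  obtain j where j: "j \<in> idx \<gamma> ?i" "\<omega> \<in> cell \<gamma> ?i j" "used_coef \<gamma> u \<omega> = coef \<gamma> ?i j"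
    and \<theta>: "used_coef \<gamma> u \<omega> \<in> \<Theta>"
    using used_coef_cell[OF \<gamma> u \<omega>] by blast
  have "f l v - f l u = (if l = ?i then Zc (used_coef \<gamma> u \<omega>) k u v \<omega> else 0)" if l: "l < nsteps \<gamma>" for l
  proof -
    have a: "max r (node \<gamma> l) = node \<gamma> l" using node_range[OF \<gamma>, of l] l by simp
    consider "l < ?i" | "l = ?i" | "?i < l" by linarith
    then show ?thesis
    proof cases
      case 1
      then have "node \<gamma> (Suc l) \<le> u" using node_mono[OF \<gamma>, of "Suc l" ?i] i by simp
      with v have "min u (node \<gamma> (Suc l)) = min v (node \<gamma> (Suc l))" by simp
      with 1 show ?thesis by (simp add: f_def)
    next
      case 2
      have m: "min u (node \<gamma> (Suc l)) = u" "min v (node \<gamma> (Suc l)) = v"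
        using v i 2 by (auto simp: next_node_def)
      have "f l t = Zc (used_coef \<gamma> u \<omega>) k (node \<gamma> l) t \<omega>" if "t \<in> {u, v}" for t
        using cell_sum[OF \<gamma> i(1) \<omega> j(1,2)] j(3) 2 i v m a that by (auto simp: f_def)
      moreover have "Zc (used_coef \<gamma> u \<omega>) k (node \<gamma> l) v \<omega> =
          Zc (used_coef \<gamma> u \<omega>) k (node \<gamma> l) u \<omega> + Zc (used_coef \<gamma> u \<omega>) k u v \<omega>"
        using 2 i v node_range[OF \<gamma>, of l] l by (intro problem_additive[OF \<theta> k r _ _ v(1) _ \<omega>])
          (auto simp: next_node_def)
      ultimately show ?thesis using 2 by simp
    next
      case 3
      then have n: "node \<gamma> (Suc ?i) \<le> node \<gamma> l" using node_mono[OF \<gamma>, of "Suc ?i" l] l by simp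
      then have fu: "f l u = 0" using i a by (auto simp: f_def Let_def)
      have fv: "f l v = 0"
      proof (cases "node \<gamma> l \<le> min v (node \<gamma> (Suc l))")
        case False
        then show ?thesis using a by (auto simp: f_def Let_def)
      next
        case True
        then have b: "min v (node \<gamma> (Suc l)) = node \<gamma> l" using v n by (auto simp: next_node_def)
        have "coef \<gamma> l j' \<in> \<Theta>" if "j' \<in> idx \<gamma> l" for j'
          using \<gamma> l that by (simp add: step_structure_def)
        then have "Zc (coef \<gamma> l j') k (node \<gamma> l) (node \<gamma> l) \<omega> = 0" if "j' \<in> idx \<gamma> l" for j'
          using node_range[OF \<gamma>, of l] l that by (intro problem_zero[OF _ k r _ _ \<omega>]) auto
        then show ?thesis by (simp add: f_def a b)
      qed
      from 3 fu fv show ?thesis by simp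
    qed
  qed
  then have "(\<Sum>l<nsteps \<gamma>. f l v - f l u) =
      (\<Sum>l<nsteps \<gamma>. if l = ?i then Zc (used_coef \<gamma> u \<omega>) k u v \<omega> else 0)"
    by (intro sum.cong) auto
  also have "\<dots> = Zc (used_coef \<gamma> u \<omega>) k u v \<omega>"
    using i(1) by simp
  finally show ?thesis
    by (simp add: Z_step_def f_def sum_subtractf)
qed

lemma Z_step_difference_in_Bb:
  assumes "k \<in> I" "r \<le> u" "u \<le> v" "v \<le> T" "B \<in> \<B> r u"
  shows "(\<lambda>\<omega>. indicator B \<omega> * (Z_step Z \<gamma> k r v \<omega> - Z_step Z \<gamma> k r u \<omega>)) \<in> Bb pk T r v"
  using assms Bb_mono[OF Bb_indicator[OF assms(5)] assms(3)]
  by (intro Bb_mult Bb_diff Z_step_in_Bb Bb_mono[OF Z_step_in_Bb, of k u v]) auto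

lemma T_step_zero: "r \<le> u \<Longrightarrow> u \<le> T \<Longrightarrow> \<omega> \<in> \<Omega> r \<Longrightarrow> Ts r \<gamma> u (\<lambda>_. 0) \<omega> = 0"
  using T_step_known[OF _ _ Bb_const] by simp

text \<open>Up to the next node this is the martingale property for the coefficient in force. An
  increment that goes further is cut at the next node, where the induction hypothesis applies.\<close>

lemma T_step_increment_from:
  assumes k: "k \<in> I" and "r \<le> u" "u \<le> v" "v \<le> T" "B \<in> \<B> r u" "\<omega> \<in> \<Omega> r"
  shows "Ts r \<gamma> u (\<lambda>\<omega>. indicator B \<omega> * (Z_step Z \<gamma> k r v \<omega> - Z_step Z \<gamma> k r u \<omega>)) \<omega> = 0"
proof -
  let ?X = "\<lambda>u v B \<omega>. indicator B \<omega> * (Z_step Z \<gamma> k r v \<omega> - Z_step Z \<gamma> k r u \<omega>)"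
  have "u \<le> T" using assms by simp
  have "\<forall>v\<in>{u..T}. \<forall>B\<in>\<B> r u. \<forall>\<omega>\<in>\<Omega> r. Ts r \<gamma> u (?X u v B) \<omega> = 0"
    using \<gamma> assms(2) \<open>u \<le> T\<close>
  proof (induction rule: step_induct)
    case 1
    show ?case by (simp add: T_step_end)
  next
    case (2 u)
    let ?w = "next_node \<gamma> u"
    note w = step_at[OF \<gamma> 2(1,2)]
    have rw: "r \<le> ?w" using w 2 by simp
    have within: "Ts r \<gamma> u (?X u v B) \<omega> = 0"
      if *: "u \<le> v" "v \<le> ?w" "B \<in> \<B> r u" "\<omega> \<in> \<Omega> r" for v B \<omega>
    proof -
      let ?\<theta> = "used_coef \<gamma> u \<omega>"
      note \<theta> = used_coef_in[OF 2(1,2) *(4)]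
      have vT: "v \<le> T" using * w by simp
      have "Ts r \<gamma> u (?X u v B) \<omega> = Tc r ?\<theta> u (?X u v B) \<omega>"
        by (rule T_step_local[OF 2(1,2) *(2) Z_step_difference_in_Bb[OF k 2(1) *(1) vT *(3)] *(4)])
      also have "\<dots> = Tc r ?\<theta> u (\<lambda>\<omega>. indicator B \<omega> * Zc ?\<theta> k u v \<omega>) \<omega>"
      proof (rule T_theta_cong[OF \<theta> *(4) r 2(1,2)])
        fix \<omega>' assume \<omega>': "\<omega>' \<in> \<Omega> r" "\<And>v. v \<in> {r..u} \<Longrightarrow> \<omega>' v = \<omega> v"
        have "used_coef \<gamma> u \<omega>' = ?\<theta>"
          by (rule used_coef_determined[OF \<gamma> 2(1) order_refl w(3) 2(2) *(4) \<omega>'])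
        then show "?X u v B \<omega>' = indicator B \<omega>' * Zc ?\<theta> k u v \<omega>'"
          using Z_step_increment[OF k 2(1,2) *(1,2) \<omega>'(1)] by simp
      qed
      also have "\<dots> = 0"
        by (rule T_theta_increment[OF \<theta> k *(4) r 2(1,2) order_refl *(1) vT *(3)])
      finally show ?thesis .
    qed
    show ?case
    proof (intro ballI)
      fix v and B :: "'n path set" and \<omega> assume v: "v \<in> {u..T}" and B: "B \<in> \<B> r u" and \<omega>: "\<omega> \<in> \<Omega> r"
      show "Ts r \<gamma> u (?X u v B) \<omega> = 0"
      proof (cases "v \<le> ?w")
        case True
        then show ?thesis using within v B \<omega> by simp
      next
        case False
        then have wv: "?w \<le> v" "v \<le> T" and uw: "u \<le> ?w" using v w by auto
        have Bw: "B \<in> \<B> r ?w" using sets_path_alg_mono[OF uw, of pk r T] B by auto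
        have X1: "?X ?w v B \<in> Bb pk T r T"
          using Z_step_difference_in_Bb[OF k rw wv Bw] by (rule Bb_mono) (rule wv)
        have X2: "?X u ?w B \<in> Bb pk T r T"
          using Z_step_difference_in_Bb[OF k 2(1) uw w(4) B] by (rule Bb_mono) (rule w(4))
        have "Ts r \<gamma> u (?X u v B) \<omega> = Ts r \<gamma> u (\<lambda>\<omega>. 1 * ?X ?w v B \<omega> + 1 * ?X u ?w B \<omega>) \<omega>"
          by (simp add: algebra_simps)
        also have "\<dots> = 1 * Ts r \<gamma> u (?X ?w v B) \<omega> + 1 * Ts r \<gamma> u (?X u ?w B) \<omega>"
          using 2 by (intro nonneg_linear_belowD(2)[OF T_step_nonneg_linear_below X1 X2 \<omega>]) auto
        also have "Ts r \<gamma> u (?X u ?w B) \<omega> = 0" by (rule within[OF uw order_refl B \<omega>])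
        also have "Ts r \<gamma> u (?X ?w v B) \<omega> = Tc r (used_coef \<gamma> u \<omega>) u (\<lambda>_. 0) \<omega>"
          unfolding T_step_unfold[OF 2(1,2) \<omega>]
          using 2(3) wv Bw by (intro T_theta_cong[OF used_coef_in[OF 2(1,2) \<omega>] \<omega> r 2(1,2)]) auto
        also have "\<dots> = 0" by (simp add: T_theta_def)
        finally show ?thesis by simp
      qed
    qed
  qed
  with assms show ?thesis by auto
qed

lemma T_step_increment:
  assumes k: "k \<in> I" and "r \<le> s" "s \<le> u" "u \<le> v" "v \<le> T" "B \<in> \<B> r u" "\<omega> \<in> \<Omega> r"
  shows "Ts r \<gamma> s (\<lambda>\<omega>. indicator B \<omega> * (Z_step Z \<gamma> k r v \<omega> - Z_step Z \<gamma> k r u \<omega>)) \<omega> = 0"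
    (is "Ts r \<gamma> s ?X \<omega> = 0")
proof -
  have ru: "r \<le> u" and uT: "u \<le> T" and sT: "s \<le> T" using assms by auto
  have X: "?X \<in> Bb pk T r T"
    using Z_step_difference_in_Bb[OF k ru assms(4-6)] by (rule Bb_mono) (rule assms(5))
  have "Ts r \<gamma> s ?X \<omega> = Ts r \<gamma> s (Ts r \<gamma> u ?X) \<omega>"
    using T_step_tower[OF assms(2,3) uT X assms(7)] by simp
  also have "\<dots> = Ts r \<gamma> s (\<lambda>_. 0) \<omega>"
    using T_step_increment_from[OF k ru assms(4-6)]
    by (intro nonneg_linear_below_cong[OF T_step_nonneg_linear_below[OF assms(2) sT]
          T_step_in_Bb_T[OF ru uT X] _ assms(7)])
  also have "\<dots> = 0" by (rule T_step_zero[OF assms(2) sT assms(7)])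
  finally show ?thesis .
qed

lemma T_step_cond_exp:
  assumes uniq: "\<exists>!Q. is_solution pk r T I (Z_step Z \<gamma>) y Q" and Q: "is_solution pk r T I (Z_step Z \<gamma>) y Q"
    and s: "r \<le> s" "s \<le> T" and \<psi>: "\<psi> \<in> Bb pk T r T"
  shows "AE \<omega> in Q. real_cond_exp Q (path_alg pk r T s) \<psi> \<omega> = Ts r \<gamma> s \<psi> \<omega>"
proof (rule unique_solution_cond_exp[OF _ uniq Q])
  show "Z_step Z \<gamma> k r u \<in> Bb pk T r u" if "k \<in> I" "u \<in> {r..T}" for k u
    using Z_step_in_Bb that by simp
  show "Ts r \<gamma> s (\<lambda>\<omega>. indicator B \<omega> * (Z_step Z \<gamma> k r v \<omega> - Z_step Z \<gamma> k r u \<omega>)) \<omega> = 0"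
    if "k \<in> I" "u \<in> {s..T}" "v \<in> {u..T}" "B \<in> \<B> r u" "\<omega> \<in> \<Omega> r" for k u v B \<omega>
    using that s by (intro T_step_increment) auto
qed (use s \<psi> T_step_nonneg_linear_below T_step_known in auto)

end

text \<open>On the event \<open>A\<close>, known at time \<open>a\<close>, both recursions apply the same coefficient at \<open>u\<close>. To
  compare them, cut at the first time after \<open>u\<close> that is a node of either process or \<open>b\<close>; the tower
  property allows it although this time need not be a node of both.\<close>

lemma T_step_eq_if_used_coef_eq:
  assumes r: "0 \<le> r" and \<gamma>: "step_structure pk T \<Theta> r \<gamma>" and \<delta>: "step_structure pk T \<Theta> r \<delta>"
    and ab: "r \<le> a" "a \<le> u" "u \<le> b" "b \<le> T" and A: "A \<in> \<B> r a"
    and eq: "\<And>\<omega> u. \<omega> \<in> A \<Longrightarrow> u \<in> {a..<b} \<Longrightarrow> used_coef \<gamma> u \<omega> = used_coef \<delta> u \<omega>"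
    and \<phi>: "\<phi> \<in> Bb pk T r b" and \<omega>: "\<omega> \<in> A"
  shows "Ts r \<gamma> u \<phi> \<omega> = Ts r \<delta> u \<phi> \<omega>"
proof -
  have A\<Omega>: "A \<subseteq> \<Omega> r" using sets.sets_into_space[OF A] by simp
  have rb: "r \<le> b" using ab by simp
  let ?D = "node \<gamma> ` {..nsteps \<gamma>} \<union> node \<delta> ` {..nsteps \<delta>} \<union> {b}"
  have "\<forall>\<omega>\<in>A. Ts r \<gamma> u \<phi> \<omega> = Ts r \<delta> u \<phi> \<omega>"
  proof (rule backward_induct[of ?D a u b])
    show "\<forall>\<omega>\<in>A. Ts r \<gamma> b \<phi> \<omega> = Ts r \<delta> b \<phi> \<omega>"
      using T_step_known[OF r \<gamma> rb ab(4) \<phi>] T_step_known[OF r \<delta> rb ab(4) \<phi>] A\<Omega> by auto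
  next
    fix u assume u: "a \<le> u" "u < b"
      and IH: "\<And>w. w \<in> ?D \<Longrightarrow> u < w \<Longrightarrow> w \<le> b \<Longrightarrow> \<forall>\<omega>\<in>A. Ts r \<gamma> w \<phi> \<omega> = Ts r \<delta> w \<phi> \<omega>"
    have u': "r \<le> u" "u < T" using u ab by auto
    note g = step_at[OF \<gamma> u'] and d = step_at[OF \<delta> u']
    define w where "w = min b (min (next_node \<gamma> u) (next_node \<delta> u))"
    have w: "w \<in> ?D" "u < w" "w \<le> b" "w \<le> next_node \<gamma> u" "w \<le> next_node \<delta> u" "r \<le> w" "w \<le> T" "u \<le> w"
      using g d u u' ab by (auto simp: w_def min_def next_node_def)
    have \<phi>T: "\<phi> \<in> Bb pk T r T" by (rule Bb_mono[OF \<phi> ab(4)])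
    show "\<forall>\<omega>\<in>A. Ts r \<gamma> u \<phi> \<omega> = Ts r \<delta> u \<phi> \<omega>"
    proof
      fix \<omega> assume \<omega>: "\<omega> \<in> A"
      then have \<omega>\<Omega>: "\<omega> \<in> \<Omega> r" using A\<Omega> by blast
      let ?\<theta> = "used_coef \<gamma> u \<omega>"
      have "Ts r \<gamma> u \<phi> \<omega> = Ts r \<gamma> u (Ts r \<gamma> w \<phi>) \<omega>"
        by (rule T_step_tower[OF r \<gamma> u'(1) w(8,7) \<phi>T \<omega>\<Omega>, symmetric])
      also have "\<dots> = Tc r ?\<theta> u (Ts r \<gamma> w \<phi>) \<omega>"
        by (rule T_step_local[OF r \<gamma> u' w(4) T_step_in_Bb[OF r \<gamma> w(6,7) \<phi>T] \<omega>\<Omega>])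
      also have "\<dots> = Tc r ?\<theta> u (Ts r \<delta> w \<phi>) \<omega>"
      proof (rule T_theta_cong[OF used_coef_in[OF r \<gamma> u' \<omega>\<Omega>] \<omega>\<Omega> r u'])
        fix \<omega>' assume \<omega>': "\<omega>' \<in> \<Omega> r" "\<And>v. v \<in> {r..u} \<Longrightarrow> \<omega>' v = \<omega> v"
        have "\<omega>' \<in> A"
          using path_alg_event_determined[OF A \<omega>'(1) \<omega>\<Omega>] \<omega>'(2) u \<omega> by auto
        then show "Ts r \<gamma> w \<phi> \<omega>' = Ts r \<delta> w \<phi> \<omega>'" using IH[OF w(1-3)] by blast
      qed
      also have "?\<theta> = used_coef \<delta> u \<omega>" using eq[OF \<omega>] u by simp
      also have "Tc r (used_coef \<delta> u \<omega>) u (Ts r \<delta> w \<phi>) \<omega> = Ts r \<delta> u (Ts r \<delta> w \<phi>) \<omega>"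
        by (rule T_step_local[OF r \<delta> u' w(5) T_step_in_Bb[OF r \<delta> w(6,7) \<phi>T] \<omega>\<Omega>, symmetric])
      also have "\<dots> = Ts r \<delta> u \<phi> \<omega>"
        by (rule T_step_tower[OF r \<delta> u'(1) w(8,7) \<phi>T \<omega>\<Omega>])
      finally show "Ts r \<gamma> u \<phi> \<omega> = Ts r \<delta> u \<phi> \<omega>" .
    qed
  qed (use ab in auto)
  with \<omega> show ?thesis by blast
qed

end

section \<open>Predictability of step processes\<close>

lemma space_predictable_alg: "space (predictable_alg pk T r) = {r..<T} \<times> Paths pk r T"
  unfolding predictable_alg_def by (rule space_measure_of_conv)

lemma predictable_generators:
  fixes pk :: path_kind and A :: "('n::finite) path set"
  shows "r < T \<Longrightarrow> A \<in> sets (path_alg pk r T r) \<Longrightarrow> {r} \<times> A \<in> sets (predictable_alg pk T r)"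
    and "r \<le> a \<Longrightarrow> a \<le> b \<Longrightarrow> b < T \<Longrightarrow> A \<in> sets (path_alg pk r T a) \<Longrightarrow>
      {a<..b} \<times> A \<in> sets (predictable_alg pk T r)"
proof -
  let ?G = "{({r} \<inter> {..<T}) \<times> A | A :: 'n path set. A \<in> sets (path_alg pk r T r)} \<union>
      {{a<..b} \<times> A | a b (A :: 'n path set). r \<le> a \<and> a \<le> b \<and> b < T \<and> A \<in> sets (path_alg pk r T a)}"
  have into: "J \<times> (A :: 'n path set) \<subseteq> {r..<T} \<times> Paths pk r T" if "A \<in> sets (path_alg pk r T a)" "J \<subseteq> {r..<T}" for A a J
    using sets.sets_into_space[OF that(1)] that(2) by auto
  have "?G \<subseteq> Pow ({r..<T} \<times> Paths pk r T)"
  proof (intro Un_least subsetI)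
    fix S :: "(real \<times> 'n path) set" assume "S \<in> {({r} \<inter> {..<T}) \<times> A | A. A \<in> sets (path_alg pk r T r)}"
    then obtain A where A: "A \<in> sets (path_alg pk r T r)" and S: "S = ({r} \<inter> {..<T}) \<times> A" by blast
    show "S \<in> Pow ({r..<T} \<times> Paths pk r T)"
      unfolding S by (intro PowI into[OF A]) auto
  next
    fix S :: "(real \<times> 'n path) set" assume "S \<in> {{a<..b} \<times> A | a b A. r \<le> a \<and> a \<le> b \<and> b < T \<and> A \<in> sets (path_alg pk r T a)}"
    then obtain a b A where A: "A \<in> sets (path_alg pk r T a)" and S: "S = {a<..b} \<times> A"
      and ab: "r \<le> a" "b < T" by blast
    show "S \<in> Pow ({r..<T} \<times> Paths pk r T)"
      unfolding S using ab by (intro PowI into[OF A]) auto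
  qed
  then have "sets (predictable_alg pk T r) = sigma_sets ({r..<T} \<times> Paths pk r T) ?G"
    unfolding predictable_alg_def by (rule sets_measure_of)
  then have G: "?G \<subseteq> sets (predictable_alg pk T r)"
    using sigma_sets_superset_generator[of ?G "{r..<T} \<times> Paths pk r T"] by (simp only:)
  show "{r} \<times> A \<in> sets (predictable_alg pk T r)" if "r < T" "A \<in> sets (path_alg pk r T r)"
  proof -
    have "{r} = {r} \<inter> {..<T}" using that by auto
    with that show ?thesis by (intro subsetD[OF G] UnI1) blast
  qed
  show "{a<..b} \<times> A \<in> sets (predictable_alg pk T r)"
    if "r \<le> a" "a \<le> b" "b < T" "A \<in> sets (path_alg pk r T a)"
    using that by (intro subsetD[OF G] UnI2) blast
qed

lemma predictable_ray:
  assumes "r \<le> a" "a < T" and A: "A \<in> sets (path_alg pk r T a)"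
  shows "{a<..<T} \<times> A \<in> sets (predictable_alg pk T r)"
proof -
  have "{a<..<T} \<times> A = (\<Union>n. {a<..max a (T - 1 / real (Suc n))} \<times> A)"
  proof (intro set_eqI iffI)
    fix x assume x: "x \<in> {a<..<T} \<times> A"
    then have "0 < T - fst x" by auto
    then obtain n where "1 / real (Suc n) < T - fst x" by (rule nat_approx_posE)
    with x show "x \<in> (\<Union>n. {a<..max a (T - 1 / real (Suc n))} \<times> A)"
      by (intro UN_I[of n]) auto
  next
    fix x assume "x \<in> (\<Union>n. {a<..max a (T - 1 / real (Suc n))} \<times> A)"
    then obtain n where n: "a < fst x" "fst x \<le> max a (T - 1 / real (Suc n))" "snd x \<in> A" by auto
    have "0 < 1 / real (Suc n)" by simp
    with n(1,2) have "fst x < T" by linarith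
    with n show "x \<in> {a<..<T} \<times> A" by (cases x) auto
  qed
  moreover have "{a<..max a (T - 1 / real (Suc n))} \<times> A \<in> sets (predictable_alg pk T r)" for n
    using assms by (intro predictable_generators(2)[OF _ _ _ A]) auto
  then have "(\<Union>n. {a<..max a (T - 1 / real (Suc n))} \<times> A) \<in> sets (predictable_alg pk T r)"
    by (intro sets.countable_UN) auto
  ultimately show ?thesis by simp
qed

lemma measurable_predictable_after:
  fixes f :: "('n::finite) path \<Rightarrow> 'a"
  assumes "r \<le> a" "a < T" and f: "f \<in> measurable (path_alg pk r T a) N" and c: "c \<in> space N"
  shows "(\<lambda>x. if a < fst x then f (snd x) else c) \<in> measurable (predictable_alg pk T r) N"
proof (rule measurableI)
  fix x :: "real \<times> 'n path" assume "x \<in> space (predictable_alg pk T r)"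
  then show "(if a < fst x then f (snd x) else c) \<in> space N"
    using measurable_space[OF f] c by (auto simp: space_predictable_alg)
next
  fix B assume B: "B \<in> sets N"
  let ?M = "predictable_alg pk T r" and ?A = "f -` B \<inter> Paths pk r T"
  have "?A \<in> sets (path_alg pk r T a)" using measurable_sets[OF f B] by simp
  then have 1: "{a<..<T} \<times> ?A \<in> sets ?M" by (rule predictable_ray[OF assms(1,2)])
  have "Paths pk r T \<in> sets (path_alg pk r T a)"
    using sets.top[of "path_alg pk r T a"] by simp
  then have 2: "{a<..<T} \<times> Paths pk r T \<in> sets ?M" by (rule predictable_ray[OF assms(1,2)])
  have "(\<lambda>x. if a < fst x then f (snd x) else c) -` B \<inter> space ?M =
      {a<..<T} \<times> ?A \<union> (if c \<in> B then space ?M - {a<..<T} \<times> Paths pk r T else {})"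
    using assms(1) by (auto simp: space_predictable_alg split: if_splits)
  with 1 2 show "(\<lambda>x. if a < fst x then f (snd x) else c) -` B \<inter> space ?M \<in> sets ?M" by auto
qed

lemma measurable_predictable_initial:
  fixes f :: "('n::finite) path \<Rightarrow> 'a"
  assumes "r < T" and f: "f \<in> measurable (path_alg pk r T r) N"
  shows "(\<lambda>x. f (snd x)) \<in> measurable (predictable_alg pk T r) N"
proof (rule measurableI)
  fix B assume B: "B \<in> sets N"
  let ?A = "f -` B \<inter> Paths pk r T"
  have A: "?A \<in> sets (path_alg pk r T r)" using measurable_sets[OF f B] by simp
  have "(\<lambda>x. f (snd x)) -` B \<inter> space (predictable_alg pk T r) = {r} \<times> ?A \<union> {r<..<T} \<times> ?A"
    using assms(1) by (auto simp: space_predictable_alg)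
  then show "(\<lambda>x. f (snd x)) -` B \<inter> space (predictable_alg pk T r) \<in> sets (predictable_alg pk T r)"
    using predictable_generators(1)[OF assms(1) A] predictable_ray[OF order_refl assms(1) A] by auto
qed (use measurable_space[OF f] in \<open>auto simp: space_predictable_alg\<close>)

lemma measurable_predictable_time:
  "fst \<in> borel_measurable (predictable_alg pk T r :: (real \<times> ('n::finite) path) measure)"
  (is "_ \<in> borel_measurable ?M")
proof (rule borel_measurable_iff_greater[THEN iffD2], rule allI)
  fix a :: real
  consider "a < r" | "T \<le> a" | "r \<le> a" "a < T" by linarith
  then show "{x \<in> space ?M. a < fst x} \<in> sets ?M"
  proof cases
    case 1
    then have "{x \<in> space ?M. a < fst x} = space ?M" by (auto simp: space_predictable_alg)
    then show ?thesis by simp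
  next
    case 2
    then have "{x \<in> space ?M. a < fst x} = {}" by (auto simp: space_predictable_alg)
    then show ?thesis by (simp only: sets.empty_sets)
  next
    case 3
    then have "{x \<in> space ?M. a < fst x} = {a<..<T} \<times> Paths pk r T"
      by (auto simp: space_predictable_alg)
    moreover have "Paths pk r T \<in> sets (path_alg pk r T a)"
      using sets.top[of "path_alg pk r T a"] by simp
    ultimately show ?thesis using predictable_ray[OF 3] by simp
  qed
qed

text \<open>By left continuity the value at \<open>u\<close> is the limit of the values on grids strictly to the left
  of \<open>u\<close>; a value at \<open>a\<close> that is only used at times after \<open>a\<close> is predictable.\<close>

lemma measurable_predictable_evaluation:
  assumes "r < T"
  shows "(\<lambda>x. snd x (fst x)) \<in> borel_measurable (predictable_alg Continuous T r :: (real \<times> ('n::finite) path) measure)"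
    (is "_ \<in> borel_measurable ?M")
proof (rule borel_measurable_LIMSEQ_metric)
  let ?a = "\<lambda>n (k::int). max r (- ((of_int k + 1) / real (Suc n)))"
  let ?f = "\<lambda>n k x. if ?a n k < T then if ?a n k < fst x then snd x (?a n k) else (0 :: real ^ 'n) else 0"
  let ?h = "\<lambda>n x. if r < fst x then ?f n (\<lfloor>real (Suc n) * (- fst x)\<rfloor>) x else snd x r"
  have [measurable]: "fst \<in> borel_measurable ?M" by (rule measurable_predictable_time)
  show "?h n \<in> borel_measurable ?M" for n
  proof (rule measurable_If)
    show "(\<lambda>x. ?f n (\<lfloor>real (Suc n) * (- fst x)\<rfloor>) x) \<in> borel_measurable ?M"
    proof (rule measurable_compose_countable[where f = "?f n" and g = "\<lambda>x. \<lfloor>real (Suc n) * (- fst x)\<rfloor>"])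
      fix k :: int
      show "?f n k \<in> borel_measurable ?M"
      proof (cases "?a n k < T")
        case True
        then show ?thesis
          using measurable_predictable_after[OF _ True measurable_coordinate[of "?a n k" r "?a n k" Continuous T], of 0]
          by simp
      next
        case False
        then show ?thesis by (simp only: if_False borel_measurable_const)
      qed
    qed measurable
    show "(\<lambda>x. snd x r) \<in> borel_measurable ?M"
      by (rule measurable_predictable_initial[OF assms measurable_coordinate]) simp
    show "{x \<in> space ?M. r < fst x} \<in> sets ?M" by measurable
  qed
  fix x :: "real \<times> 'n path" assume "x \<in> space ?M"
  then have x: "r \<le> fst x" "fst x < T" "snd x \<in> Paths Continuous r T"
    by (auto simp: space_predictable_alg)
  show "(\<lambda>n. ?h n x) \<longlonglongrightarrow> snd x (fst x)"
  proof (cases "r < fst x")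
    case False
    with x have "fst x = r" by simp
    then show ?thesis by simp
  next
    case True
    \<comment> \<open>the floor of the negated time yields a grid point strictly below the time\<close>
    define b where "b n = ?a n (\<lfloor>real (Suc n) * (- fst x)\<rfloor>)" for n
    have lt: "b n < fst x" for n
      using floor_above_greater[of "- fst x" n] True unfolding b_def by linarith
    have "b \<longlonglongrightarrow> max r (- (- fst x))"
      unfolding b_def by (intro tendsto_max tendsto_const tendsto_minus tendsto_floor_above)
    then have lim: "b \<longlonglongrightarrow> fst x" using True by simp
    have cont: "continuous_on {r..T} (snd x)" using x(3) by (simp add: Paths_def)
    have "r \<le> b n" for n by (simp add: b_def)
    then have "\<forall>n. b n \<in> {r..T}" using lt x(2) by (meson atLeastAtMost_iff less_imp_le less_trans)
    then have "(\<lambda>n. snd x (b n)) \<longlonglongrightarrow> snd x (fst x)"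
      using x(1,2) by (intro continuous_on_tendsto_compose[OF cont lim]) auto
    moreover have "?h n x = snd x (b n)" for n
      unfolding b_def[symmetric] using lt[of n] less_trans[OF lt[of n] x(2)] True by simp
    ultimately show ?thesis by simp
  qed
qed

text \<open>The delicate part is the graph of the constant time \<open>a\<close>, where an event known at \<open>a\<close> must be
  predictable. On that graph the coordinates up to \<open>a\<close> are predictable, the last one because the
  coordinate process is.\<close>

lemma predictable_from:
  assumes "r < T" "r \<le> a" "a < T" and A: "A \<in> sets (path_alg Continuous r T a :: ('n::finite) path measure)"
  shows "{x \<in> space (predictable_alg Continuous T r). a \<le> fst x \<and> snd x \<in> A} \<in> sets (predictable_alg Continuous T r)"
proof -
  let ?M = "predictable_alg Continuous T r :: (real \<times> 'n path) measure"
  let ?S = "{x \<in> space ?M. fst x = a}"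
  have [measurable]: "fst \<in> borel_measurable ?M" by (rule measurable_predictable_time)
  have S: "?S \<in> sets ?M" by measurable
  have "snd \<in> measurable (restrict_space ?M ?S) (path_alg Continuous r T a)"
  proof (rule measurable_into_path_alg)
    fix v assume v: "v \<in> {r..a}"
    show "(\<lambda>x. snd x v) \<in> borel_measurable (restrict_space ?M ?S)"
    proof (cases "v = a")
      case True
      have "(\<lambda>x. snd x (fst x)) \<in> borel_measurable (restrict_space ?M ?S)"
        by (rule measurable_restrict_space1[OF measurable_predictable_evaluation[OF assms(1)]])
      then show ?thesis
        by (rule measurable_cong[THEN iffD1, rotated]) (auto simp: space_restrict_space True)
    next
      case False
      have "(\<lambda>x. if v < fst x then snd x v else 0) \<in> borel_measurable (restrict_space ?M ?S)"
        using v assms by (intro measurable_restrict_space1 measurable_predictable_after measurable_coordinate) auto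
      then show ?thesis
        by (rule measurable_cong[THEN iffD1, rotated]) (use False v in \<open>auto simp: space_restrict_space\<close>)
    qed
  qed (auto simp: space_restrict_space space_predictable_alg)
  from measurable_sets[OF this A]
  have "snd -` A \<inter> (?S \<inter> space ?M) \<in> sets ?M"
    using S by (simp add: sets_restrict_space_iff space_restrict_space)
  moreover have "{a<..<T} \<times> A \<in> sets ?M" by (rule predictable_ray[OF assms(2,3) A])
  moreover have "{x \<in> space ?M. a \<le> fst x \<and> snd x \<in> A} = (snd -` A \<inter> (?S \<inter> space ?M)) \<union> {a<..<T} \<times> A"
    using sets.sets_into_space[OF A] assms(2) by (auto simp: space_predictable_alg)
  ultimately show ?thesis by auto
qed

text \<open>The process is one of finitely many functions of time and position, chosen by the step and
  the cell; it is measurable for each $\sigma$-algebra that measures time, position and this choice.\<close>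

lemma measurable_process:
  fixes \<gamma> :: "('n::finite, 'e::topological_space) step_process"
  assumes \<gamma>: "step_structure pk T \<Theta> r \<gamma>" and r: "0 \<le> r"
    and \<Theta>: "\<And>\<theta>. \<theta> \<in> \<Theta> \<Longrightarrow> \<theta> \<in> borel_measurable (restrict_space borel ({0..} \<times> UNIV))"
    and M: "space M \<subseteq> {r..<T} \<times> Paths pk r T"
    and time: "fst \<in> borel_measurable M" and eval: "(\<lambda>x. snd x (fst x)) \<in> borel_measurable M"
    and cells: "\<And>i j. i < nsteps \<gamma> \<Longrightarrow> j \<in> idx \<gamma> i \<Longrightarrow>
      {x \<in> space M. node \<gamma> i \<le> fst x \<and> snd x \<in> cell \<gamma> i j} \<in> sets M"
  shows "(\<lambda>(u, \<omega>). process \<gamma> u \<omega>) \<in> borel_measurable M"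
proof -
  let ?J = "SIGMA i:{..<nsteps \<gamma>}. idx \<gamma> i"
  let ?g = "\<lambda>x. (step_at \<gamma> (fst x), THE j. j \<in> idx \<gamma> (step_at \<gamma> (fst x)) \<and> snd x \<in> cell \<gamma> (step_at \<gamma> (fst x)) j)"
  let ?f = "\<lambda>(i, j) x. coef \<gamma> i j (fst x, snd x (fst x))"
  have x: "r \<le> fst x" "fst x < T" "snd x \<in> Paths pk r T" if "x \<in> space M" for x
    using M that by auto
  have g: "?g x = (i, j) \<longleftrightarrow> node \<gamma> i \<le> fst x \<and> fst x < node \<gamma> (Suc i) \<and> snd x \<in> cell \<gamma> i j"
    if "x \<in> space M" "i < nsteps \<gamma>" "j \<in> idx \<gamma> i" for x i j
  proof -
    note st = step_at[OF \<gamma> x(1,2)[OF that(1)], unfolded next_node_def]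
    note un = cell_index_unique[OF \<gamma> _ x(3)[OF that(1)]]
    show ?thesis
    proof
      assume e: "?g x = (i, j)"
      then have i: "step_at \<gamma> (fst x) = i" by simp
      from e theI'[OF un[OF that(2)]] have "snd x \<in> cell \<gamma> i j" by (auto simp: i)
      with st i show "node \<gamma> i \<le> fst x \<and> fst x < node \<gamma> (Suc i) \<and> snd x \<in> cell \<gamma> i j" by simp
    next
      assume e: "node \<gamma> i \<le> fst x \<and> fst x < node \<gamma> (Suc i) \<and> snd x \<in> cell \<gamma> i j"
      then have "step_at \<gamma> (fst x) = i" using step_at_unique[OF \<gamma> that(2)] by simp
      with e that(3) the1_equality[OF un[OF that(2)]] show "?g x = (i, j)" by simp
    qed
  qed
  have fin: "finite ?J"
    using \<gamma> by (intro finite_SigmaI) (auto simp: step_structure_def)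
  have "(\<lambda>x. ?f (?g x) x) \<in> borel_measurable M"
  proof (rule measurable_compose_countable'[where I = ?J])
    fix p assume "p \<in> ?J"
    then obtain i j where p: "p = (i, j)" "i < nsteps \<gamma>" "j \<in> idx \<gamma> i" by auto
    then have "coef \<gamma> i j \<in> \<Theta>" using \<gamma> by (simp add: step_structure_def)
    note \<theta> = \<Theta>[OF this]
    have "(\<lambda>x. (fst x, snd x (fst x))) \<in> measurable M (restrict_space borel ({0..} \<times> UNIV))"
      using x(1) r by (intro measurable_restrict_space2 borel_measurable_Pair time eval) fastforce
    from measurable_compose[OF this \<theta>] show "?f p \<in> borel_measurable M" by (simp add: p(1))
  next
    show "?g \<in> measurable M (count_space ?J)"
      unfolding measurable_count_space_eq2[OF fin]
    proof (intro conjI ballI Pi_I)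
      fix x assume xM: "x \<in> space M"
      note st = step_at(1)[OF \<gamma> x(1,2)[OF xM]]
      from st theI'[OF cell_index_unique[OF \<gamma> st x(3)[OF xM]]] show "?g x \<in> ?J" by simp
    next
      fix p assume "p \<in> ?J"
      then obtain i j where p: "p = (i, j)" "i < nsteps \<gamma>" "j \<in> idx \<gamma> i" by auto
      have "?g -` {p} \<inter> space M = {x \<in> space M. node \<gamma> i \<le> fst x \<and> snd x \<in> cell \<gamma> i j} \<inter>
          {x \<in> space M. fst x < node \<gamma> (Suc i)}"
        using g[OF _ p(2,3)] by (auto simp: p(1))
      moreover have "{x \<in> space M. fst x < node \<gamma> (Suc i)} \<in> sets M" using time by measurable
      ultimately show "?g -` {p} \<inter> space M \<in> sets M" using cells[OF p(2,3)] by auto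
    qed
  qed (rule countable_finite[OF fin])
  moreover have "(\<lambda>x. ?f (?g x) x) = (\<lambda>(u, \<omega>). process \<gamma> u \<omega>)"
    by (auto simp: fun_eq_iff process_def used_coef_def Let_def)
  ultimately show ?thesis by simp
qed

lemma step_structure_predictable:
  fixes \<gamma> :: "('n::finite, 'e::topological_space) step_process"
  assumes \<gamma>: "step_structure pk T \<Theta> r \<gamma>" and r: "0 \<le> r"
    and \<Theta>: "\<And>\<theta>. \<theta> \<in> \<Theta> \<Longrightarrow> \<theta> \<in> borel_measurable (restrict_space borel ({0..} \<times> UNIV))"
  shows "predictable_process pk T r (process \<gamma>)"
proof (cases pk)
  case Continuous
  let ?M = "predictable_alg Continuous T r :: (real \<times> 'n path) measure"
  have "(\<lambda>(u, \<omega>). process \<gamma> u \<omega>) \<in> borel_measurable ?M"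
  proof (cases "r < T")
    case True
    show ?thesis
    proof (rule measurable_process[OF \<gamma> r \<Theta>])
      fix i j assume ij: "i < nsteps \<gamma>" "j \<in> idx \<gamma> i"
      have "node \<gamma> i < T" using node_strict_mono[OF \<gamma> ij(1)] node_ends[OF \<gamma>] by simp
      then show "{x \<in> space ?M. node \<gamma> i \<le> fst x \<and> snd x \<in> cell \<gamma> i j} \<in> sets ?M"
        using \<gamma> ij Continuous node_range[OF \<gamma>, of i]
        by (intro predictable_from[OF True]) (auto simp: step_structure_def)
    qed (auto simp: Continuous space_predictable_alg measurable_predictable_time
        measurable_predictable_evaluation[OF True])
  next
    case False
    then have "space ?M = {}" by (simp add: space_predictable_alg)
    then show ?thesis by (simp add: measurable_def)
  qed
  with Continuous show ?thesis by (simp add: predictable_process_def)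
next
  case Cadlag
  have "(\<lambda>(u, \<omega>). process \<gamma> u \<omega>) \<in> borel_measurable (restrict_space borel {r..t} \<Otimes>\<^sub>M path_alg pk r T t)"
    (is "_ \<in> borel_measurable ?M") if t: "t \<in> {r..<T}" for t
  proof (rule measurable_process[OF \<gamma> r \<Theta>])
    show "space ?M \<subseteq> {r..<T} \<times> Paths pk r T"
      using t by (auto simp: space_pair_measure space_restrict_space)
    show time: "fst \<in> borel_measurable ?M"
      using measurable_fst[of "restrict_space borel {r..t}"]
      by (rule measurable_compose) (auto intro: measurable_restrict_space1)
    show "(\<lambda>x. snd x (fst x)) \<in> borel_measurable ?M"
      using measurable_evaluation[of r t T pk] t by (simp add: split_beta')
    fix i j assume ij: "i < nsteps \<gamma>" "j \<in> idx \<gamma> i"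
    show "{x \<in> space ?M. node \<gamma> i \<le> fst x \<and> snd x \<in> cell \<gamma> i j} \<in> sets ?M"
    proof (cases "node \<gamma> i \<le> t")
      case True
      then have "cell \<gamma> i j \<in> sets (path_alg pk r T t)"
        using \<gamma> ij sets_path_alg_mono[OF True, of pk r T] by (auto simp: step_structure_def)
      from measurable_sets[OF measurable_snd this]
      have "{x \<in> space ?M. snd x \<in> cell \<gamma> i j} \<in> sets ?M" by (simp add: vimage_def Int_def conj_commute)
      moreover have "{x \<in> space ?M. node \<gamma> i \<le> fst x} \<in> sets ?M" using time by measurable
      ultimately have "{x \<in> space ?M. node \<gamma> i \<le> fst x} \<inter> {x \<in> space ?M. snd x \<in> cell \<gamma> i j} \<in> sets ?M"
        by (rule sets.Int[rotated])
      moreover have "{x \<in> space ?M. node \<gamma> i \<le> fst x} \<inter> {x \<in> space ?M. snd x \<in> cell \<gamma> i j} =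
          {x \<in> space ?M. node \<gamma> i \<le> fst x \<and> snd x \<in> cell \<gamma> i j}" by auto
      ultimately show ?thesis by simp
    next
      case False
      then have "{x \<in> space ?M. node \<gamma> i \<le> fst x \<and> snd x \<in> cell \<gamma> i j} = {}"
        by (auto simp: space_pair_measure space_restrict_space)
      then show ?thesis by (simp only: sets.empty_sets)
    qed
  qed
  with Cadlag show ?thesis by (simp add: predictable_process_def)
qed

section \<open>Splicing\<close>

lemma finite_set_increasing_enumeration:
  fixes D :: "real set"
  assumes D: "finite D" "D \<subseteq> {r..T}" "r \<in> D" "T \<in> D"
  obtains N and p :: "nat \<Rightarrow> real"
  where "p 0 = r" "p N = T" "\<And>i. i < N \<Longrightarrow> p i < p (Suc i)" "D = p ` {..N}"
proof -
  let ?xs = "sorted_list_of_set D"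
  define h where "h i = ?xs ! i" for i
  have "0 < card D" using D by (auto simp: card_gt_0_iff)
  then obtain N where "card D = Suc N" by (metis Suc_pred)
  then have len: "length ?xs = Suc N" by simp
  have "D = set ?xs" using D(1) by simp
  also have "\<dots> = h ` {..N}" unfolding set_conv_nth len h_def by (auto simp: less_Suc_eq_le)
  finally have img: "D = h ` {..N}" .
  have mono: "h i < h j" if "i < j" "j \<le> N" for i j
    using sorted_wrt_nth_less[OF strict_sorted_list_of_set, of i j D] that len by (simp add: h_def)
  obtain i where i: "i \<le> N" "h i = r" using D(3) img by auto
  have "r \<le> h 0" "h N \<le> T" using D(2) img by auto
  then have "h 0 = r" using mono[of 0 i] i by (cases "i = 0") auto
  moreover obtain j where j: "j \<le> N" "h j = T" using D(4) img by auto
  then have "h N = T" using mono[of j N] \<open>h N \<le> T\<close> by (cases "j = N") auto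
  ultimately show ?thesis using mono img by (intro that[of h N]) auto
qed

text \<open>The subdivision consists of the nodes of both processes and \<open>s\<close>. After \<open>s\<close>, the cells of
  the first process are cut with \<open>A\<close> and those of the second with the complement of \<open>A\<close>; even and
  odd indices keep the two families apart.\<close>

lemma splice_exists:
  fixes \<gamma> \<delta> :: "('n::finite, 'e) step_process"
  assumes \<gamma>: "step_structure pk T \<Theta> r \<gamma>" and \<delta>: "step_structure pk T \<Theta> r \<delta>"
    and s: "s \<in> {r..T}" and A: "A \<in> sets (path_alg pk r T s)"
  obtains \<eta> where "step_structure pk T \<Theta> r \<eta>" "splices pk T r s A \<gamma> \<delta> \<eta>"
    "r < s \<Longrightarrow> idx \<eta> 0 = idx \<gamma> 0"
proof -
  let ?D = "node \<gamma> ` {..nsteps \<gamma>} \<union> node \<delta> ` {..nsteps \<delta>} \<union> {s}"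
  have D: "?D \<subseteq> {r..T}" using node_range[OF \<gamma>] node_range[OF \<delta>] s by (simp add: image_subset_iff)
  have "node \<gamma> 0 \<in> ?D" "node \<gamma> (nsteps \<gamma>) \<in> ?D" by blast+
  then have "r \<in> ?D" "T \<in> ?D" unfolding node_ends[OF \<gamma>] .
  moreover have "finite ?D" by simp
  ultimately obtain N p where p: "p 0 = r" "p N = T" "\<And>i. i < N \<Longrightarrow> p i < p (Suc i)"
    and img: "?D = p ` {..N}"
    using D by (metis finite_set_increasing_enumeration)
  have mono: "p i \<le> p j" if "i \<le> j" "j \<le> N" for i j
    using that
  proof (induction j)
    case (Suc j)
    then show ?case using p(3)[of j] by (cases "i = Suc j") auto
  qed simp
  \<comment> \<open>between two neighbouring nodes of \<open>\<eta>\<close> there is no node of \<open>\<gamma>\<close> or \<open>\<delta>\<close>, nor \<open>s\<close>\<close>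
  have gap: "p (Suc i) \<le> d" if "i < N" "d \<in> ?D" "p i < d" for i d
  proof -
    have "d \<in> p ` {..N}" using that(2) unfolding img .
    then obtain j where j: "j \<le> N" "d = p j" by auto
    have "\<not> j \<le> i" using mono[of j i] that(1,3) j by auto
    then show ?thesis using mono[of "Suc i" j] j by simp
  qed
  define g d where "g i = step_at \<gamma> (p i)" and "d i = step_at \<delta> (p i)" for i
  define \<eta> where "\<eta> = \<lparr>nsteps = N, node = p,
    idx = (\<lambda>i. if p i < s then idx \<gamma> (g i)
      else (\<lambda>j. 2 * j) ` idx \<gamma> (g i) \<union> (\<lambda>j. 2 * j + 1) ` idx \<delta> (d i)),
    cell = (\<lambda>i j. if p i < s then cell \<gamma> (g i) j
      else if even j then cell \<gamma> (g i) (j div 2) \<inter> A else cell \<delta> (d i) (j div 2) - A),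
    coef = (\<lambda>i j. if p i < s then coef \<gamma> (g i) j
      else if even j then coef \<gamma> (g i) (j div 2) else coef \<delta> (d i) (j div 2))\<rparr>"
  have N: "nsteps \<eta> = N" and node: "node \<eta> = p" by (simp_all add: \<eta>_def)
  have pi: "r \<le> p i" "p i < T" if "i < N" for i
    using mono[of 0 i] mono[of "Suc i" N] p(3)[OF that] that unfolding p(1,2) by auto
  have steps: "g i < nsteps \<gamma>" "node \<gamma> (g i) \<le> p i" "d i < nsteps \<delta>" "node \<delta> (d i) \<le> p i" if "i < N" for i
    using step_at[OF \<gamma> pi[OF that]] step_at[OF \<delta> pi[OF that]] by (auto simp: g_def d_def)
  have at_\<gamma>: "step_at \<gamma> u = g i" and at_\<delta>: "step_at \<delta> u = d i"
    if i: "i < N" "p i \<le> u" "u < p (Suc i)" for i u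
  proof -
    note a = step_at[OF \<gamma> pi[OF i(1)]] and b = step_at[OF \<delta> pi[OF i(1)]]
    have "p (Suc i) \<le> next_node \<gamma> (p i)" "p (Suc i) \<le> next_node \<delta> (p i)"
      using a b by (auto intro!: gap[OF i(1)] simp: next_node_def)
    then show "step_at \<gamma> u = g i" "step_at \<delta> u = d i"
      using step_at_between(1)[OF \<gamma> pi(1) i(2) _ pi(2)] step_at_between(1)[OF \<delta> pi(1) i(2) _ pi(2)] i
      by (auto simp: g_def d_def)
  qed
  have struct_\<gamma>: "finite (idx \<gamma> (g i))" "(\<Union>j\<in>idx \<gamma> (g i). cell \<gamma> (g i) j) = Paths pk r T"
    "disjoint_family_on (cell \<gamma> (g i)) (idx \<gamma> (g i))"
    "\<And>j. j \<in> idx \<gamma> (g i) \<Longrightarrow> cell \<gamma> (g i) j \<in> sets (path_alg pk r T (p i)) \<and> coef \<gamma> (g i) j \<in> \<Theta>"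
    if "i < N" for i
    using \<gamma> steps[OF that] sets_path_alg_mono[OF steps(2)[OF that], of pk r T]
    by (auto simp: step_structure_def)
  have struct_\<delta>: "finite (idx \<delta> (d i))" "(\<Union>j\<in>idx \<delta> (d i). cell \<delta> (d i) j) = Paths pk r T"
    "disjoint_family_on (cell \<delta> (d i)) (idx \<delta> (d i))"
    "\<And>j. j \<in> idx \<delta> (d i) \<Longrightarrow> cell \<delta> (d i) j \<in> sets (path_alg pk r T (p i)) \<and> coef \<delta> (d i) j \<in> \<Theta>"
    if "i < N" for i
    using \<delta> steps[OF that] sets_path_alg_mono[OF steps(4)[OF that], of pk r T]
    by (auto simp: step_structure_def)
  have A\<Omega>: "A \<subseteq> Paths pk r T" using sets.sets_into_space[OF A] by simp
  have struct: "step_structure pk T \<Theta> r \<eta>"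
    unfolding step_structure_def N node
  proof (intro conjI allI impI ballI)
    fix i assume i: "i < N"
    note sg = struct_\<gamma>[OF i] and sd = struct_\<delta>[OF i]
    show "p i < p (Suc i)" using p i by blast
    show "finite (idx \<eta> i)" using sg(1) sd(1) by (simp add: \<eta>_def)
    show "(\<Union>j\<in>idx \<eta> i. cell \<eta> i j) = Paths pk r T"
    proof (cases "p i < s")
      case True
      then show ?thesis using sg(2) by (simp add: \<eta>_def)
    next
      case False
      have "(\<Union>j\<in>idx \<eta> i. cell \<eta> i j) =
          (\<Union>j\<in>idx \<gamma> (g i). cell \<gamma> (g i) j) \<inter> A \<union> ((\<Union>j\<in>idx \<delta> (d i). cell \<delta> (d i) j) - A)"
        using False by (auto simp: \<eta>_def UN_Un)
      then show ?thesis using A\<Omega> by (auto simp: sg(2) sd(2))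
    qed
    show "disjoint_family_on (cell \<eta> i) (idx \<eta> i)"
      using sg(3) sd(3) unfolding disjoint_family_on_def by (auto simp: \<eta>_def; blast)
    fix j assume j: "j \<in> idx \<eta> i"
    have "A \<in> sets (path_alg pk r T (p i))" if "\<not> p i < s"
      using A sets_path_alg_mono[of s "p i" pk r T] that by auto
    then show "cell \<eta> i j \<in> sets (path_alg pk r T (p i))" "coef \<eta> i j \<in> \<Theta>"
      using j sg(4) sd(4) by (auto simp: \<eta>_def split: if_splits)
  qed (use p in simp_all)
  have "splices pk T r s A \<gamma> \<delta> \<eta>"
    unfolding splices_def
  proof (intro ballI conjI)
    fix \<omega> :: "'n path" and u assume \<omega>: "\<omega> \<in> Paths pk r T"
    have used: "used_coef \<eta> u \<omega> = (if u < s \<or> \<omega> \<in> A then used_coef \<gamma> u \<omega> else used_coef \<delta> u \<omega>)"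
      if u: "r \<le> u" "u < T"
    proof -
      define i where "i = step_at \<eta> u"
      have i: "i < N" "p i \<le> u" "u < p (Suc i)"
        using step_at[OF struct u] by (auto simp: i_def N node next_node_def)
      have us: "u < s \<longleftrightarrow> p i < s"
        using gap[OF i(1), of s] i by auto
      obtain j where j: "j \<in> idx \<gamma> (g i)" "\<omega> \<in> cell \<gamma> (g i) j" "used_coef \<gamma> u \<omega> = coef \<gamma> (g i) j"
        using used_coef_cell[OF \<gamma> u \<omega>] unfolding at_\<gamma>[OF i] by blast
      obtain l where l: "l \<in> idx \<delta> (d i)" "\<omega> \<in> cell \<delta> (d i) l" "used_coef \<delta> u \<omega> = coef \<delta> (d i) l"
        using used_coef_cell[OF \<delta> u \<omega>] unfolding at_\<delta>[OF i] by blast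
      consider "u < s" | "\<not> u < s" "\<omega> \<in> A" | "\<not> u < s" "\<omega> \<notin> A" by blast
      then show ?thesis
      proof cases
        case 1
        have "used_coef \<eta> u \<omega> = coef \<eta> i j"
          by (rule used_coef_eqI[OF struct u \<omega> i_def]) (use 1 us j in \<open>auto simp: \<eta>_def\<close>)
        with 1 us j show ?thesis by (simp add: \<eta>_def)
      next
        case 2
        have "used_coef \<eta> u \<omega> = coef \<eta> i (2 * j)"
          by (rule used_coef_eqI[OF struct u \<omega> i_def]) (use 2 us j in \<open>auto simp: \<eta>_def\<close>)
        with 2 us j show ?thesis by (simp add: \<eta>_def)
      next
        case 3
        have "used_coef \<eta> u \<omega> = coef \<eta> i (2 * l + 1)"
          by (rule used_coef_eqI[OF struct u \<omega> i_def]) (use 3 us l in \<open>auto simp: \<eta>_def\<close>)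
        with 3 us l show ?thesis by (simp add: \<eta>_def)
      qed
    qed
    show "used_coef \<eta> u \<omega> = used_coef \<gamma> u \<omega>" if "u \<in> {r..<s}" using used that s by simp
    show "used_coef \<eta> u \<omega> = (if \<omega> \<in> A then used_coef \<gamma> u \<omega> else used_coef \<delta> u \<omega>)" if "u \<in> {s..<T}"
      using used that s by auto
  qed
  moreover have "idx \<eta> 0 = idx \<gamma> 0" if "r < s"
  proof -
    have "r < T" using that s by simp
    then have "nsteps \<gamma> \<noteq> 0" using node_ends[OF \<gamma>] by (metis less_irrefl)
    then have "step_at \<gamma> r = 0"
      using node_ends[OF \<gamma>] node_strict_mono[OF \<gamma>, of 0 "Suc 0"] by (intro step_at_unique[OF \<gamma>]) auto
    with that show ?thesis by (simp add: \<eta>_def p(1) g_def)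
  qed
  ultimately show ?thesis using struct that by blast
qed

lemma constant_path_in_Paths: "restrict (\<lambda>_. y) {r..t} \<in> Paths pk r t"
proof -
  have "continuous_on {r..t} (restrict (\<lambda>_. y) {r..t})"
    by (rule continuous_on_eq[of _ "\<lambda>_. y"]) auto
  then have c: "restrict (\<lambda>_. y) {r..t} \<in> Paths Continuous r t" by (simp add: Paths_def)
  show ?thesis
  proof (cases pk)
    case Cadlag
    with Paths_cadlag[OF c] show ?thesis by (simp add: Paths_def)
  qed (use c in simp)
qed

context theta_family
begin

lemma in_Theta_ext_iff:
  assumes "0 \<le> r"
  shows "\<gamma> \<in> Theta_ext pk T \<Theta> r \<longleftrightarrow> step_structure pk T \<Theta> r \<gamma>"
proof -
  have \<Theta>: "\<theta> \<in> borel_measurable (restrict_space borel ({0..} \<times> UNIV))" if "\<theta> \<in> \<Theta>" for \<theta>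
    using hypothesis that unfolding Theta_hypothesis_def by blast
  have "predictable_process pk T r (process \<gamma>)" if "step_structure pk T \<Theta> r \<gamma>"
    using step_structure_predictable[OF that assms \<Theta>] .
  then show ?thesis unfolding Theta_ext_def step_structure_def by auto
qed

text \<open>On \<open>A\<close> and on its complement the coefficients in force after \<open>s\<close> are those of one of the two
  processes. Before \<open>s\<close> they are those of \<open>\<gamma>\<close>, but the operators of \<open>\<gamma>\<close> and \<open>\<eta>\<close> at \<open>u\<close> also involve
  what happens after \<open>s\<close>; hence the restriction to functionals known at \<open>s\<close>.\<close>

lemma splice_operators:
  assumes r: "0 \<le> r" and \<gamma>: "step_structure pk T \<Theta> r \<gamma>" and \<delta>: "step_structure pk T \<Theta> r \<delta>"
    and \<eta>: "step_structure pk T \<Theta> r \<eta>" and sp: "splices pk T r s A \<gamma> \<delta> \<eta>"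
    and s: "s \<in> {r..T}" and A: "A \<in> \<B> r s" and \<omega>: "\<omega> \<in> \<Omega> r"
  shows "u \<in> {s..T} \<Longrightarrow> \<psi> \<in> Bb pk T r T \<Longrightarrow>
      Ts r \<eta> u \<psi> \<omega> = indicator A \<omega> * Ts r \<gamma> u \<psi> \<omega> + indicator (- A) \<omega> * Ts r \<delta> u \<psi> \<omega>"
    and "u \<in> {r..<s} \<Longrightarrow> \<phi> \<in> Bb pk T r s \<Longrightarrow> Ts r \<eta> u \<phi> \<omega> = Ts r \<gamma> u \<phi> \<omega>"
proof -
  have A\<Omega>: "A \<subseteq> \<Omega> r" using sets.sets_into_space[OF A] by simp
  have rs: "r \<le> s" "s \<le> T" using s by auto
  show "Ts r \<eta> u \<psi> \<omega> = indicator A \<omega> * Ts r \<gamma> u \<psi> \<omega> + indicator (- A) \<omega> * Ts r \<delta> u \<psi> \<omega>"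
    if u: "u \<in> {s..T}" and \<psi>: "\<psi> \<in> Bb pk T r T"
  proof (cases "\<omega> \<in> A")
    case True
    have "Ts r \<eta> u \<psi> \<omega> = Ts r \<gamma> u \<psi> \<omega>"
      by (rule T_step_eq_if_used_coef_eq[OF r \<eta> \<gamma> rs(1) _ _ order_refl A _ \<psi> True])
        (use u sp A\<Omega> in \<open>auto simp: splices_def\<close>)
    with True show ?thesis by simp
  next
    case False
    have A': "\<Omega> r - A \<in> \<B> r s" using sets.compl_sets[OF A] by simp
    have "Ts r \<eta> u \<psi> \<omega> = Ts r \<delta> u \<psi> \<omega>"
      by (rule T_step_eq_if_used_coef_eq[OF r \<eta> \<delta> rs(1) _ _ order_refl A' _ \<psi>])
        (use u sp False \<omega> in \<open>auto simp: splices_def\<close>)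
    with False show ?thesis by simp
  qed
  show "Ts r \<eta> u \<phi> \<omega> = Ts r \<gamma> u \<phi> \<omega>" if u: "u \<in> {r..<s}" and \<phi>: "\<phi> \<in> Bb pk T r s"
  proof (rule T_step_eq_if_used_coef_eq[OF r \<eta> \<gamma> order_refl _ _ rs(2) _ _ \<phi> \<omega>])
    show "\<Omega> r \<in> \<B> r r" using sets.top[of "path_alg pk r T r"] by simp
  qed (use u sp in \<open>auto simp: splices_def\<close>)
qed

text \<open>The cells at time \<open>r\<close> are events of the position at \<open>r\<close>, so all paths that start from \<open>y\<close> lie
  in one of them. Replacing the initial partition by that single cell changes the problem only on
  paths that a measure starting from \<open>y\<close> does not charge.\<close>

lemma merge_initial_cells:
  assumes r: "0 \<le> r" "r \<le> T" and \<gamma>: "step_structure pk T \<Theta> r \<gamma>"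
  obtains \<gamma>' where "step_structure pk T \<Theta> r \<gamma>'" "idx \<gamma>' 0 = {1}"
    "\<And>Q. is_solution pk r T I (Z_step Z \<gamma>) y Q \<longleftrightarrow> is_solution pk r T I (Z_step Z \<gamma>') y Q"
proof (cases "nsteps \<gamma> = 0")
  case True
  define \<gamma>' where "\<gamma>' = \<gamma>\<lparr>idx := (idx \<gamma>)(0 := {1})\<rparr>"
  have "step_structure pk T \<Theta> r \<gamma>'" using \<gamma> True by (simp add: step_structure_def \<gamma>'_def)
  moreover have "Z_step Z \<gamma>' = Z_step Z \<gamma>" using True by (simp add: fun_eq_iff Z_step_def \<gamma>'_def)
  ultimately show ?thesis by (intro that[of \<gamma>']) (simp_all add: \<gamma>'_def)
next
  case False
  then have N: "0 < nsteps \<gamma>" by simp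
  \<comment> \<open>a path from \<open>y\<close>, only used to single out the initial cell of the paths from \<open>y\<close>\<close>
  let ?\<omega> = "restrict (\<lambda>_. y) {r..T}"
  obtain j0 where j0: "j0 \<in> idx \<gamma> 0" "?\<omega> \<in> cell \<gamma> 0 j0"
    using cell_index_unique[OF \<gamma> N constant_path_in_Paths] by blast
  define \<gamma>' where "\<gamma>' = \<gamma>\<lparr>idx := (idx \<gamma>)(0 := {1}), cell := (cell \<gamma>)(0 := (\<lambda>_. \<Omega> r)),
    coef := (coef \<gamma>)(0 := (\<lambda>_. coef \<gamma> 0 j0))\<rparr>"
  have top: "\<Omega> r \<in> \<B> r u" for u using sets.top[of "path_alg pk r T u"] by simp
  have \<gamma>': "step_structure pk T \<Theta> r \<gamma>'"
    using \<gamma> j0 N top by (auto simp: step_structure_def \<gamma>'_def disjoint_family_on_def)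
  have eq: "Z_step Z \<gamma>' k r u \<omega> = Z_step Z \<gamma> k r u \<omega>" if \<omega>: "\<omega> \<in> \<Omega> r" "\<omega> r = y" for k u \<omega>
  proof -
    have "cell \<gamma> 0 j0 \<in> \<B> r r" using \<gamma> N j0(1) by (auto simp: step_structure_def)
    from path_alg_event_determined[OF this \<omega>(1) constant_path_in_Paths, of y] j0(2) \<omega>(2) r(2)
    have \<omega>j: "\<omega> \<in> cell \<gamma> 0 j0" by auto
    have "(\<Sum>j\<in>idx \<gamma>' i. indicator (cell \<gamma>' i j) \<omega> * Zc (coef \<gamma>' i j) k a b \<omega>) =
        (\<Sum>j\<in>idx \<gamma> i. indicator (cell \<gamma> i j) \<omega> * Zc (coef \<gamma> i j) k a b \<omega>)" for i a b
    proof (cases "i = 0")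
      case True
      then show ?thesis
        using cell_sum[OF \<gamma> N \<omega>(1) j0(1) \<omega>j, of "\<lambda>j. Zc (coef \<gamma> 0 j) k a b \<omega>"] \<omega>(1)
        by (simp add: \<gamma>'_def)
    qed (simp add: \<gamma>'_def)
    moreover have "nsteps \<gamma>' = nsteps \<gamma>" "node \<gamma>' = node \<gamma>" by (simp_all add: \<gamma>'_def)
    ultimately show ?thesis by (simp add: Z_step_def Let_def cong: if_cong)
  qed
  have "is_solution pk r T I (Z_step Z \<gamma>) y Q \<longleftrightarrow> is_solution pk r T I (Z_step Z \<gamma>') y Q" for Q
  proof -
    have W: "Z_step Z \<gamma> k r u \<in> Bb pk T r u" "Z_step Z \<gamma>' k r u \<in> Bb pk T r u"
      if "k \<in> I" "u \<in> {r..T}" for k u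
      using Z_step_in_Bb[OF r(1) \<gamma>] Z_step_in_Bb[OF r(1) \<gamma>'] that by auto
    have int: "(\<integral>\<omega>. indicator B \<omega> * (Z_step Z \<gamma> k r v \<omega> - Z_step Z \<gamma> k r u \<omega>) \<partial>Q) =
        (\<integral>\<omega>. indicator B \<omega> * (Z_step Z \<gamma>' k r v \<omega> - Z_step Z \<gamma>' k r u \<omega>) \<partial>Q)"
      if Q: "prob_on (path_alg pk r T T) Q" "measure Q {\<omega> \<in> \<Omega> r. \<omega> r = y} = 1"
        and *: "k \<in> I" "u \<in> {r..T}" "v \<in> {u..T}" "B \<in> \<B> r u" for k u v B
    proof (rule integral_cong_AE)
      interpret prob_space Q using prob_onD(1)[OF Q(1)] .
      have "AE \<omega> in Q. \<omega> \<in> {\<omega> \<in> \<Omega> r. \<omega> r = y}" by (rule AE_prob_1[OF Q(2)])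
      then show "AE \<omega> in Q. indicator B \<omega> * (Z_step Z \<gamma> k r v \<omega> - Z_step Z \<gamma> k r u \<omega>) =
          indicator B \<omega> * (Z_step Z \<gamma>' k r v \<omega> - Z_step Z \<gamma>' k r u \<omega>)"
        by eventually_elim (simp add: eq)
      have uv: "r \<le> u" "u \<le> v" "v \<le> T" using * by auto
      show "(\<lambda>\<omega>. indicator B \<omega> * (Z_step Z \<gamma> k r v \<omega> - Z_step Z \<gamma> k r u \<omega>)) \<in> borel_measurable Q"
        by (rule borel_measurable_integrable[OF integrable_Bb[OF Q(1)
              Bb_mono[OF Z_step_difference_in_Bb[OF r(1) \<gamma> *(1) uv *(4)] uv(3)]]])
      show "(\<lambda>\<omega>. indicator B \<omega> * (Z_step Z \<gamma>' k r v \<omega> - Z_step Z \<gamma>' k r u \<omega>)) \<in> borel_measurable Q"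
        by (rule borel_measurable_integrable[OF integrable_Bb[OF Q(1)
              Bb_mono[OF Z_step_difference_in_Bb[OF r(1) \<gamma>' *(1) uv *(4)] uv(3)]]])
    qed
    show ?thesis
      using is_solution_iff[where W = "Z_step Z \<gamma>" and Q = Q and y = y, OF W(1)]
        is_solution_iff[where W = "Z_step Z \<gamma>'" and Q = Q and y = y, OF W(2)]
        int by auto
  qed
  with \<gamma>' show ?thesis by (intro that[of \<gamma>']) (simp_all add: \<gamma>'_def)
qed

section \<open>Stability\<close>

context
  fixes r :: real and y :: "real ^ 'n"
  assumes r: "0 \<le> r" "r \<le> T"
    and unique: "\<And>\<gamma>. \<gamma> \<in> Theta_T pk T \<Theta> r \<Longrightarrow> \<exists>!Q. is_solution pk r T I (Z_step Z \<gamma>) y Q"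
begin

lemma extended_solution:
  assumes "step_structure pk T \<Theta> r \<gamma>"
  shows "\<exists>!Q. is_solution pk r T I (Z_step Z \<gamma>) y Q"
    and "is_solution pk r T I (Z_step Z \<gamma>) y (Q_step pk T I Z r y \<gamma>)"
    and "Q_step pk T I Z r y \<gamma> \<in> Q_set pk T \<Theta> I Z r y"
proof -
  obtain \<gamma>' where \<gamma>': "step_structure pk T \<Theta> r \<gamma>'" "idx \<gamma>' 0 = {1}"
    "\<And>Q. is_solution pk r T I (Z_step Z \<gamma>) y Q \<longleftrightarrow> is_solution pk r T I (Z_step Z \<gamma>') y Q"
    using merge_initial_cells[OF r assms] by blast
  then have T: "\<gamma>' \<in> Theta_T pk T \<Theta> r" using in_Theta_ext_iff[OF r(1)] by (simp add: Theta_T_def)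
  from unique[OF this] \<gamma>'(3) show ex: "\<exists>!Q. is_solution pk r T I (Z_step Z \<gamma>) y Q" by simp
  then show "is_solution pk r T I (Z_step Z \<gamma>) y (Q_step pk T I Z r y \<gamma>)"
    unfolding Q_step_def by (rule theI')
  have "Q_step pk T I Z r y \<gamma> = Q_step pk T I Z r y \<gamma>'" using \<gamma>'(3) by (simp add: Q_step_def)
  with T show "Q_step pk T I Z r y \<gamma> \<in> Q_set pk T \<Theta> I Z r y" by (simp add: Q_set_def)
qed

lemma Q_set_stable:
  "stable_set_with pk T r (Q_set pk T \<Theta> I Z r y)
     ((\<lambda>\<gamma>. (Q_step pk T I Z r y \<gamma>, Ts r \<gamma>)) ` Theta_ext pk T \<Theta> r)"
proof -
  note ext = in_Theta_ext_iff[OF r(1)]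
  let ?Q = "Q_step pk T I Z r y"
  let ?K = "(\<lambda>\<gamma>. (?Q \<gamma>, Ts r \<gamma>)) ` Theta_ext pk T \<Theta> r"
  have "fst ` ?K = Q_set pk T \<Theta> I Z r y"
  proof
    show "fst ` ?K \<subseteq> Q_set pk T \<Theta> I Z r y" using extended_solution(3) ext by auto
    show "Q_set pk T \<Theta> I Z r y \<subseteq> fst ` ?K" by (auto simp: Q_set_def Theta_T_def image_image)
  qed
  moreover have "prob_on (path_alg pk r T T) (?Q \<gamma>)" if "step_structure pk T \<Theta> r \<gamma>" for \<gamma>
    using extended_solution(2)[OF that] by (simp add: is_solution_def)
  moreover have "nonneg_linear_below pk T r s (Ts r \<gamma> s) \<and>
      (\<forall>\<psi>\<in>Bb pk T r T. AE \<omega> in ?Q \<gamma>. real_cond_exp (?Q \<gamma>) (path_alg pk r T s) \<psi> \<omega> = Ts r \<gamma> s \<psi> \<omega>)"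
    if "step_structure pk T \<Theta> r \<gamma>" "s \<in> {r..T}" for \<gamma> s
    using T_step_nonneg_linear_below[OF r(1) that(1)] that(2)
      T_step_cond_exp[OF r(1) that(1) extended_solution(1,2)[OF that(1)]] by auto
  moreover have "Ts r \<gamma> s \<psi> \<omega> = Ts r \<gamma> s (Ts r \<gamma> t \<psi>) \<omega>"
    if "step_structure pk T \<Theta> r \<gamma>" "t \<in> {r..T}" "s \<in> {r..t}" "\<psi> \<in> Bb pk T r T" "\<omega> \<in> \<Omega> r" for \<gamma> s t \<psi> \<omega>
    using T_step_tower[OF r(1) that(1)] that(2-5) by simp
  moreover have "\<exists>\<eta>. step_structure pk T \<Theta> r \<eta> \<and>
      (\<forall>u\<in>{s..T}. \<forall>\<psi>\<in>Bb pk T r T. \<forall>\<omega>\<in>\<Omega> r. Ts r \<eta> u \<psi> \<omega> = Ts r \<delta> u \<psi> \<omega>) \<and>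
      (\<forall>u\<in>{r..<s}. \<forall>\<phi>\<in>Bb pk T r s. \<forall>\<omega>\<in>\<Omega> r. Ts r \<eta> u \<phi> \<omega> = Ts r \<gamma> u \<phi> \<omega>)"
    if \<gamma>: "step_structure pk T \<Theta> r \<gamma>" and \<delta>: "step_structure pk T \<Theta> r \<delta>" and s: "s \<in> {r..T}" for \<gamma> \<delta> s
  proof -
    obtain \<eta> where \<eta>: "step_structure pk T \<Theta> r \<eta>" "splices pk T r s {} \<gamma> \<delta> \<eta>"
      using splice_exists[OF \<gamma> \<delta> s sets.empty_sets] by blast
    show ?thesis
      using splice_operators[OF r(1) \<gamma> \<delta> \<eta> s sets.empty_sets] \<eta>(1) by (intro exI[of _ \<eta>]) simp
  qed
  moreover have "\<exists>\<eta>. step_structure pk T \<Theta> r \<eta> \<and>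
      (\<forall>u\<in>{s..T}. \<forall>\<psi>\<in>Bb pk T r T. \<forall>\<omega>\<in>\<Omega> r.
        Ts r \<eta> u \<psi> \<omega> = indicator A \<omega> * Ts r \<gamma> u \<psi> \<omega> + indicator (- A) \<omega> * Ts r \<delta> u \<psi> \<omega>)"
    if \<gamma>: "step_structure pk T \<Theta> r \<gamma>" and \<delta>: "step_structure pk T \<Theta> r \<delta>" and s: "s \<in> {r..T}"
      and A: "A \<in> \<B> r s" for \<gamma> \<delta> s A
  proof -
    obtain \<eta> where \<eta>: "step_structure pk T \<Theta> r \<eta>" "splices pk T r s A \<gamma> \<delta> \<eta>"
      using splice_exists[OF \<gamma> \<delta> s A] by blast
    show ?thesis
      using splice_operators(1)[OF r(1) \<gamma> \<delta> \<eta> s A] \<eta>(1) by (intro exI[of _ \<eta>]) simp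
  qed
  moreover have ball: "Ball ?K P \<longleftrightarrow> (\<forall>\<gamma>. step_structure pk T \<Theta> r \<gamma> \<longrightarrow> P (?Q \<gamma>, Ts r \<gamma>))"
    and bex: "Bex ?K P \<longleftrightarrow> (\<exists>\<gamma>. step_structure pk T \<Theta> r \<gamma> \<and> P (?Q \<gamma>, Ts r \<gamma>))" for P
    using ext by auto
  ultimately show ?thesis
    unfolding stable_set_with_def ball bex prod.case by simp
qed

end

end

theorem theorem4p2:
  fixes pk :: path_kind and T r :: real and y :: "real ^ 'n::finite"
    and \<Theta> :: "('n, 'e::topological_space) coefficient set"
    and I :: "'k set" and Z :: "('n, 'e, 'k) problems"
  assumes "0 < T" and "0 \<le> r" and "r \<le> T"
    and "Theta_hypothesis pk T \<Theta> I Z"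
    and "\<And>\<gamma>. \<gamma> \<in> Theta_T pk T \<Theta> r \<Longrightarrow> \<exists>!Q. is_solution pk r T I (Z_step Z \<gamma>) y Q"
  shows
    "stable_set_with pk T r (Q_set pk T \<Theta> I Z r y)
       ((\<lambda>\<gamma>. (Q_step pk T I Z r y \<gamma>, T_step pk T I Z r \<gamma>)) ` Theta_ext pk T \<Theta> r) \<and>
     (\<forall>\<gamma>\<in>Theta_T pk T \<Theta> r. \<forall>\<delta>\<in>Theta_T pk T \<Theta> r.
      \<forall>s\<in>{r..T}. \<forall>A\<in>sets (path_alg pk r T s).
        (\<exists>\<kappa>\<in>Theta_T pk T \<Theta> r. splices pk T r s {} \<gamma> \<delta> \<kappa>) \<and>
        (\<forall>\<kappa>\<in>Theta_ext pk T \<Theta> r. splices pk T r s {} \<gamma> \<delta> \<kappa> \<longrightarrow>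
           Q_step pk T I Z r y \<kappa> \<in> Q_set pk T \<Theta> I Z r y \<and>
           (\<forall>u\<in>{s..T}. \<forall>\<psi>\<in>Bb pk T r T. \<forall>\<omega>\<in>Paths pk r T.
              T_step pk T I Z r \<kappa> u \<psi> \<omega> = T_step pk T I Z r \<delta> u \<psi> \<omega>) \<and>
           (\<forall>u\<in>{r..<s}. \<forall>\<phi>\<in>Bb pk T r s. \<forall>\<omega>\<in>Paths pk r T.
              T_step pk T I Z r \<kappa> u \<phi> \<omega> = T_step pk T I Z r \<gamma> u \<phi> \<omega>)) \<and>
        (\<exists>\<eta>\<in>Theta_ext pk T \<Theta> r. splices pk T r s A \<gamma> \<delta> \<eta> \<and> (r < s \<longrightarrow> \<eta> \<in> Theta_T pk T \<Theta> r)) \<and>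
        (\<forall>\<eta>\<in>Theta_ext pk T \<Theta> r. splices pk T r s A \<gamma> \<delta> \<eta> \<longrightarrow>
           Q_step pk T I Z r y \<eta> \<in> Q_set pk T \<Theta> I Z r y \<and>
           (\<forall>u\<in>{s..T}. \<forall>\<psi>\<in>Bb pk T r T. \<forall>\<omega>\<in>Paths pk r T.
              T_step pk T I Z r \<eta> u \<psi> \<omega> =
                indicator A \<omega> * T_step pk T I Z r \<gamma> u \<psi> \<omega> +
                indicator (- A) \<omega> * T_step pk T I Z r \<delta> u \<psi> \<omega>)))"
proof -
  interpret theta_family pk T \<Theta> I Z by unfold_locales (rule assms(4))
  note r = assms(2,3) and ext = in_Theta_ext_iff[OF assms(2)]
  note solution = extended_solution[OF r assms(5)]
  show ?thesis
  proof (rule conjI, rule Q_set_stable[OF r assms(5)], assumption, intro ballI conjI impI)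
    fix \<gamma> \<delta> s and A :: "'n path set"
    assume \<gamma>T: "\<gamma> \<in> Theta_T pk T \<Theta> r" and \<delta>T: "\<delta> \<in> Theta_T pk T \<Theta> r"
      and s: "s \<in> {r..T}" and A: "A \<in> sets (path_alg pk r T s)"
    have \<gamma>: "step_structure pk T \<Theta> r \<gamma>" "idx \<gamma> 0 = {1}" and \<delta>: "step_structure pk T \<Theta> r \<delta>"
      using \<gamma>T \<delta>T ext by (auto simp: Theta_T_def)
    have splice: "\<exists>\<eta>\<in>Theta_ext pk T \<Theta> r. splices pk T r s A \<gamma> \<delta> \<eta> \<and> (r < s \<longrightarrow> \<eta> \<in> Theta_T pk T \<Theta> r)"
      if A: "A \<in> sets (path_alg pk r T s)" for A
    proof -
      obtain \<eta> where "step_structure pk T \<Theta> r \<eta>" "splices pk T r s A \<gamma> \<delta> \<eta>"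
        "r < s \<Longrightarrow> idx \<eta> 0 = idx \<gamma> 0"
        using splice_exists[OF \<gamma>(1) \<delta> s A] by blast
      with \<gamma>(2) show ?thesis using ext by (intro bexI[of _ \<eta>]) (auto simp: Theta_T_def)
    qed
    show "\<exists>\<kappa>\<in>Theta_T pk T \<Theta> r. splices pk T r s {} \<gamma> \<delta> \<kappa>"
    proof (cases "r < s")
      case True
      then show ?thesis using splice[OF sets.empty_sets] by blast
    next
      \<comment> \<open>splicing at time \<open>r\<close> leaves only the second process, which starts with a single cell\<close>
      case False
      with s have "s = r" by simp
      with \<delta>T show ?thesis by (intro bexI[of _ \<delta>]) (simp_all add: splices_def)
    qed
    show "\<exists>\<eta>\<in>Theta_ext pk T \<Theta> r. splices pk T r s A \<gamma> \<delta> \<eta> \<and> (r < s \<longrightarrow> \<eta> \<in> Theta_T pk T \<Theta> r)"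
      by (rule splice[OF A])
    show member: "Q_step pk T I Z r y \<eta> \<in> Q_set pk T \<Theta> I Z r y" if "\<eta> \<in> Theta_ext pk T \<Theta> r" for \<eta>
      using solution(3)[of \<eta>] that ext by simp
    show "Q_step pk T I Z r y \<eta> \<in> Q_set pk T \<Theta> I Z r y" if "\<eta> \<in> Theta_ext pk T \<Theta> r" for \<eta>
      using that by (rule member)
    show "T_step pk T I Z r \<kappa> u \<psi> \<omega> = T_step pk T I Z r \<delta> u \<psi> \<omega>"
      if "\<kappa> \<in> Theta_ext pk T \<Theta> r" "splices pk T r s {} \<gamma> \<delta> \<kappa>"
        "u \<in> {s..T}" "\<psi> \<in> Bb pk T r T" "\<omega> \<in> Paths pk r T" for \<kappa> u \<psi> \<omega>
      using splice_operators(1)[OF r(1) \<gamma>(1) \<delta> _ that(2) s sets.empty_sets that(5,3,4)] that(1) ext by simp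
    show "T_step pk T I Z r \<kappa> u \<phi> \<omega> = T_step pk T I Z r \<gamma> u \<phi> \<omega>"
      if "\<kappa> \<in> Theta_ext pk T \<Theta> r" "splices pk T r s {} \<gamma> \<delta> \<kappa>"
        "u \<in> {r..<s}" "\<phi> \<in> Bb pk T r s" "\<omega> \<in> Paths pk r T" for \<kappa> u \<phi> \<omega>
      using splice_operators(2)[OF r(1) \<gamma>(1) \<delta> _ that(2) s sets.empty_sets that(5,3,4)] that(1) ext by simp
    show "T_step pk T I Z r \<eta> u \<psi> \<omega> =
        indicator A \<omega> * T_step pk T I Z r \<gamma> u \<psi> \<omega> + indicator (- A) \<omega> * T_step pk T I Z r \<delta> u \<psi> \<omega>"
      if "\<eta> \<in> Theta_ext pk T \<Theta> r" "splices pk T r s A \<gamma> \<delta> \<eta>"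
        "u \<in> {s..T}" "\<psi> \<in> Bb pk T r T" "\<omega> \<in> Paths pk r T" for \<eta> u \<psi> \<omega>
      using splice_operators(1)[OF r(1) \<gamma>(1) \<delta> _ that(2) s A that(5,3,4)] that(1) ext by simp
  qed
qed

end
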